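(* Assume $N\ge n\ge r$. Then the functor $\mathsf G_\varepsilon:\mathcal S_\vartriangle(N,r)_\varepsilon\text{-}\mathsf{mod}\to\mathcal S_\vartriangle(n,r)_\varepsilon\text{-}\mathsf{mod}$, $V\mapsto eV$, is an equivalence of categories.
   Context: Let $v$ be an indeterminate, $\mathcal Z=\mathbb C[v,v^{-1}]$, $\mathbb N=\{0,1,2,\dots\}$. Let $\varepsilon\in\mathbb C$ be a primitive $l'$-th root of $1$; $\mathbb C$ is a $\mathcal Z$-module via $v\mapsto\varepsilon$. $n$, $N$, $r$ are positive integers. For an algebra $B$, $B\text{-}\mathsf{mod}$ is the category of finite dimensional left $B$-modules. The extended affine Hecke algebra $H_{\mathcal Z}=\mathcal H_\vartriangle(r)_{\mathcal Z}$ is the $\mathcal Z$-algebra generated by $T_i$ ($1\le i\le r-1$), $X_j^{\pm1}$ ($1\le j\le r$) with relations $(T_i+1)(T_i-v^2)=0$, $T_iT_{i+1}T_i=T_{i+1}T_iT_{i+1}$, $T_iT_j=T_jT_i$ ($|i-j|>1$), $X_iX_i^{-1}=1=X_i^{-1}X_i$, $X_iX_j=X_jX_i$, $T_iX_iT_i=v^2X_{i+1}$, $X_jT_i=T_iX_j$ ($j\ne i,i+1$). Let $\Omega_{\mathcal Z}$ be the free $\mathcal Z$-module with basis $\{\omega_i\mid i\in\mathbb Z\}$, $\omega_{\mathbf i}=\omega_{i_1}\otimes\cdots\otimes\omega_{i_r}$ for $\mathbf i\in\mathbb Z^r$. Depending on $n$, $\Omega_{\mathcal Z}^{\otimes r}$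 is a right $H_{\mathcal Z}$-module: $\omega_{\mathbf i}X_t^{-1}$ is obtained from $\omega_{\mathbf i}$ by replacing $i_t$ with $i_t+n$ (all $\mathbf i\in\mathbb Z^r$), and for $\mathbf i$ with all $1\le i_k\le n$, $\omega_{\mathbf i}T_k=v^2\omega_{\mathbf i}$ if $i_k=i_{k+1}$; $=v\,\omega_{\mathbf is_k}$ if $i_k<i_{k+1}$; $=v\,\omega_{\mathbf is_k}+(v^2-1)\omega_{\mathbf i}$ if $i_{k+1}<i_k$, where $\mathbf is_k$ swaps the $k$-th and $(k+1)$-st entries. The affine quantum Schur algebra is $\mathcal S_\vartriangle(n,r)_{\mathcal Z}=\mathrm{End}_{H_{\mathcal Z}}(\Omega_{\mathcal Z}^{\otimes r})$, and $\mathcal S_\vartriangle(n,r)_\varepsilon=\mathcal S_\vartriangle(n,r)_{\mathcal Z}\otimes_{\mathcal Z}\mathbb C$. $\Lambda(n,r)=\{\lambda\in\mathbb N^n\mid\sum_i\lambda_i=r\}$. For $\lambda\in\Lambda(n,r)$, $\mathfrak l_\lambda\in\mathcal S_\vartriangle(n,r)_{\mathcal Z}$ is the idempotent with $\mathfrak l_\lambda\omega_{\mathbf i}=\omega_{\mathbf i}$ if for every $1\le j\le n$ exactly $\lambda_j$ of the entries of $\mathbf i$ are congruent to $j$ mod $n$, and $\mathfrak l_\lambda\omega_{\mathbf i}=0$ otherwise. For $N\ge n$ and $\mu\in\Lambda(n,r)$ let $\widetilde\mu=(\mu_1,\dots,\mu_n,0,\dots,0)\in\Lambda(N,r)$, and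 $e=\sum_{\mu\in\Lambda(n,r)}\mathfrak l_{\widetilde\mu}\in\mathcal S_\vartriangle(N,r)_{\mathcal Z}$; its image in $\mathcal S_\vartriangle(N,r)_\varepsilon$ is also denoted $e$. The algebra $e\,\mathcal S_\vartriangle(N,r)_\varepsilon\,e$ is identified with $\mathcal S_\vartriangle(n,r)_\varepsilon$ by the natural isomorphism (the base change of the one over $\mathcal Z$) induced by the $H_{\mathcal Z}$-module isomorphism from the tensor space for $n$ onto $e$ times the tensor space for $N$ given on factors by $\omega_{j+an}\mapsto\omega_{j+aN}$ ($1\le j\le n$, $a\in\mathbb Z$). *)

theory Defs
  imports
    Complex_Main
    "HOL-Library.Poly_Mapping"
    "HOL-Algebra.QuotRing"
    "HOL-Algebra.Generated_Groups"
    "HOL-Algebra.Module"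
begin

section \<open>Categories\<close>

text \<open>
  Hom sets of different pairs of objects may overlap, so composition and the arrow part of a
  functor take the objects involved as additional arguments.
\<close>

record ('o, 'f) cat =
  Ob :: "'o set"
  Hom :: "'o \<Rightarrow> 'o \<Rightarrow> 'f set"
  Comp :: "'o \<Rightarrow> 'o \<Rightarrow> 'o \<Rightarrow> 'f \<Rightarrow> 'f \<Rightarrow> 'f"
  Ident :: "'o \<Rightarrow> 'f"

locale category =
  fixes C :: "('o, 'f) cat"
  assumes Ident_in_Hom: "X \<in> Ob C \<Longrightarrow> Ident C X \<in> Hom C X X"
    and Comp_in_Hom:
      "\<lbrakk>X \<in> Ob C; Y \<in> Ob C; Z \<in> Ob C; f \<in> Hom C X Y; g \<in> Hom C Y Z\<rbrakk>
        \<Longrightarrow> Comp C X Y Z g f \<in> Hom C X Z"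
    and Comp_Ident: "\<lbrakk>X \<in> Ob C; Y \<in> Ob C; f \<in> Hom C X Y\<rbrakk> \<Longrightarrow> Comp C X X Y f (Ident C X) = f"
    and Ident_Comp: "\<lbrakk>X \<in> Ob C; Y \<in> Ob C; f \<in> Hom C X Y\<rbrakk> \<Longrightarrow> Comp C X Y Y (Ident C Y) f = f"
    and Comp_assoc:
      "\<lbrakk>W \<in> Ob C; X \<in> Ob C; Y \<in> Ob C; Z \<in> Ob C; f \<in> Hom C W X; g \<in> Hom C X Y; h \<in> Hom C Y Z\<rbrakk>
        \<Longrightarrow> Comp C W Y Z h (Comp C W X Y g f) = Comp C W X Z (Comp C X Y Z h g) f"

locale cat_functor = C: category C + D: category D
  for C :: "('o, 'f) cat" and D :: "('p, 'g) cat" +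
  fixes F :: "'o \<Rightarrow> 'p" and Fm :: "'o \<Rightarrow> 'o \<Rightarrow> 'f \<Rightarrow> 'g"
  assumes F_Ob: "X \<in> Ob C \<Longrightarrow> F X \<in> Ob D"
    and Fm_Hom: "\<lbrakk>X \<in> Ob C; Y \<in> Ob C; f \<in> Hom C X Y\<rbrakk> \<Longrightarrow> Fm X Y f \<in> Hom D (F X) (F Y)"
    and Fm_Ident: "X \<in> Ob C \<Longrightarrow> Fm X X (Ident C X) = Ident D (F X)"
    and Fm_Comp:
      "\<lbrakk>X \<in> Ob C; Y \<in> Ob C; Z \<in> Ob C; f \<in> Hom C X Y; g \<in> Hom C Y Z\<rbrakk>
        \<Longrightarrow> Fm X Z (Comp C X Y Z g f) = Comp D (F X) (F Y) (F Z) (Fm Y Z g) (Fm X Y f)"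

definition is_iso :: "('o, 'f) cat \<Rightarrow> 'o \<Rightarrow> 'o \<Rightarrow> 'f \<Rightarrow> bool" where
  "is_iso C X Y f \<longleftrightarrow> f \<in> Hom C X Y \<and>
     (\<exists>g \<in> Hom C Y X. Comp C X Y X g f = Ident C X \<and> Comp C Y X Y f g = Ident C Y)"

definition natural_iso ::
  "('o, 'f) cat \<Rightarrow> ('p, 'g) cat \<Rightarrow> ('o \<Rightarrow> 'p) \<Rightarrow> ('o \<Rightarrow> 'o \<Rightarrow> 'f \<Rightarrow> 'g)
    \<Rightarrow> ('o \<Rightarrow> 'p) \<Rightarrow> ('o \<Rightarrow> 'o \<Rightarrow> 'f \<Rightarrow> 'g) \<Rightarrow> ('o \<Rightarrow> 'g) \<Rightarrow> bool" where
  "natural_iso C D F Fm G Gm \<eta> \<longleftrightarrow>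
     (\<forall>X \<in> Ob C. is_iso D (F X) (G X) (\<eta> X)) \<and>
     (\<forall>X \<in> Ob C. \<forall>Y \<in> Ob C. \<forall>f \<in> Hom C X Y.
        Comp D (F X) (F Y) (G Y) (\<eta> Y) (Fm X Y f) = Comp D (F X) (G X) (G Y) (Gm X Y f) (\<eta> X))"

definition equivalence_of_categories ::
  "('o, 'f) cat \<Rightarrow> ('p, 'g) cat \<Rightarrow> ('o \<Rightarrow> 'p) \<Rightarrow> ('o \<Rightarrow> 'o \<Rightarrow> 'f \<Rightarrow> 'g) \<Rightarrow> bool" where
  "equivalence_of_categories C D F Fm \<longleftrightarrow>
     cat_functor C D F Fm \<and>
     (\<exists>G Gm. cat_functor D C G Gm \<and>
        (\<exists>\<eta>. natural_iso C C (\<lambda>X. X) (\<lambda>X Y f. f) (\<lambda>X. G (F X)) (\<lambda>X Y f. Gm (F X) (F Y) (Fm X Y f)) \<eta>) \<and>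
        (\<exists>\<theta>. natural_iso D D (\<lambda>X. F (G X)) (\<lambda>X Y f. Fm (G X) (G Y) (Gm X Y f)) (\<lambda>X. X) (\<lambda>X Y f. f) \<theta>))"


section \<open>Finite dimensional modules over a complex algebra\<close>

text \<open>
  An algebra over a commutative ring is a \<^typ>\<open>('r, 'b) module\<close> record: its ring fields give the
  (not necessarily commutative) ring and \<^const>\<open>smult\<close> the scalars. The locale
  \<^locale>\<open>module\<close> of the library demands a commutative ring of scalars, hence the following.
  For modules, the record fields \<^const>\<open>mult\<close> and \<^const>\<open>one\<close> carry no information.
\<close>

locale left_module = B?: ring B + V?: abelian_group V
  for B :: "('b, 'c) ring_scheme" and V :: "('b, 'm, 'd) module_scheme" +
  assumes lm_closed: "\<lbrakk>b \<in> carrier B; x \<in> carrier V\<rbrakk> \<Longrightarrow> b \<odot>\<^bsub>V\<^esub> x \<in> carrier V"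
    and lm_l_distr: "\<lbrakk>a \<in> carrier B; b \<in> carrier B; x \<in> carrier V\<rbrakk>
          \<Longrightarrow> (a \<oplus>\<^bsub>B\<^esub> b) \<odot>\<^bsub>V\<^esub> x = a \<odot>\<^bsub>V\<^esub> x \<oplus>\<^bsub>V\<^esub> b \<odot>\<^bsub>V\<^esub> x"
    and lm_r_distr: "\<lbrakk>a \<in> carrier B; x \<in> carrier V; y \<in> carrier V\<rbrakk>
          \<Longrightarrow> a \<odot>\<^bsub>V\<^esub> (x \<oplus>\<^bsub>V\<^esub> y) = a \<odot>\<^bsub>V\<^esub> x \<oplus>\<^bsub>V\<^esub> a \<odot>\<^bsub>V\<^esub> y"
    and lm_assoc: "\<lbrakk>a \<in> carrier B; b \<in> carrier B; x \<in> carrier V\<rbrakk>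
          \<Longrightarrow> (a \<otimes>\<^bsub>B\<^esub> b) \<odot>\<^bsub>V\<^esub> x = a \<odot>\<^bsub>V\<^esub> (b \<odot>\<^bsub>V\<^esub> x)"
    and lm_one: "x \<in> carrier V \<Longrightarrow> \<one>\<^bsub>B\<^esub> \<odot>\<^bsub>V\<^esub> x = x"

text \<open>A complex number \<open>c\<close> acts on a module over the algebra \<open>B\<close> as \<open>c \<cdot> 1\<^sub>B\<close>.\<close>

definition fin_dim :: "(complex, 'b) module \<Rightarrow> ('b, 'm) module \<Rightarrow> bool" where
  "fin_dim B V \<longleftrightarrow>
     (\<exists>S. finite S \<and> S \<subseteq> carrier V \<and>
        (\<forall>x \<in> carrier V. \<exists>c :: 'm \<Rightarrow> complex.
           x = finsum V (\<lambda>u. (c u \<odot>\<^bsub>B\<^esub> \<one>\<^bsub>B\<^esub>) \<odot>\<^bsub>V\<^esub> u) S))"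

definition module_hom :: "('b, 'c) ring_scheme \<Rightarrow> ('b, 'm) module \<Rightarrow> ('b, 'm) module \<Rightarrow> ('m \<Rightarrow> 'm) set" where
  "module_hom B V W =
     {f \<in> carrier V \<rightarrow>\<^sub>E carrier W.
        (\<forall>x \<in> carrier V. \<forall>y \<in> carrier V. f (x \<oplus>\<^bsub>V\<^esub> y) = f x \<oplus>\<^bsub>W\<^esub> f y) \<and>
        (\<forall>b \<in> carrier B. \<forall>x \<in> carrier V. f (b \<odot>\<^bsub>V\<^esub> x) = b \<odot>\<^bsub>W\<^esub> f x)}"

text \<open>
  The objects are the modules whose underlying set is contained in the type \<^typ>\<open>'m\<close>, which
  plays the role of a universe. As soon as \<^typ>\<open>'m\<close> has the cardinality of the continuum,
  every finite dimensional module is isomorphic to one of these.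
\<close>

definition fdmod :: "(complex, 'b) module \<Rightarrow> (('b, 'm) module, 'm \<Rightarrow> 'm) cat" where
  "fdmod B =
     \<lparr>Ob = {V. left_module B V \<and> fin_dim B V},
      Hom = module_hom B,
      Comp = (\<lambda>X Y Z g f. compose (carrier X) g f),
      Ident = (\<lambda>X. \<lambda>x \<in> carrier X. x)\<rparr>"


section \<open>Free modules, monoid algebras, quotients and base change\<close>

text \<open>
  The type \<^typ>\<open>'a \<Rightarrow>\<^sub>0 'k\<close> is the free \<^typ>\<open>'k\<close>-module with basis
  \<open>single a 1\<close>, indexed by \<open>a :: 'a\<close>.
\<close>

definition scale :: "'k \<Rightarrow> ('a \<Rightarrow>\<^sub>0 'k) \<Rightarrow> ('a \<Rightarrow>\<^sub>0 'k::comm_ring_1)" where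
  "scale c x = Poly_Mapping.map ((*) c) x"

abbreviation basis :: "'a \<Rightarrow> ('a \<Rightarrow>\<^sub>0 'k::comm_ring_1)" where
  "basis a \<equiv> Poly_Mapping.single a 1"

definition lin_ext :: "('a \<Rightarrow> ('b \<Rightarrow>\<^sub>0 'k)) \<Rightarrow> ('a \<Rightarrow>\<^sub>0 'k) \<Rightarrow> ('b \<Rightarrow>\<^sub>0 'k::comm_ring_1)" where
  "lin_ext g x = (\<Sum>a \<in> Poly_Mapping.keys x. scale (Poly_Mapping.lookup x a) (g a))"

definition monoid_algebra :: "('a, 'c) monoid_scheme \<Rightarrow> ('k::comm_ring_1, 'a \<Rightarrow>\<^sub>0 'k) module" where
  "monoid_algebra M =
     \<lparr>carrier = {x. Poly_Mapping.keys x \<subseteq> carrier M},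
      mult = (\<lambda>x y. lin_ext (\<lambda>a. lin_ext (\<lambda>b. basis (a \<otimes>\<^bsub>M\<^esub> b)) y) x),
      one = basis \<one>\<^bsub>M\<^esub>,
      zero = 0,
      add = (+),
      smult = scale\<rparr>"

definition free_algebra :: "'g set \<Rightarrow> ('k::comm_ring_1, 'g list \<Rightarrow>\<^sub>0 'k) module" where
  "free_algebra L = monoid_algebra \<lparr>carrier = lists L, mult = (@), one = []\<rparr>"

definition quotient_algebra :: "('k, 'a) module \<Rightarrow> 'a set \<Rightarrow> ('k, 'a set) module" where
  "quotient_algebra A I =
     ring.extend (A Quot I) (module.fields (\<lambda>c X. \<Union>x \<in> X. I +>\<^bsub>A\<^esub> (c \<odot>\<^bsub>A\<^esub> x)))"

definition complex_ring :: "complex ring" where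
  "complex_ring = \<lparr>carrier = UNIV, mult = (*), one = 1, zero = 0, add = (+)\<rparr>"

text \<open>
  For an algebra \<open>A\<close> over \<^typ>\<open>'z\<close> and a ring homomorphism \<open>\<phi>\<close> from \<^typ>\<open>'z\<close> to the complex
  numbers, the tensor product of \<open>A\<close> with the complex numbers over \<^typ>\<open>'z\<close>: the free abelian
  group on pairs \<open>(a, c)\<close> modulo the usual relations, with
  \<open>(a \<otimes> c) (b \<otimes> d) = ab \<otimes> cd\<close>.
\<close>

definition pairs_ring :: "('z, 'a) module \<Rightarrow> (int, 'a \<times> complex \<Rightarrow>\<^sub>0 int) module" where
  "pairs_ring A = monoid_algebra (A \<times>\<times> complex_ring)"

definition tensor_relations :: "('z \<Rightarrow> complex) \<Rightarrow> ('z, 'a) module \<Rightarrow> ('a \<times> complex \<Rightarrow>\<^sub>0 int) set" where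
  "tensor_relations \<phi> A =
     {basis (a \<oplus>\<^bsub>A\<^esub> b, c) - basis (a, c) - basis (b, c) | a b c. a \<in> carrier A \<and> b \<in> carrier A} \<union>
     {basis (a, c + d) - basis (a, c) - basis (a, d) | a c d. a \<in> carrier A} \<union>
     {basis (z \<odot>\<^bsub>A\<^esub> a, c) - basis (a, \<phi> z * c) | z a c. a \<in> carrier A}"

definition tensor_kernel :: "('z \<Rightarrow> complex) \<Rightarrow> ('z, 'a) module \<Rightarrow> ('a \<times> complex \<Rightarrow>\<^sub>0 int) set" where
  "tensor_kernel \<phi> A = generate (add_monoid (pairs_ring A)) (tensor_relations \<phi> A)"

definition pure_tensor ::
  "('z \<Rightarrow> complex) \<Rightarrow> ('z, 'a) module \<Rightarrow> 'a \<Rightarrow> complex \<Rightarrow> ('a \<times> complex \<Rightarrow>\<^sub>0 int) set" where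
  "pure_tensor \<phi> A a c = tensor_kernel \<phi> A +>\<^bsub>pairs_ring A\<^esub> basis (a, c)"

definition base_change ::
  "('z \<Rightarrow> complex) \<Rightarrow> ('z, 'a) module \<Rightarrow> (complex, ('a \<times> complex \<Rightarrow>\<^sub>0 int) set) module" where
  "base_change \<phi> A =
     ring.extend (pairs_ring A Quot tensor_kernel \<phi> A)
       (module.fields (\<lambda>c X. \<Union>x \<in> X.
          tensor_kernel \<phi> A +>\<^bsub>pairs_ring A\<^esub> lin_ext (\<lambda>(a, d). basis (a, c * d)) x))"

text \<open>\<open>h \<otimes> id\<close> for a linear map \<open>h\<close> with values in \<open>A\<close>\<close>

definition base_change_map ::
  "('z \<Rightarrow> complex) \<Rightarrow> ('z, 'a) module \<Rightarrow> ('b \<Rightarrow> 'a)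
    \<Rightarrow> ('b \<times> complex \<Rightarrow>\<^sub>0 int) set \<Rightarrow> ('a \<times> complex \<Rightarrow>\<^sub>0 int) set" where
  "base_change_map \<phi> A h X = (\<Union>x \<in> X.
     tensor_kernel \<phi> A +>\<^bsub>pairs_ring A\<^esub> lin_ext (\<lambda>(b, c). basis (h b, c)) x)"


section \<open>The extended affine Hecke algebra\<close>

text \<open>Laurent polynomials over the complex numbers, i.e. the group algebra of the integers\<close>

type_synonym laurent = "int \<Rightarrow>\<^sub>0 complex"

definition v :: laurent where
  "v = Poly_Mapping.single 1 1"

definition laurent_eval :: "complex \<Rightarrow> laurent \<Rightarrow> complex" where
  "laurent_eval \<epsilon> p = (\<Sum>k \<in> Poly_Mapping.keys p. Poly_Mapping.lookup p k * \<epsilon> powi k)"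

definition primitive_root_of_unity :: "nat \<Rightarrow> complex \<Rightarrow> bool" where
  "primitive_root_of_unity l \<epsilon> \<longleftrightarrow> 0 < l \<and> \<epsilon> ^ l = 1 \<and> (\<forall>k. 0 < k \<and> k < l \<longrightarrow> \<epsilon> ^ k \<noteq> 1)"

datatype hecke_gen = T nat | X nat | Xinv nat

definition hecke_gens :: "nat \<Rightarrow> hecke_gen set" where
  "hecke_gens r = T ` {1..<r} \<union> X ` {1..r} \<union> Xinv ` {1..r}"

definition free_hecke :: "nat \<Rightarrow> (laurent, hecke_gen list \<Rightarrow>\<^sub>0 laurent) module" where
  "free_hecke r = free_algebra (hecke_gens r)"

definition hecke_relations :: "nat \<Rightarrow> (hecke_gen list \<Rightarrow>\<^sub>0 laurent) set" where
  "hecke_relations r =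
     {(basis [T i] + basis []) \<otimes>\<^bsub>free_hecke r\<^esub> (basis [T i] - scale (v^2) (basis [])) | i. i \<in> {1..<r}} \<union>
     {basis [T i, T (i+1), T i] - basis [T (i+1), T i, T (i+1)] | i. i \<in> {1..<r} \<and> i + 1 \<in> {1..<r}} \<union>
     {basis [T i, T j] - basis [T j, T i] | i j. i \<in> {1..<r} \<and> j \<in> {1..<r} \<and> (i + 1 < j \<or> j + 1 < i)} \<union>
     {basis [X i, Xinv i] - basis [] | i. i \<in> {1..r}} \<union>
     {basis [Xinv i, X i] - basis [] | i. i \<in> {1..r}} \<union>
     {basis [X i, X j] - basis [X j, X i] | i j. i \<in> {1..r} \<and> j \<in> {1..r}} \<union>
     {basis [T i, X i, T i] - scale (v^2) (basis [X (i+1)]) | i. i \<in> {1..<r}} \<union>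
     {basis [X j, T i] - basis [T i, X j] | i j. i \<in> {1..<r} \<and> j \<in> {1..r} \<and> j \<noteq> i \<and> j \<noteq> i + 1}"

definition hecke_ideal :: "nat \<Rightarrow> (hecke_gen list \<Rightarrow>\<^sub>0 laurent) set" where
  "hecke_ideal r = Idl\<^bsub>free_hecke r\<^esub> (hecke_relations r)"

type_synonym hecke_elt = "(hecke_gen list \<Rightarrow>\<^sub>0 laurent) set"

definition hecke :: "nat \<Rightarrow> (laurent, hecke_elt) module" where
  "hecke r = quotient_algebra (free_hecke r) (hecke_ideal r)"

definition hgen :: "nat \<Rightarrow> hecke_gen \<Rightarrow> hecke_elt" where
  "hgen r g = hecke_ideal r +>\<^bsub>free_hecke r\<^esub> basis [g]"


section \<open>Tensor space and the affine quantum Schur algebra\<close>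

text \<open>
  The \<open>r\<close>-th tensor power of the free module on the integers is the free module on the integer
  lists of length \<open>r\<close>; the \<open>t\<close>-th entry of \<open>i\<close> is \<open>i ! (t - 1)\<close>.
\<close>

type_synonym tens = "int list \<Rightarrow>\<^sub>0 laurent"

definition tensor_space :: "nat \<Rightarrow> tens set" where
  "tensor_space r = {x. Poly_Mapping.keys x \<subseteq> {i. length i = r}}"

abbreviation \<omega> :: "int list \<Rightarrow> tens" where
  "\<omega> i \<equiv> basis i"

definition swap :: "nat \<Rightarrow> int list \<Rightarrow> int list" where
  "swap k i = i[k - 1 := i ! k, k := i ! (k - 1)]"

text \<open>
  \<open>act x h\<close> is the right action \<open>x h\<close> of the Hecke algebra on tensor space. The formulas of the
  last two assumptions determine the right module structure uniquely: every \<open>\<omega> i\<close> is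
  obtained from one with all entries in \<open>{1..n}\<close> by a monomial in the \<open>X\<close>'s, and in the Hecke
  algebra \<open>T\<^sub>k\<close> can be moved to the left of all \<open>X\<close>'s.
\<close>

locale affine_tensor_module =
  fixes n r :: nat and act :: "tens \<Rightarrow> hecke_elt \<Rightarrow> tens"
  assumes act_closed:
      "\<lbrakk>x \<in> tensor_space r; h \<in> carrier (hecke r)\<rbrakk> \<Longrightarrow> act x h \<in> tensor_space r"
    and act_add_left:
      "\<lbrakk>x \<in> tensor_space r; y \<in> tensor_space r; h \<in> carrier (hecke r)\<rbrakk>
        \<Longrightarrow> act (x + y) h = act x h + act y h"
    and act_add_right:
      "\<lbrakk>x \<in> tensor_space r; h \<in> carrier (hecke r); h' \<in> carrier (hecke r)\<rbrakk>
        \<Longrightarrow> act x (h \<oplus>\<^bsub>hecke r\<^esub> h') = act x h + act x h'"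
    and act_scale_left:
      "\<lbrakk>x \<in> tensor_space r; h \<in> carrier (hecke r)\<rbrakk> \<Longrightarrow> act (scale z x) h = scale z (act x h)"
    and act_scale_right:
      "\<lbrakk>x \<in> tensor_space r; h \<in> carrier (hecke r)\<rbrakk> \<Longrightarrow> act x (z \<odot>\<^bsub>hecke r\<^esub> h) = scale z (act x h)"
    and act_mult:
      "\<lbrakk>x \<in> tensor_space r; h \<in> carrier (hecke r); h' \<in> carrier (hecke r)\<rbrakk>
        \<Longrightarrow> act x (h \<otimes>\<^bsub>hecke r\<^esub> h') = act (act x h) h'"
    and act_one: "x \<in> tensor_space r \<Longrightarrow> act x \<one>\<^bsub>hecke r\<^esub> = x"
    and act_Xinv:
      "\<lbrakk>length i = r; t \<in> {1..r}\<rbrakk>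
        \<Longrightarrow> act (\<omega> i) (hgen r (Xinv t)) = \<omega> (i[t - 1 := i ! (t - 1) + int n])"
    and act_T:
      "\<lbrakk>length i = r; set i \<subseteq> {1..int n}; k \<in> {1..<r}\<rbrakk>
        \<Longrightarrow> act (\<omega> i) (hgen r (T k)) =
          (if i ! (k - 1) = i ! k then scale (v^2) (\<omega> i)
           else if i ! (k - 1) < i ! k then scale v (\<omega> (swap k i))
           else scale v (\<omega> (swap k i)) + scale (v^2 - 1) (\<omega> i))"

text \<open>
  The affine quantum Schur algebra over the Laurent polynomials: endomorphisms of tensor space
  with the Hecke action \<open>act\<close> (through which it depends on \<open>n\<close>).
\<close>

definition schur :: "nat \<Rightarrow> (tens \<Rightarrow> hecke_elt \<Rightarrow> tens) \<Rightarrow> (laurent, tens \<Rightarrow> tens) module" where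
  "schur r act =
     \<lparr>carrier = {f \<in> tensor_space r \<rightarrow>\<^sub>E tensor_space r.
        (\<forall>x \<in> tensor_space r. \<forall>y \<in> tensor_space r. f (x + y) = f x + f y) \<and>
        (\<forall>z. \<forall>x \<in> tensor_space r. f (scale z x) = scale z (f x)) \<and>
        (\<forall>h \<in> carrier (hecke r). \<forall>x \<in> tensor_space r. f (act x h) = act (f x) h)},
      mult = compose (tensor_space r),
      one = (\<lambda>x \<in> tensor_space r. x),
      zero = (\<lambda>x \<in> tensor_space r. 0),
      add = (\<lambda>f g. \<lambda>x \<in> tensor_space r. f x + g x),
      smult = (\<lambda>z f. \<lambda>x \<in> tensor_space r. scale z (f x))\<rparr>"

type_synonym schur_eps = "((tens \<Rightarrow> tens) \<times> complex \<Rightarrow>\<^sub>0 int) set"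

definition schur_at :: "complex \<Rightarrow> nat \<Rightarrow> (tens \<Rightarrow> hecke_elt \<Rightarrow> tens) \<Rightarrow> (complex, schur_eps) module" where
  "schur_at \<epsilon> r act = base_change (laurent_eval \<epsilon>) (schur r act)"


section \<open>The idempotent and the functor\<close>

definition compositions :: "nat \<Rightarrow> nat \<Rightarrow> nat list set" where
  "compositions n r = {\<mu>. length \<mu> = n \<and> sum_list \<mu> = r}"

definition weight_idem :: "nat \<Rightarrow> nat \<Rightarrow> nat list \<Rightarrow> tens \<Rightarrow> tens" where
  "weight_idem n r \<mu> = restrict (lin_ext (\<lambda>i.
     if \<forall>j \<in> {1..n}. card {t \<in> {1..r}. i ! (t - 1) mod int n = int j mod int n} = \<mu> ! (j - 1)
     then \<omega> i else 0)) (tensor_space r)"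

definition corner_idem :: "nat \<Rightarrow> nat \<Rightarrow> nat \<Rightarrow> (tens \<Rightarrow> hecke_elt \<Rightarrow> tens) \<Rightarrow> tens \<Rightarrow> tens" where
  "corner_idem n N r act =
     finsum (schur r act) (\<lambda>\<mu>. weight_idem N r (\<mu> @ replicate (N - n) 0)) (compositions n r)"

definition corner_idem_at :: "complex \<Rightarrow> nat \<Rightarrow> nat \<Rightarrow> nat \<Rightarrow> (tens \<Rightarrow> hecke_elt \<Rightarrow> tens) \<Rightarrow> schur_eps" where
  "corner_idem_at \<epsilon> n N r act = pure_tensor (laurent_eval \<epsilon>) (schur r act) (corner_idem n N r act) 1"

text \<open>Sends \<open>j + a n\<close> to \<open>j + a N\<close> for \<open>1 \<le> j \<le> n\<close>.\<close>

definition relabel :: "nat \<Rightarrow> nat \<Rightarrow> int \<Rightarrow> int" where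
  "relabel n N i = ((i - 1) mod int n + 1) + ((i - 1) div int n) * int N"

definition relabel_tens :: "nat \<Rightarrow> nat \<Rightarrow> tens \<Rightarrow> tens" where
  "relabel_tens n N = lin_ext (\<lambda>i. \<omega> (map (relabel n N) i))"

text \<open>
  The isomorphism from the Schur algebra for \<open>n\<close> onto the corner \<open>e S e\<close> of the one for \<open>N\<close>:
  transport along \<^const>\<open>relabel_tens\<close>, which maps the tensor space for \<open>n\<close> bijectively onto
  \<open>e\<close> times that for \<open>N\<close>. Here \<open>act\<close> is the action for \<open>N\<close>.
\<close>

definition corner_iso ::
  "nat \<Rightarrow> nat \<Rightarrow> nat \<Rightarrow> (tens \<Rightarrow> hecke_elt \<Rightarrow> tens) \<Rightarrow> (tens \<Rightarrow> tens) \<Rightarrow> tens \<Rightarrow> tens" where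
  "corner_iso n N r act f = (\<lambda>x \<in> tensor_space r.
     relabel_tens n N (f (inv_into (tensor_space r) (relabel_tens n N) (corner_idem n N r act x))))"

definition corner_iso_at ::
  "complex \<Rightarrow> nat \<Rightarrow> nat \<Rightarrow> nat \<Rightarrow> (tens \<Rightarrow> hecke_elt \<Rightarrow> tens) \<Rightarrow> schur_eps \<Rightarrow> schur_eps" where
  "corner_iso_at \<epsilon> n N r act =
     base_change_map (laurent_eval \<epsilon>) (schur r act) (corner_iso n N r act)"

text \<open>The functor \<open>V \<mapsto> e V\<close> on objects and on morphisms\<close>

definition G_obj ::
  "complex \<Rightarrow> nat \<Rightarrow> nat \<Rightarrow> nat \<Rightarrow> (tens \<Rightarrow> hecke_elt \<Rightarrow> tens)
    \<Rightarrow> (schur_eps, 'm) module \<Rightarrow> (schur_eps, 'm) module" where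
  "G_obj \<epsilon> n N r act V =
     V\<lparr>carrier := (\<lambda>x. corner_idem_at \<epsilon> n N r act \<odot>\<^bsub>V\<^esub> x) ` carrier V,
       smult := (\<lambda>s x. corner_iso_at \<epsilon> n N r act s \<odot>\<^bsub>V\<^esub> x)\<rparr>"

definition G_map ::
  "complex \<Rightarrow> nat \<Rightarrow> nat \<Rightarrow> nat \<Rightarrow> (tens \<Rightarrow> hecke_elt \<Rightarrow> tens)
    \<Rightarrow> (schur_eps, 'm) module \<Rightarrow> (schur_eps, 'm) module \<Rightarrow> ('m \<Rightarrow> 'm) \<Rightarrow> ('m \<Rightarrow> 'm)" where
  "G_map \<epsilon> n N r act V W f = restrict f (carrier (G_obj \<epsilon> n N r act V))"

end

theory Submission
  imports "HOL-Library.Equipollence" "HOL-Library.Multiset" Defs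
begin

text \<open>
  Write \<open>S\<^sub>N\<close> and \<open>S\<^sub>n\<close> for the two Schur algebras. Since \<open>e S\<^sub>N e\<close> is \<open>S\<^sub>n\<close>, the theorem is an instance
  of Morita theory: \<open>V \<mapsto> e V\<close> is an equivalence as soon as \<open>e\<close> is full, that is
  \<open>1 = \<Sum>\<^sub>k a\<^sub>k e b\<^sub>k\<close> for finitely many \<open>a\<^sub>k\<close>, \<open>b\<^sub>k\<close>.

  Fullness is where \<open>n \<ge> r\<close> enters. The entries of a list \<open>i\<close> of length \<open>r\<close> have at most \<open>r\<close> different
  residues modulo \<open>N\<close> (taken in \<open>{1..N}\<close>). If \<open>A\<close> is the set of these residues, then the
  order isomorphism from \<open>A\<close> onto \<open>{1..card A}\<close> relabels \<open>i\<close> into a list with residues in \<open>{1..n}\<close>. For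
  fixed \<open>A\<close> this relabelling, extended by zero to the lists with other residue sets, commutes with the
  Hecke action, because \<open>T\<^sub>k\<close> only compares neighbouring entries. Relabelling there and back is the
  projection onto the span of the \<open>\<omega> i\<close> with residue set \<open>A\<close>, and these projections sum up to the
  identity. The same kind of map, without changing residues, identifies \<open>e S\<^sub>N e\<close> with \<open>S\<^sub>n\<close>, and the
  weight idempotents are of this kind too.

  That relabelling commutes with all of the Hecke algebra, although the action of \<open>T\<^sub>k\<close> is only given on
  lists with entries in \<open>{1..n}\<close>, follows from the Bernstein relations, by which \<open>T\<^sub>k\<close> can be moved past the
  \<open>X\<^sub>j\<close>: this is \<open>tensor_space_map.commutes\<close>, and \<open>tensor_space_map_relab\<close> applies it to relabellings.

  The equation \<open>1 = \<Sum>\<^sub>k a\<^sub>k e b\<^sub>k\<close> and the isomorphism \<open>S\<^sub>n \<cong> e S\<^sub>N e\<close> hold over the Laurent polynomials and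
  survive base change (\<open>full_corner_base_change\<close>), since a tensor product is generated by pure tensors and
  is functorial.

  For the Morita part let \<open>R\<close> be an algebra with a full idempotent \<open>e\<close> and \<open>B = e R e\<close>. Evaluating
  module homomorphisms at \<open>x = \<Sum>\<^sub>k a\<^sub>k (b\<^sub>k x)\<close> with \<open>b\<^sub>k x \<in> e V\<close> shows that \<open>V \<mapsto> e V\<close> is fully faithful.
  A preimage of a \<open>B\<close>-module \<open>W\<close> is the coinduced module \<open>Hom\<^sub>B(e R, W)\<close>. It has to be realised on a subset of
  the given type of module elements, which may be small. A map in it is determined by its values at the
  \<open>b\<^sub>k\<close>, so the coinduced module is finite dimensional and embeds into a finite power of \<open>W\<close>; since \<open>W\<close> is
  either zero or infinite, this power embeds into \<open>W\<close>.
\<close>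

section \<open>Fully faithful, essentially surjective functors\<close>

text \<open>The inverse functor chooses a preimage \<open>G Y\<close> of each object together with mutually inverse arrows
  \<open>t Y\<close> and \<open>s Y\<close> between \<open>F (G Y)\<close> and \<open>Y\<close>, and lifts \<open>s Y' \<circ> g \<circ> t Y\<close> along \<open>F\<close>. The arrows \<open>t\<close> are then
  one of the two natural isomorphisms, and the lifts of the arrows \<open>s (F X)\<close> the other.\<close>

lemma equivalence_of_fully_faithful_ess_surj:
  assumes func: "cat_functor C D F Fm"
    and full: "\<And>X Y g. \<lbrakk>X \<in> Ob C; Y \<in> Ob C; g \<in> Hom D (F X) (F Y)\<rbrakk> \<Longrightarrow> \<exists>f \<in> Hom C X Y. Fm X Y f = g"
    and faithful: "\<And>X Y f f'. \<lbrakk>X \<in> Ob C; Y \<in> Ob C; f \<in> Hom C X Y; f' \<in> Hom C X Y; Fm X Y f = Fm X Y f'\<rbrakk>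
        \<Longrightarrow> f = f'"
    and ess_surj: "\<And>Y. Y \<in> Ob D \<Longrightarrow> \<exists>X \<in> Ob C. \<exists>f. is_iso D (F X) Y f"
  shows "equivalence_of_categories C D F Fm"
proof -
  interpret cat_functor C D F Fm by (fact func)
  have "\<forall>Y\<in>Ob D. \<exists>X t s. X \<in> Ob C \<and> t \<in> Hom D (F X) Y \<and> s \<in> Hom D Y (F X) \<and>
      Comp D (F X) Y (F X) s t = Ident D (F X) \<and> Comp D Y (F X) Y t s = Ident D Y"
    using ess_surj unfolding is_iso_def by blast
  then obtain G t s where G: "\<And>Y. Y \<in> Ob D \<Longrightarrow> G Y \<in> Ob C"
    and t: "\<And>Y. Y \<in> Ob D \<Longrightarrow> t Y \<in> Hom D (F (G Y)) Y"
    and s: "\<And>Y. Y \<in> Ob D \<Longrightarrow> s Y \<in> Hom D Y (F (G Y))"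
    and st: "\<And>Y. Y \<in> Ob D \<Longrightarrow> Comp D (F (G Y)) Y (F (G Y)) (s Y) (t Y) = Ident D (F (G Y))"
    and ts: "\<And>Y. Y \<in> Ob D \<Longrightarrow> Comp D Y (F (G Y)) Y (t Y) (s Y) = Ident D Y"
    by metis
  define lift where "lift X Y g = (THE f. f \<in> Hom C X Y \<and> Fm X Y f = g)" for X Y g
  have lift: "lift X Y g \<in> Hom C X Y \<and> Fm X Y (lift X Y g) = g"
    if "X \<in> Ob C" "Y \<in> Ob C" "g \<in> Hom D (F X) (F Y)" for X Y g
    unfolding lift_def by (rule theI') (use full[OF that] faithful[OF that(1,2)] in blast)
  define conj where "conj Y Y' g =
      Comp D (F (G Y)) Y' (F (G Y')) (s Y') (Comp D (F (G Y)) Y Y' g (t Y))" for Y Y' g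
  have conj: "conj Y Y' g \<in> Hom D (F (G Y)) (F (G Y'))"
    if "Y \<in> Ob D" "Y' \<in> Ob D" "g \<in> Hom D Y Y'" for Y Y' g
    unfolding conj_def using that G t s by (meson D.Comp_in_Hom F_Ob)
  define Gm where "Gm Y Y' g = lift (G Y) (G Y') (conj Y Y' g)" for Y Y' g
  have Gm: "Gm Y Y' g \<in> Hom C (G Y) (G Y')" "Fm (G Y) (G Y') (Gm Y Y' g) = conj Y Y' g"
    if "Y \<in> Ob D" "Y' \<in> Ob D" "g \<in> Hom D Y Y'" for Y Y' g
    unfolding Gm_def using lift[OF G G conj] that by auto
  have t_conj: "Comp D (F (G Y)) (F (G Y')) Y' (t Y') (conj Y Y' g) = Comp D (F (G Y)) Y Y' g (t Y)"
    if Y: "Y \<in> Ob D" "Y' \<in> Ob D" "g \<in> Hom D Y Y'" for Y Y' g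
  proof -
    have gt: "Comp D (F (G Y)) Y Y' g (t Y) \<in> Hom D (F (G Y)) Y'"
      using Y G t by (meson D.Comp_in_Hom F_Ob)
    have "Comp D (F (G Y)) (F (G Y')) Y' (t Y') (conj Y Y' g) =
      Comp D (F (G Y)) Y' Y' (Comp D Y' (F (G Y')) Y' (t Y') (s Y')) (Comp D (F (G Y)) Y Y' g (t Y))"
      unfolding conj_def using Y G t s gt F_Ob by (intro D.Comp_assoc) auto
    then show ?thesis using ts Y gt G F_Ob D.Ident_Comp by auto
  qed
  have conj_s: "Comp D Y (F (G Y)) (F (G Y')) (conj Y Y' g) (s Y) = Comp D Y Y' (F (G Y')) (s Y') g"
    if Y: "Y \<in> Ob D" "Y' \<in> Ob D" "g \<in> Hom D Y Y'" for Y Y' g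
  proof -
    have gt: "Comp D (F (G Y)) Y Y' g (t Y) \<in> Hom D (F (G Y)) Y'"
      using Y G t by (meson D.Comp_in_Hom F_Ob)
    have "Comp D Y (F (G Y)) (F (G Y')) (conj Y Y' g) (s Y) =
      Comp D Y Y' (F (G Y')) (s Y') (Comp D Y (F (G Y)) Y' (Comp D (F (G Y)) Y Y' g (t Y)) (s Y))"
      unfolding conj_def by (rule D.Comp_assoc[symmetric]) (use Y G t s gt F_Ob in auto)
    also have "Comp D Y (F (G Y)) Y' (Comp D (F (G Y)) Y Y' g (t Y)) (s Y) =
       Comp D Y Y Y' g (Comp D Y (F (G Y)) Y (t Y) (s Y))"
      by (rule D.Comp_assoc[symmetric]) (use Y G t s gt F_Ob in auto)
    also have "\<dots> = g" using ts Y D.Comp_Ident by auto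
    finally show ?thesis .
  qed
  have functor_G: "cat_functor D C G Gm"
  proof unfold_locales
    fix Y assume Y: "Y \<in> Ob D"
    have "conj Y Y (Ident D Y) = Fm (G Y) (G Y) (Ident C (G Y))"
      unfolding conj_def using Y t st G F_Ob D.Ident_Comp Fm_Ident by auto
    with Y show "Gm Y Y (Ident D Y) = Ident C (G Y)"
      using faithful[OF G G] Gm[OF Y Y] D.Ident_in_Hom C.Ident_in_Hom G by metis
  next
    fix X Y Z f g assume O: "X \<in> Ob D" "Y \<in> Ob D" "Z \<in> Ob D" and f: "f \<in> Hom D X Y" and g: "g \<in> Hom D Y Z"
    have gf: "Comp D X Y Z g f \<in> Hom D X Z" using O f g D.Comp_in_Hom by auto
    have "conj X Z (Comp D X Y Z g f) =
        Comp D (F (G X)) Z (F (G Z)) (s Z) (Comp D (F (G X)) Y Z g (Comp D (F (G X)) X Y f (t X)))"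
      unfolding conj_def using D.Comp_assoc[of "F (G X)" X Y Z "t X" f g] O f g t G F_Ob by auto
    also have "\<dots> = Comp D (F (G X)) Z (F (G Z)) (s Z) (Comp D (F (G X)) Y Z g
        (Comp D (F (G X)) (F (G Y)) Y (t Y) (conj X Y f)))"
      using t_conj O f by auto
    also have "\<dots> = Comp D (F (G X)) Z (F (G Z)) (s Z) (Comp D (F (G X)) (F (G Y)) Z
        (Comp D (F (G Y)) Y Z g (t Y)) (conj X Y f))"
      using D.Comp_assoc[of "F (G X)" "F (G Y)" Y Z "conj X Y f" "t Y" g] O f g t G F_Ob conj by auto
    also have "\<dots> = Comp D (F (G X)) (F (G Y)) (F (G Z)) (conj Y Z g) (conj X Y f)"
      unfolding conj_def[of Y Z g]
      by (rule D.Comp_assoc) (use O f g t s G F_Ob conj D.Comp_in_Hom in auto)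
    also have "\<dots> = Fm (G X) (G Z) (Comp C (G X) (G Y) (G Z) (Gm Y Z g) (Gm X Y f))"
      using Fm_Comp O f g G Gm by metis
    finally show "Gm X Z (Comp D X Y Z g f) = Comp C (G X) (G Y) (G Z) (Gm Y Z g) (Gm X Y f)"
      using faithful[OF G G] Gm O f g gf G C.Comp_in_Hom by metis
  qed (use G Gm in auto)
  define \<eta> where "\<eta> X = lift X (G (F X)) (s (F X))" for X
  have \<eta>: "\<eta> X \<in> Hom C X (G (F X))" "Fm X (G (F X)) (\<eta> X) = s (F X)" if "X \<in> Ob C" for X
    unfolding \<eta>_def using lift[of X "G (F X)" "s (F X)"] that G F_Ob s by auto
  have "natural_iso C C (\<lambda>X. X) (\<lambda>X Y f. f) (\<lambda>X. G (F X)) (\<lambda>X Y f. Gm (F X) (F Y) (Fm X Y f)) \<eta>"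
    unfolding natural_iso_def
  proof (intro conjI ballI)
    fix X assume X: "X \<in> Ob C"
    then have FX: "F X \<in> Ob D" "G (F X) \<in> Ob C" using F_Ob G by auto
    define \<xi> where "\<xi> = lift (G (F X)) X (t (F X))"
    have \<xi>: "\<xi> \<in> Hom C (G (F X)) X" "Fm (G (F X)) X \<xi> = t (F X)"
      unfolding \<xi>_def using lift[of "G (F X)" X "t (F X)"] X FX t by auto
    have "Comp C X (G (F X)) X \<xi> (\<eta> X) = Ident C X"
    proof (rule faithful[OF X X])
      show "Fm X X (Comp C X (G (F X)) X \<xi> (\<eta> X)) = Fm X X (Ident C X)"
        using X FX \<xi> \<eta> Fm_Comp Fm_Ident ts by auto
    qed (use X FX \<xi> \<eta> C.Comp_in_Hom C.Ident_in_Hom in auto)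
    moreover have "Comp C (G (F X)) X (G (F X)) (\<eta> X) \<xi> = Ident C (G (F X))"
    proof (rule faithful[OF FX(2) FX(2)])
      show "Fm (G (F X)) (G (F X)) (Comp C (G (F X)) X (G (F X)) (\<eta> X) \<xi>) =
          Fm (G (F X)) (G (F X)) (Ident C (G (F X)))"
        using X FX \<xi> \<eta> Fm_Comp Fm_Ident st by auto
    qed (use X FX \<xi> \<eta> C.Comp_in_Hom C.Ident_in_Hom in auto)
    ultimately show "is_iso C X (G (F X)) (\<eta> X)"
      unfolding is_iso_def using \<xi> \<eta> X by auto
  next
    fix X Y f assume O: "X \<in> Ob C" "Y \<in> Ob C" and f: "f \<in> Hom C X Y"
    then have FO: "F X \<in> Ob D" "G (F X) \<in> Ob C" "F Y \<in> Ob D" "G (F Y) \<in> Ob C"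
      and Ff: "Fm X Y f \<in> Hom D (F X) (F Y)" using F_Ob G Fm_Hom by auto
    show "Comp C X Y (G (F Y)) (\<eta> Y) f = Comp C X (G (F X)) (G (F Y)) (Gm (F X) (F Y) (Fm X Y f)) (\<eta> X)"
    proof (rule faithful[OF O(1) FO(4)])
      show "Fm X (G (F Y)) (Comp C X Y (G (F Y)) (\<eta> Y) f) =
        Fm X (G (F Y)) (Comp C X (G (F X)) (G (F Y)) (Gm (F X) (F Y) (Fm X Y f)) (\<eta> X))"
        using Fm_Comp[of X Y "G (F Y)" f "\<eta> Y"]
          Fm_Comp[of X "G (F X)" "G (F Y)" "\<eta> X" "Gm (F X) (F Y) (Fm X Y f)"]
          O FO f Ff \<eta> Gm conj_s by auto
    qed (use O FO f Ff \<eta> Gm C.Comp_in_Hom in metis)+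
  qed
  moreover have "natural_iso D D (\<lambda>X. F (G X)) (\<lambda>X Y f. Fm (G X) (G Y) (Gm X Y f)) (\<lambda>X. X) (\<lambda>X Y f. f) t"
    unfolding natural_iso_def is_iso_def using t s ts st t_conj Gm by (auto intro!: bexI[OF _ s])
  ultimately show ?thesis
    unfolding equivalence_of_categories_def using functor_G func by blast
qed

section \<open>Modules over complex algebras\<close>

abbreviation scalar :: "(complex, 'a) module \<Rightarrow> complex \<Rightarrow> 'a" where
  "scalar A c \<equiv> c \<odot>\<^bsub>A\<^esub> \<one>\<^bsub>A\<^esub>"

text \<open>Complex numbers act through the ring homomorphism \<open>c \<mapsto> c \<cdot> 1\<close> into the centre; this is the form in
  which they enter the definition of finite dimensionality.\<close>

locale complex_algebra = ring A for A :: "(complex, 'a) module" +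
  assumes scalar_closed [simp]: "scalar A c \<in> carrier A"
    and scalar_add: "scalar A (c + d) = scalar A c \<oplus>\<^bsub>A\<^esub> scalar A d"
    and scalar_mult: "scalar A (c * d) = scalar A c \<otimes>\<^bsub>A\<^esub> scalar A d"
    and scalar_one: "scalar A 1 = \<one>\<^bsub>A\<^esub>"
    and scalar_commute: "x \<in> carrier A \<Longrightarrow> scalar A c \<otimes>\<^bsub>A\<^esub> x = x \<otimes>\<^bsub>A\<^esub> scalar A c"

lemma additive_zero:
  assumes "abelian_group V" "abelian_group W" "f \<in> carrier V \<rightarrow> carrier W"
    and "\<And>x y. \<lbrakk>x \<in> carrier V; y \<in> carrier V\<rbrakk> \<Longrightarrow> f (x \<oplus>\<^bsub>V\<^esub> y) = f x \<oplus>\<^bsub>W\<^esub> f y"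
  shows "f \<zero>\<^bsub>V\<^esub> = \<zero>\<^bsub>W\<^esub>"
proof -
  interpret V: abelian_group V by fact
  interpret W: abelian_group W by fact
  have fz: "f \<zero>\<^bsub>V\<^esub> \<in> carrier W" using assms(3) by auto
  have "f \<zero>\<^bsub>V\<^esub> \<oplus>\<^bsub>W\<^esub> f \<zero>\<^bsub>V\<^esub> = f \<zero>\<^bsub>V\<^esub>"
    using assms(4)[of "\<zero>\<^bsub>V\<^esub>" "\<zero>\<^bsub>V\<^esub>"] by simp
  then show ?thesis using fz W.add.l_cancel_one by blast
qed

lemma additive_finsum:
  assumes "abelian_group V" "abelian_group W" "f \<in> carrier V \<rightarrow> carrier W"
    and add: "\<And>x y. \<lbrakk>x \<in> carrier V; y \<in> carrier V\<rbrakk> \<Longrightarrow> f (x \<oplus>\<^bsub>V\<^esub> y) = f x \<oplus>\<^bsub>W\<^esub> f y"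
    and "finite S" and "g \<in> S \<rightarrow> carrier V"
  shows "f (finsum V g S) = finsum W (\<lambda>s. f (g s)) S"
proof -
  interpret V: abelian_group V by fact
  interpret W: abelian_group W by fact
  show ?thesis using \<open>finite S\<close> \<open>g \<in> S \<rightarrow> carrier V\<close>
  proof (induction S)
    case empty
    then show ?case using additive_zero[OF assms(1-3) add] by simp
  next
    case (insert s S)
    have "(\<lambda>s. f (g s)) \<in> S \<rightarrow> carrier W" "f (g s) \<in> carrier W"
      using insert.prems assms(3) by auto
    with insert show ?case by (simp add: add V.finsum_insert W.finsum_insert)
  qed
qed

lemma (in abelian_monoid) finsum_in_closed_subset:
  assumes "\<zero> \<in> U" "\<And>x y. \<lbrakk>x \<in> U; y \<in> U\<rbrakk> \<Longrightarrow> x \<oplus> y \<in> U" "U \<subseteq> carrier G"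
    and "finite S" "g \<in> S \<rightarrow> U"
  shows "finsum G g S \<in> U"
  using assms(4,5)
proof (induction S)
  case (insert s S)
  then have "g \<in> S \<rightarrow> carrier G" "g s \<in> carrier G" using assms(3) by auto
  with insert show ?case using assms(2) by (simp add: finsum_insert)
qed (use assms in simp)

context left_module
begin

lemma smult_zero_left: "x \<in> carrier V \<Longrightarrow> \<zero>\<^bsub>B\<^esub> \<odot>\<^bsub>V\<^esub> x = \<zero>\<^bsub>V\<^esub>"
  by (rule additive_zero[where f = "\<lambda>b. b \<odot>\<^bsub>V\<^esub> x"])
     (auto simp: lm_l_distr lm_closed B.abelian_group_axioms V.abelian_group_axioms)

lemma smult_finsum_right:
  assumes "b \<in> carrier B" "finite S" "g \<in> S \<rightarrow> carrier V"
  shows "b \<odot>\<^bsub>V\<^esub> finsum V g S = finsum V (\<lambda>s. b \<odot>\<^bsub>V\<^esub> g s) S"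
  using assms
  by (intro additive_finsum[where f = "\<lambda>x. b \<odot>\<^bsub>V\<^esub> x"])
     (auto simp: lm_r_distr lm_closed V.abelian_group_axioms)

lemma smult_finsum_left:
  assumes "x \<in> carrier V" "finite S" "g \<in> S \<rightarrow> carrier B"
  shows "finsum B g S \<odot>\<^bsub>V\<^esub> x = finsum V (\<lambda>s. g s \<odot>\<^bsub>V\<^esub> x) S"
  using assms
  by (intro additive_finsum[where f = "\<lambda>b. b \<odot>\<^bsub>V\<^esub> x"])
     (auto simp: lm_l_distr lm_closed B.abelian_group_axioms V.abelian_group_axioms)

end

text \<open>The assumption \<open>span\<close> says that \<open>x\<close> lies in every subset closed under addition which contains \<open>0\<close>
  and the multiples of \<open>S\<close>. This avoids coefficient functions: a combination of doubly indexed
  vectors need not be rewritten over the set of its distinct members.\<close>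

lemma fin_dimI:
  fixes V :: "('b, 'm) module"
  assumes alg: "complex_algebra B" and V: "left_module B V"
    and S: "finite S" "S \<subseteq> carrier V"
    and span: "\<And>x U. \<lbrakk>x \<in> carrier V; \<zero>\<^bsub>V\<^esub> \<in> U; \<And>y z. \<lbrakk>y \<in> U; z \<in> U\<rbrakk> \<Longrightarrow> y \<oplus>\<^bsub>V\<^esub> z \<in> U;
        \<And>c y. y \<in> S \<Longrightarrow> scalar B c \<odot>\<^bsub>V\<^esub> y \<in> U; U \<subseteq> carrier V\<rbrakk> \<Longrightarrow> x \<in> U"
  shows "fin_dim B V"
proof -
  interpret B: complex_algebra B by fact
  interpret M: left_module B V by fact
  have scalar_0: "scalar B 0 = \<zero>\<^bsub>B\<^esub>"
    using B.scalar_add[of 0 0] by (metis B.add.l_cancel_one' B.scalar_closed add.right_neutral)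
  let ?s = "\<lambda>c. finsum V (\<lambda>u. scalar B (c u) \<odot>\<^bsub>V\<^esub> u) S"
  have summand: "(\<lambda>u. scalar B (c u) \<odot>\<^bsub>V\<^esub> u) \<in> S \<rightarrow> carrier V" for c :: "'m \<Rightarrow> complex"
    using S M.lm_closed by auto
  show ?thesis unfolding fin_dim_def
  proof (intro exI[of _ S] conjI ballI)
    fix x assume "x \<in> carrier V"
    then have "x \<in> range ?s"
    proof (rule span)
      have "?s (\<lambda>_. 0) = \<zero>\<^bsub>V\<^esub>"
        using S by (intro M.V.add.finprod_one_eqI) (auto simp: scalar_0 M.smult_zero_left)
      then show "\<zero>\<^bsub>V\<^esub> \<in> range ?s" by (intro range_eqI[where x = "\<lambda>_. 0"]) simp
    next
      fix y z assume "y \<in> range ?s" "z \<in> range ?s"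
      then obtain c d where cd: "y = ?s c" "z = ?s d" by auto
      have "?s (\<lambda>u. c u + d u) = finsum V (\<lambda>u. scalar B (c u) \<odot>\<^bsub>V\<^esub> u \<oplus>\<^bsub>V\<^esub> scalar B (d u) \<odot>\<^bsub>V\<^esub> u) S"
        using S summand M.lm_closed by (intro M.V.finsum_cong') (auto simp: B.scalar_add M.lm_l_distr)
      also have "\<dots> = y \<oplus>\<^bsub>V\<^esub> z" unfolding cd using summand by (intro M.V.finsum_addf)
      finally show "y \<oplus>\<^bsub>V\<^esub> z \<in> range ?s" by (intro range_eqI[where x = "\<lambda>u. c u + d u"]) simp
    next
      fix c y assume y: "y \<in> S"
      have "?s (\<lambda>u. if u = y then c else 0) =
          finsum V (\<lambda>u. if y = u then scalar B c \<odot>\<^bsub>V\<^esub> u else \<zero>\<^bsub>V\<^esub>) S"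
        using S M.lm_closed by (intro M.V.finsum_cong') (auto simp: scalar_0 M.smult_zero_left)
      also have "\<dots> = scalar B c \<odot>\<^bsub>V\<^esub> y"
        using S y M.lm_closed by (intro M.V.finsum_singleton) auto
      finally show "scalar B c \<odot>\<^bsub>V\<^esub> y \<in> range ?s" by (intro range_eqI[where x = "\<lambda>u. if u = y then c else 0"]) simp
    next
      show "range ?s \<subseteq> carrier V" by (intro image_subsetI M.V.finsum_closed summand)
    qed
    then show "\<exists>c. x = ?s c" by auto
  qed (use S in auto)
qed

lemma category_fdmod:
  fixes B :: "(complex, 'b) module"
  shows "category (fdmod B :: (('b, 'm) module, 'm \<Rightarrow> 'm) cat)"
proof unfold_locales
  fix X :: "('b, 'm) module"
  assume "X \<in> Ob (fdmod B)"
  then interpret left_module B X by (simp add: fdmod_def)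
  show "Ident (fdmod B) X \<in> Hom (fdmod B) X X"
    by (auto simp: fdmod_def module_hom_def lm_closed)
next
  fix X Y Z :: "('b, 'm) module" and f g
  assume O: "X \<in> Ob (fdmod B)" "Y \<in> Ob (fdmod B)" "Z \<in> Ob (fdmod B)"
    and f: "f \<in> Hom (fdmod B) X Y" and g: "g \<in> Hom (fdmod B) Y Z"
  from O interpret X: left_module B X by (simp add: fdmod_def)
  have f': "f x \<in> carrier Y" "y \<in> carrier X \<Longrightarrow> f (x \<oplus>\<^bsub>X\<^esub> y) = f x \<oplus>\<^bsub>Y\<^esub> f y"
    "b \<in> carrier B \<Longrightarrow> f (b \<odot>\<^bsub>X\<^esub> x) = b \<odot>\<^bsub>Y\<^esub> f x" if "x \<in> carrier X" for x y b
    using f that by (auto simp: fdmod_def module_hom_def)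
  have g': "g x \<in> carrier Z" "y \<in> carrier Y \<Longrightarrow> g (x \<oplus>\<^bsub>Y\<^esub> y) = g x \<oplus>\<^bsub>Z\<^esub> g y"
    "b \<in> carrier B \<Longrightarrow> g (b \<odot>\<^bsub>Y\<^esub> x) = b \<odot>\<^bsub>Z\<^esub> g x" if "x \<in> carrier Y" for x y b
    using g that by (auto simp: fdmod_def module_hom_def)
  show "Comp (fdmod B) X Y Z g f \<in> Hom (fdmod B) X Z"
    by (simp add: fdmod_def module_hom_def compose_def f' g' X.lm_closed)
next
  fix X Y :: "('b, 'm) module" and f
  assume "f \<in> Hom (fdmod B) X Y"
  then have f: "f \<in> carrier X \<rightarrow>\<^sub>E carrier Y" by (simp add: fdmod_def module_hom_def)
  show "Comp (fdmod B) X X Y f (Ident (fdmod B) X) = f"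
    using f by (auto simp: fdmod_def PiE_def intro!: compose_Id)
  show "Comp (fdmod B) X Y Y (Ident (fdmod B) Y) f = f"
    using f by (auto simp: fdmod_def PiE_def intro!: Id_compose)
next
  fix W X Y Z :: "('b, 'm) module" and f g h
  assume "f \<in> Hom (fdmod B) W X"
  then have f: "f \<in> carrier W \<rightarrow>\<^sub>E carrier X" by (simp add: fdmod_def module_hom_def)
  then show "Comp (fdmod B) W Y Z h (Comp (fdmod B) W X Y g f) = Comp (fdmod B) W X Z (Comp (fdmod B) X Y Z h g) f"
    by (auto simp: fdmod_def PiE_def intro!: compose_assoc)
qed

lemma is_iso_of_bijective:
  fixes X Y :: "('b, 'm) module"
  assumes X: "X \<in> Ob (fdmod B)" and Y: "Y \<in> Ob (fdmod B)"
    and f: "f \<in> module_hom B X Y" and bij: "bij_betw f (carrier X) (carrier Y)"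
  shows "is_iso (fdmod B) X Y f"
proof -
  interpret X: left_module B X using X by (simp add: fdmod_def)
  interpret Y: left_module B Y using Y by (simp add: fdmod_def)
  define g where "g = restrict (inv_into (carrier X) f) (carrier Y)"
  have g: "g y \<in> carrier X" "f (g y) = y" if "y \<in> carrier Y" for y
    using that bij unfolding g_def bij_betw_def by (auto simp: inv_into_into f_inv_into_f)
  have gf: "g (f x) = x" and fx: "f x \<in> carrier Y" if "x \<in> carrier X" for x
    using that bij unfolding g_def bij_betw_def by auto
  have add: "f (x \<oplus>\<^bsub>X\<^esub> y) = f x \<oplus>\<^bsub>Y\<^esub> f y" and smult: "b \<in> carrier B \<Longrightarrow> f (b \<odot>\<^bsub>X\<^esub> x) = b \<odot>\<^bsub>Y\<^esub> f x"
    if "x \<in> carrier X" "y \<in> carrier X" for x y b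
    using that f by (auto simp: module_hom_def)
  have "g \<in> module_hom B Y X"
    unfolding module_hom_def
  proof (intro CollectI conjI ballI)
    fix x y b assume x: "x \<in> carrier Y" and y: "y \<in> carrier Y"
    show "g (x \<oplus>\<^bsub>Y\<^esub> y) = g x \<oplus>\<^bsub>X\<^esub> g y"
      using gf[of "g x \<oplus>\<^bsub>X\<^esub> g y"] add[of "g x" "g y"] g x y by simp
  next
    fix x b assume x: "x \<in> carrier Y" and b: "b \<in> carrier B"
    show "g (b \<odot>\<^bsub>Y\<^esub> x) = b \<odot>\<^bsub>X\<^esub> g x"
      using gf[of "b \<odot>\<^bsub>X\<^esub> g x"] smult[of "g x" "g x" b] g x b X.lm_closed by simp
  qed (use g in \<open>auto simp: g_def\<close>)
  then show ?thesis
    unfolding is_iso_def using f g gf fx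
    by (auto simp: fdmod_def compose_def intro!: bexI[of _ g])
qed

text \<open>A nonzero vector \<open>w\<close> has infinitely many multiples \<open>c w\<close>, because \<open>c - d\<close> is invertible for
  \<open>c \<noteq> d\<close>.\<close>

lemma fdmod_object_infinite_or_zero:
  assumes alg: "complex_algebra B" and W: "left_module B W"
  shows "infinite (carrier W) \<or> carrier W = {\<zero>\<^bsub>W\<^esub>}"
proof (cases "carrier W = {\<zero>\<^bsub>W\<^esub>}")
  case False
  interpret B: complex_algebra B by fact
  interpret M: left_module B W by fact
  obtain w where w: "w \<in> carrier W" "w \<noteq> \<zero>\<^bsub>W\<^esub>" using False M.V.zero_closed by blast
  have "inj (\<lambda>c. scalar B c \<odot>\<^bsub>W\<^esub> w)"
  proof (rule injI, rule ccontr)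
    fix c d assume eq: "scalar B c \<odot>\<^bsub>W\<^esub> w = scalar B d \<odot>\<^bsub>W\<^esub> w" and "c \<noteq> d"
    have scalar_0: "scalar B 0 = \<zero>\<^bsub>B\<^esub>"
      using B.scalar_add[of 0 0] by (metis B.add.l_cancel_one' B.scalar_closed add.right_neutral)
    have "scalar B (c - d) \<odot>\<^bsub>W\<^esub> w \<oplus>\<^bsub>W\<^esub> scalar B d \<odot>\<^bsub>W\<^esub> w = \<zero>\<^bsub>W\<^esub> \<oplus>\<^bsub>W\<^esub> scalar B d \<odot>\<^bsub>W\<^esub> w"
      using eq w M.lm_closed by (simp flip: M.lm_l_distr B.scalar_add)
    then have "scalar B (c - d) \<odot>\<^bsub>W\<^esub> w = \<zero>\<^bsub>W\<^esub>"
      using w M.lm_closed by (metis B.scalar_closed M.V.add.right_cancel M.V.zero_closed)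
    then have "scalar B (inverse (c - d)) \<odot>\<^bsub>W\<^esub> (scalar B (c - d) \<odot>\<^bsub>W\<^esub> w) = \<zero>\<^bsub>W\<^esub>"
      using M.smult_finsum_right[of "scalar B (inverse (c - d))" "{}"] by simp
    then have "scalar B 1 \<odot>\<^bsub>W\<^esub> w = \<zero>\<^bsub>W\<^esub>"
      using \<open>c \<noteq> d\<close> w by (simp flip: M.lm_assoc B.scalar_mult)
    then show False using w by (simp add: B.scalar_one M.lm_one)
  qed
  then have "infinite (range (\<lambda>c. scalar B c \<odot>\<^bsub>W\<^esub> w))"
    using infinite_UNIV_char_0 finite_imageD by blast
  then show ?thesis using w M.lm_closed B.scalar_closed finite_subset
    by (metis (no_types, lifting) image_subsetI)
qed simp

lemma PiE_lepoll_infinite: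
  assumes "finite K" "infinite W" shows "(K \<rightarrow>\<^sub>E W) \<lesssim> W"
  using assms(1)
proof induction
  case empty
  then show ?case using assms(2) by (simp add: finite_lepoll_infinite)
next
  case (insert k K)
  have sq: "W \<times> W \<lesssim> W"
    using assms(2) card_of_Times_same_infinite card_of_ordLeq ordIso_imp_ordLeq unfolding lepoll_def by blast
  have "(insert k K \<rightarrow>\<^sub>E W) \<lesssim> W \<times> (K \<rightarrow>\<^sub>E W)"
    unfolding PiE_insert_eq by (rule image_lepoll)
  also have "\<dots> \<lesssim> W \<times> W" using insert by (intro times_lepoll_mono) auto
  finally show ?case using sq lepoll_trans by blast
qed

section \<open>Transport of structure\<close>

text \<open>The objects of a module category have their elements in one fixed type, so a module built over another type has
  to be moved there along an injection.\<close>

definition transport :: "('m \<Rightarrow> 'n) \<Rightarrow> ('b, 'm) module \<Rightarrow> ('b, 'n) module" where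
  "transport \<iota> V =
     \<lparr>carrier = \<iota> ` carrier V, mult = undefined, one = undefined, zero = \<iota> \<zero>\<^bsub>V\<^esub>,
      add = (\<lambda>x y. \<iota> (inv_into (carrier V) \<iota> x \<oplus>\<^bsub>V\<^esub> inv_into (carrier V) \<iota> y)),
      smult = (\<lambda>b x. \<iota> (b \<odot>\<^bsub>V\<^esub> inv_into (carrier V) \<iota> x))\<rparr>"

lemma left_module_transport:
  assumes V: "left_module B V" and inj: "inj_on \<iota> (carrier V)"
  shows "left_module B (transport \<iota> V)"
proof -
  interpret left_module B V by fact
  have "abelian_group (transport \<iota> V)"
  proof (rule abelian_groupI)
    fix x assume "x \<in> carrier (transport \<iota> V)"
    then obtain u where "u \<in> carrier V" "x = \<iota> u" by (auto simp: transport_def)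
    then show "\<exists>y\<in>carrier (transport \<iota> V). y \<oplus>\<^bsub>transport \<iota> V\<^esub> x = \<zero>\<^bsub>transport \<iota> V\<^esub>"
      by (intro bexI[of _ "\<iota> (\<ominus>\<^bsub>V\<^esub> u)"]) (auto simp: transport_def inj V.l_neg)
  qed (auto simp: transport_def inj V.a_ac)
  then show ?thesis
    by (intro left_module.intro left_module_axioms.intro B.ring_axioms)
       (auto simp: transport_def inj lm_closed lm_l_distr lm_r_distr lm_assoc lm_one)
qed

lemma fin_dim_transport:
  fixes V :: "('b, 'm) module" and \<iota> :: "'m \<Rightarrow> 'n"
  assumes alg: "complex_algebra B" and V: "left_module B V" and inj: "inj_on \<iota> (carrier V)"
    and fin: "fin_dim B V"
  shows "fin_dim B (transport \<iota> V)"
proof -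
  interpret B: complex_algebra B by fact
  interpret V: left_module B V by fact
  interpret T: left_module B "transport \<iota> V" using left_module_transport[OF V inj] .
  obtain S where S: "finite S" "S \<subseteq> carrier V"
    and span: "\<And>x. x \<in> carrier V \<Longrightarrow> \<exists>c. x = finsum V (\<lambda>u. scalar B (c u) \<odot>\<^bsub>V\<^esub> u) S"
    using fin unfolding fin_dim_def by auto
  show ?thesis
  proof (rule fin_dimI[OF alg T.left_module_axioms])
    show "finite (\<iota> ` S)" "\<iota> ` S \<subseteq> carrier (transport \<iota> V)" using S by (auto simp: transport_def)
  next
    fix x U
    assume x: "x \<in> carrier (transport \<iota> V)" and U: "\<zero>\<^bsub>transport \<iota> V\<^esub> \<in> U"
      "\<And>y z. \<lbrakk>y \<in> U; z \<in> U\<rbrakk> \<Longrightarrow> y \<oplus>\<^bsub>transport \<iota> V\<^esub> z \<in> U" "U \<subseteq> carrier (transport \<iota> V)"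
      "\<And>c y. y \<in> \<iota> ` S \<Longrightarrow> scalar B c \<odot>\<^bsub>transport \<iota> V\<^esub> y \<in> U"
    obtain u where u: "u \<in> carrier V" "x = \<iota> u" using x by (auto simp: transport_def)
    obtain c where c: "u = finsum V (\<lambda>u. scalar B (c u) \<odot>\<^bsub>V\<^esub> u) S" using span u by blast
    have "x = finsum (transport \<iota> V) (\<lambda>u. \<iota> (scalar B (c u) \<odot>\<^bsub>V\<^esub> u)) S"
      unfolding u(2) c
      by (rule additive_finsum[OF V.V.abelian_group_axioms T.V.abelian_group_axioms])
         (use S in \<open>auto simp: transport_def inj V.lm_closed\<close>)
    also have "\<dots> \<in> U"
    proof (rule T.V.finsum_in_closed_subset)
      show "(\<lambda>u. \<iota> (scalar B (c u) \<odot>\<^bsub>V\<^esub> u)) \<in> S \<rightarrow> U"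
      proof
        fix s assume s: "s \<in> S"
        then have "scalar B (c s) \<odot>\<^bsub>transport \<iota> V\<^esub> \<iota> s \<in> U" using U(4) by simp
        then show "\<iota> (scalar B (c s) \<odot>\<^bsub>V\<^esub> s) \<in> U"
          using s S by (auto simp: transport_def inj subset_iff)
      qed
    qed (use U S in auto)
    finally show "x \<in> U" .
  qed
qed

section \<open>Full corners\<close>

definition corner_obj :: "'r \<Rightarrow> ('b \<Rightarrow> 'r) \<Rightarrow> ('r, 'm) module \<Rightarrow> ('b, 'm) module" where
  "corner_obj e \<iota> V =
     \<lparr>carrier = (\<lambda>x. e \<odot>\<^bsub>V\<^esub> x) ` carrier V, mult = mult V, one = one V, zero = zero V, add = add V,
      smult = (\<lambda>s x. \<iota> s \<odot>\<^bsub>V\<^esub> x)\<rparr>"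

text \<open>The map \<open>\<iota>\<close> identifies \<open>B\<close> with \<open>e R e\<close>. Fullness of \<open>e\<close> is stated with \<open>a\<^sub>k \<in> R e\<close> and
  \<open>b\<^sub>k \<in> e R\<close>, so that \<open>e\<close> can be dropped from \<open>a\<^sub>k e b\<^sub>k\<close>.\<close>

locale full_corner = R: complex_algebra R + B: complex_algebra B
  for R :: "(complex, 'r) module" (structure) and B :: "(complex, 'b) module" +
  fixes e :: 'r and \<iota> :: "'b \<Rightarrow> 'r" and K :: "'k set" and a b :: "'k \<Rightarrow> 'r"
  assumes \<iota>_closed [simp]: "s \<in> carrier B \<Longrightarrow> \<iota> s \<in> carrier R"
    and \<iota>_add: "\<lbrakk>s \<in> carrier B; t \<in> carrier B\<rbrakk> \<Longrightarrow> \<iota> (s \<oplus>\<^bsub>B\<^esub> t) = \<iota> s \<oplus> \<iota> t"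
    and \<iota>_mult: "\<lbrakk>s \<in> carrier B; t \<in> carrier B\<rbrakk> \<Longrightarrow> \<iota> (s \<otimes>\<^bsub>B\<^esub> t) = \<iota> s \<otimes> \<iota> t"
    and \<iota>_one: "\<iota> \<one>\<^bsub>B\<^esub> = e"
    and \<iota>_scalar: "\<iota> (scalar B c) = e \<otimes> scalar R c"
    and \<iota>_inj: "inj_on \<iota> (carrier B)"
    and \<iota>_onto: "x \<in> carrier R \<Longrightarrow> \<exists>s \<in> carrier B. \<iota> s = e \<otimes> x \<otimes> e"
    and finite_K: "finite K"
    and a_closed [simp]: "k \<in> K \<Longrightarrow> a k \<in> carrier R" and a_e: "k \<in> K \<Longrightarrow> a k \<otimes> e = a k"
    and b_closed [simp]: "k \<in> K \<Longrightarrow> b k \<in> carrier R" and e_b: "k \<in> K \<Longrightarrow> e \<otimes> b k = b k"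
    and full: "\<one> = finsum R (\<lambda>k. a k \<otimes> b k) K"
begin

lemma e_closed [simp]: "e \<in> carrier R"
  using \<iota>_closed[of "\<one>\<^bsub>B\<^esub>"] \<iota>_one by simp

lemma e_idem [simp]: "e \<otimes> e = e"
  using \<iota>_mult[of "\<one>\<^bsub>B\<^esub>" "\<one>\<^bsub>B\<^esub>"] \<iota>_one by simp

lemma e_\<iota>: "s \<in> carrier B \<Longrightarrow> e \<otimes> \<iota> s = \<iota> s"
  using \<iota>_mult[of "\<one>\<^bsub>B\<^esub>" s] \<iota>_one by simp

lemma \<iota>_e: "s \<in> carrier B \<Longrightarrow> \<iota> s \<otimes> e = \<iota> s"
  using \<iota>_mult[of s "\<one>\<^bsub>B\<^esub>"] \<iota>_one by simp

lemma corner_is_image: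
  assumes "x \<in> carrier R" "e \<otimes> x = x" "x \<otimes> e = x"
  shows "\<exists>s \<in> carrier B. \<iota> s = x"
  using \<iota>_onto[of x] assms by simp

subsection \<open>The functor\<close>

lemma corner_carrier:
  assumes "left_module R V"
  shows "x \<in> carrier (corner_obj e \<iota> V) \<longleftrightarrow> x \<in> carrier V \<and> e \<odot>\<^bsub>V\<^esub> x = x"
proof -
  interpret V: left_module R V by fact
  show ?thesis
    by (auto simp: corner_obj_def V.lm_closed image_iff simp flip: V.lm_assoc intro!: bexI[of _ x])
qed

lemma corner_simps:
  "add (corner_obj e \<iota> V) = add V" "zero (corner_obj e \<iota> V) = zero V"
  "smult (corner_obj e \<iota> V) s = smult V (\<iota> s)"
  by (auto simp: corner_obj_def)

lemma left_module_corner: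
  assumes V: "left_module R V"
  shows "left_module B (corner_obj e \<iota> V)"
proof -
  interpret V: left_module R V by fact
  note cc = corner_carrier[OF V]
  have z: "e \<odot>\<^bsub>V\<^esub> \<zero>\<^bsub>V\<^esub> = \<zero>\<^bsub>V\<^esub>" using V.smult_finsum_right[of e "{}"] by simp
  have "abelian_group (corner_obj e \<iota> V)"
  proof (rule abelian_groupI)
    fix x assume "x \<in> carrier (corner_obj e \<iota> V)"
    then have x: "x \<in> carrier V" "e \<odot>\<^bsub>V\<^esub> x = x" by (auto simp: cc)
    have "e \<odot>\<^bsub>V\<^esub> (\<ominus>\<^bsub>V\<^esub> x) \<oplus>\<^bsub>V\<^esub> x = \<zero>\<^bsub>V\<^esub>"
      using x z V.lm_r_distr[of e "\<ominus>\<^bsub>V\<^esub> x" x] by (simp add: V.V.l_neg)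
    then show "\<exists>y\<in>carrier (corner_obj e \<iota> V). y \<oplus>\<^bsub>corner_obj e \<iota> V\<^esub> x = \<zero>\<^bsub>corner_obj e \<iota> V\<^esub>"
      using x by (intro bexI[of _ "e \<odot>\<^bsub>V\<^esub> (\<ominus>\<^bsub>V\<^esub> x)"]) 
        (auto simp: corner_simps cc V.lm_closed simp flip: V.lm_assoc)
  qed (auto simp: cc z corner_simps V.V.a_ac V.lm_r_distr)
  then show ?thesis
    by (intro left_module.intro left_module_axioms.intro B.ring_axioms)
       (auto simp: cc corner_simps V.lm_closed V.lm_l_distr V.lm_r_distr \<iota>_add \<iota>_mult \<iota>_one e_\<iota>
          simp flip: V.lm_assoc)
qed

lemma finsum_corner:
  assumes V: "left_module R V" and "finite S" "g \<in> S \<rightarrow> carrier (corner_obj e \<iota> V)"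
  shows "finsum V g S = finsum (corner_obj e \<iota> V) g S"
proof -
  interpret V: left_module R V by fact
  interpret F: left_module B "corner_obj e \<iota> V" using left_module_corner[OF V] .
  show ?thesis
    using additive_finsum[OF F.V.abelian_group_axioms V.V.abelian_group_axioms, of "\<lambda>x. x" S g] assms
    by (auto simp: corner_carrier[OF V] corner_simps)
qed

text \<open>If \<open>S\<close> spans \<open>V\<close>, then \<open>e S\<close> spans \<open>e V\<close>.\<close>

lemma fin_dim_corner:
  fixes V :: "('r, 'm) module"
  assumes V: "left_module R V" and fin: "fin_dim R V"
  shows "fin_dim B (corner_obj e \<iota> V)"
proof -
  interpret V: left_module R V by fact
  interpret F: left_module B "corner_obj e \<iota> V" using left_module_corner[OF V] .
  note cc = corner_carrier[OF V]
  obtain S where S: "finite S" "S \<subseteq> carrier V"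
    and span: "\<And>x. x \<in> carrier V \<Longrightarrow> \<exists>c. x = finsum V (\<lambda>u. scalar R (c u) \<odot>\<^bsub>V\<^esub> u) S"
    using fin unfolding fin_dim_def by auto
  have e_scalar: "e \<odot>\<^bsub>V\<^esub> (scalar R c \<odot>\<^bsub>V\<^esub> u) = \<iota> (scalar B c) \<odot>\<^bsub>V\<^esub> (e \<odot>\<^bsub>V\<^esub> u)" if "u \<in> carrier V" for c u
  proof -
    have "e \<otimes> scalar R c \<otimes> e = e \<otimes> scalar R c"
      using R.scalar_commute[of e c] by (metis R.m_assoc R.scalar_closed e_closed e_idem)
    then show ?thesis using that by (simp add: \<iota>_scalar flip: V.lm_assoc)
  qed
  show ?thesis
  proof (rule fin_dimI[OF B.complex_algebra_axioms F.left_module_axioms])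
    show "finite ((\<lambda>u. e \<odot>\<^bsub>V\<^esub> u) ` S)" "(\<lambda>u. e \<odot>\<^bsub>V\<^esub> u) ` S \<subseteq> carrier (corner_obj e \<iota> V)"
      using S by (auto simp: corner_obj_def)
  next
    fix x U
    assume x: "x \<in> carrier (corner_obj e \<iota> V)" and U: "\<zero>\<^bsub>corner_obj e \<iota> V\<^esub> \<in> U"
      "\<And>y z. \<lbrakk>y \<in> U; z \<in> U\<rbrakk> \<Longrightarrow> y \<oplus>\<^bsub>corner_obj e \<iota> V\<^esub> z \<in> U" "U \<subseteq> carrier (corner_obj e \<iota> V)"
      "\<And>c y. y \<in> (\<lambda>u. e \<odot>\<^bsub>V\<^esub> u) ` S \<Longrightarrow> scalar B c \<odot>\<^bsub>corner_obj e \<iota> V\<^esub> y \<in> U"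
    obtain c where c: "x = finsum V (\<lambda>u. scalar R (c u) \<odot>\<^bsub>V\<^esub> u) S" using x span cc by blast
    have "x = e \<odot>\<^bsub>V\<^esub> x" using x by (simp add: cc)
    also have "\<dots> = finsum V (\<lambda>u. e \<odot>\<^bsub>V\<^esub> (scalar R (c u) \<odot>\<^bsub>V\<^esub> u)) S"
      unfolding c using S by (intro V.smult_finsum_right) (auto simp: V.lm_closed)
    also have "\<dots> \<in> U"
      using S U V.lm_closed by (intro V.V.finsum_in_closed_subset)
        (auto simp: e_scalar corner_simps subset_iff cc)
    finally show "x \<in> U" .
  qed
qed

abbreviation "corner_map V (W :: ('r, 'm) module) f \<equiv> restrict f (carrier (corner_obj e \<iota> V))"

lemma cat_functor_corner:
  "cat_functor (fdmod R :: (('r, 'm) module, 'm \<Rightarrow> 'm) cat) (fdmod B) (corner_obj e \<iota>) corner_map"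
proof (intro cat_functor.intro category_fdmod cat_functor_axioms.intro)
  fix V :: "('r, 'm) module" assume "V \<in> Ob (fdmod R)"
  then have V: "left_module R V" "fin_dim R V" by (auto simp: fdmod_def)
  then show "corner_obj e \<iota> V \<in> Ob (fdmod B)"
    by (simp add: fdmod_def left_module_corner fin_dim_corner)
  show "corner_map V V (Ident (fdmod R) V) = Ident (fdmod B) (corner_obj e \<iota> V)"
    using corner_carrier[OF V(1)] by (auto simp: fdmod_def fun_eq_iff)
next
  fix V W :: "('r, 'm) module" and f
  assume O: "V \<in> Ob (fdmod R)" "W \<in> Ob (fdmod R)" and f: "f \<in> Hom (fdmod R) V W"
  then have V: "left_module R V" and W: "left_module R W" by (auto simp: fdmod_def)
  have f': "f x \<in> carrier W" "r \<in> carrier R \<Longrightarrow> f (r \<odot>\<^bsub>V\<^esub> x) = r \<odot>\<^bsub>W\<^esub> f x" 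
    "y \<in> carrier V \<Longrightarrow> f (x \<oplus>\<^bsub>V\<^esub> y) = f x \<oplus>\<^bsub>W\<^esub> f y" if "x \<in> carrier V" for x y r
    using f that by (auto simp: fdmod_def module_hom_def)
  interpret FV: left_module B "corner_obj e \<iota> V" using left_module_corner[OF V] .
  have fe: "f x \<in> carrier (corner_obj e \<iota> W)" if "x \<in> carrier (corner_obj e \<iota> V)" for x
    using that f'(1) f'(2)[of x e] by (auto simp: corner_carrier[OF V] corner_carrier[OF W])
  show "corner_map V W f \<in> Hom (fdmod B) (corner_obj e \<iota> V) (corner_obj e \<iota> W)"
    unfolding fdmod_def module_hom_def
    using fe FV.V.a_closed FV.lm_closed f' corner_carrier[OF V] by (auto simp: corner_simps)
  fix Z :: "('r, 'm) module" and g
  show "corner_map V Z (Comp (fdmod R) V W Z g f) =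
     Comp (fdmod B) (corner_obj e \<iota> V) (corner_obj e \<iota> W) (corner_obj e \<iota> Z) (corner_map W Z g) (corner_map V W f)"
    using fe corner_carrier[OF V] by (auto simp: fdmod_def compose_def fun_eq_iff)
qed

text \<open>Every vector is recovered from the vectors \<open>b\<^sub>k x\<close> of the corner; this is how fullness of \<open>e\<close>
  enters the proof that the functor is fully faithful.\<close>

lemma decompose:
  assumes V: "left_module R V" and x: "x \<in> carrier V"
  shows "x = finsum V (\<lambda>k. a k \<odot>\<^bsub>V\<^esub> (b k \<odot>\<^bsub>V\<^esub> x)) K"
proof -
  interpret V: left_module R V by fact
  have "x = finsum R (\<lambda>k. a k \<otimes> b k) K \<odot>\<^bsub>V\<^esub> x"
    using x by (simp add: V.lm_one flip: full)
  also have "\<dots> = finsum V (\<lambda>k. (a k \<otimes> b k) \<odot>\<^bsub>V\<^esub> x) K"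
    using x finite_K by (intro V.smult_finsum_left) auto
  also have "\<dots> = finsum V (\<lambda>k. a k \<odot>\<^bsub>V\<^esub> (b k \<odot>\<^bsub>V\<^esub> x)) K"
    using x by (intro V.V.finsum_cong') (auto simp: V.lm_assoc V.lm_closed)
  finally show ?thesis .
qed

lemma b_into_corner:
  assumes V: "left_module R V" and "x \<in> carrier V" "k \<in> K"
  shows "b k \<odot>\<^bsub>V\<^esub> x \<in> carrier (corner_obj e \<iota> V)"
proof -
  interpret V: left_module R V by fact
  show ?thesis using assms by (simp add: corner_carrier V.lm_closed e_b flip: V.lm_assoc)
qed

text \<open>A homomorphism satisfies \<open>f x = \<Sum>\<^sub>k a\<^sub>k f (b\<^sub>k x)\<close>, where only values on the corner occur.\<close>

lemma faithful:
  assumes V: "left_module R V" and W: "left_module R W"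
    and f: "f \<in> module_hom R V W" and g: "g \<in> module_hom R V W"
    and eq: "corner_map V W f = corner_map V W g"
  shows "f = g"
proof (rule extensionalityI)
  show "f \<in> extensional (carrier V)" "g \<in> extensional (carrier V)"
    using f g by (auto simp: module_hom_def PiE_def)
next
  fix x assume x: "x \<in> carrier V"
  interpret V: left_module R V by fact
  interpret W: left_module R W by fact
  have closed: "h y \<in> carrier W" if "h \<in> module_hom R V W" "y \<in> carrier V" for h y
    using that by (auto simp: module_hom_def)
  have determined: "h x = finsum W (\<lambda>k. a k \<odot>\<^bsub>W\<^esub> h (b k \<odot>\<^bsub>V\<^esub> x)) K" if h: "h \<in> module_hom R V W" for h
  proof -
    have "h x = h (finsum V (\<lambda>k. a k \<odot>\<^bsub>V\<^esub> (b k \<odot>\<^bsub>V\<^esub> x)) K)" using decompose[OF V x] by simp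
    also have "\<dots> = finsum W (\<lambda>k. h (a k \<odot>\<^bsub>V\<^esub> (b k \<odot>\<^bsub>V\<^esub> x))) K"
      using h x finite_K by (intro additive_finsum V.V.abelian_group_axioms W.V.abelian_group_axioms)
        (auto simp: module_hom_def V.lm_closed)
    also have "\<dots> = finsum W (\<lambda>k. a k \<odot>\<^bsub>W\<^esub> h (b k \<odot>\<^bsub>V\<^esub> x)) K"
      using h x closed[OF h] by (intro W.V.finsum_cong') (auto simp: module_hom_def V.lm_closed W.lm_closed)
    finally show ?thesis .
  qed
  have "f y = g y" if "y \<in> carrier (corner_obj e \<iota> V)" for y
    using fun_cong[OF eq, of y] that by simp
  then have "finsum W (\<lambda>k. a k \<odot>\<^bsub>W\<^esub> f (b k \<odot>\<^bsub>V\<^esub> x)) K = finsum W (\<lambda>k. a k \<odot>\<^bsub>W\<^esub> g (b k \<odot>\<^bsub>V\<^esub> x)) K"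
    using b_into_corner[OF V x] closed[OF g] x
    by (intro W.V.finsum_cong') (auto simp: V.lm_closed W.lm_closed)
  then show "f x = g x" using determined[OF f] determined[OF g] by simp
qed

text \<open>The formula for \<open>f x\<close> in terms of the corner also serves to extend a given \<open>h\<close>.\<close>

lemma full_on_homs:
  fixes V W :: "('r, 'm) module"
  assumes V: "left_module R V" and W: "left_module R W"
    and h: "h \<in> module_hom B (corner_obj e \<iota> V) (corner_obj e \<iota> W)"
  shows "\<exists>f \<in> module_hom R V W. corner_map V W f = h"
proof -
  interpret V: left_module R V by fact
  interpret W: left_module R W by fact
  interpret FV: left_module B "corner_obj e \<iota> V" using left_module_corner[OF V] .
  interpret FW: left_module B "corner_obj e \<iota> W" using left_module_corner[OF W] .
  let ?eV = "carrier (corner_obj e \<iota> V)" and ?eW = "carrier (corner_obj e \<iota> W)"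
  note cV = corner_carrier[OF V] and cW = corner_carrier[OF W]
  have h_eW: "h y \<in> ?eW" and h_closed: "h y \<in> carrier W"
    and h_add: "z \<in> ?eV \<Longrightarrow> h (y \<oplus>\<^bsub>V\<^esub> z) = h y \<oplus>\<^bsub>W\<^esub> h z"
    and h_smult: "s \<in> carrier B \<Longrightarrow> h (\<iota> s \<odot>\<^bsub>V\<^esub> y) = \<iota> s \<odot>\<^bsub>W\<^esub> h y" if "y \<in> ?eV" for y z s
    using h that cW by (auto simp: module_hom_def corner_simps PiE_mem)
  have h_corner: "h (r \<odot>\<^bsub>V\<^esub> y) = r \<odot>\<^bsub>W\<^esub> h y"
    if r: "r \<in> carrier R" "e \<otimes> r = r" "r \<otimes> e = r" and y: "y \<in> ?eV" for r y
    using corner_is_image[OF r] h_smult[OF y] by auto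
  note bV = b_into_corner[OF V]
  define f where "f = (\<lambda>x \<in> carrier V. finsum W (\<lambda>k. a k \<odot>\<^bsub>W\<^esub> h (b k \<odot>\<^bsub>V\<^esub> x)) K)"
  have f_closed: "f x \<in> carrier W" if "x \<in> carrier V" for x
    using that bV h_closed W.lm_closed by (auto simp: f_def intro!: W.V.finsum_closed)
  have f_add: "f (x \<oplus>\<^bsub>V\<^esub> y) = f x \<oplus>\<^bsub>W\<^esub> f y" if x: "x \<in> carrier V" and y: "y \<in> carrier V" for x y
  proof -
    have "f (x \<oplus>\<^bsub>V\<^esub> y) = finsum W (\<lambda>k. a k \<odot>\<^bsub>W\<^esub> h (b k \<odot>\<^bsub>V\<^esub> (x \<oplus>\<^bsub>V\<^esub> y))) K"
      using x y by (simp add: f_def)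
    also have "\<dots> = finsum W (\<lambda>k. a k \<odot>\<^bsub>W\<^esub> h (b k \<odot>\<^bsub>V\<^esub> x) \<oplus>\<^bsub>W\<^esub> a k \<odot>\<^bsub>W\<^esub> h (b k \<odot>\<^bsub>V\<^esub> y)) K"
      using x y bV h_closed W.lm_closed
      by (intro W.V.finsum_cong') (auto simp: V.lm_r_distr h_add W.lm_r_distr)
    also have "\<dots> = f x \<oplus>\<^bsub>W\<^esub> f y"
      unfolding f_def using x y bV h_closed W.lm_closed by (simp add: W.V.finsum_addf)
    finally show ?thesis .
  qed
  \<comment> \<open>\<open>b\<^sub>k r a\<^sub>j\<close> lies in the corner, hence may be moved past \<open>h\<close>.\<close>
  have f_smult: "f (r \<odot>\<^bsub>V\<^esub> x) = r \<odot>\<^bsub>W\<^esub> f x" if r: "r \<in> carrier R" and x: "x \<in> carrier V" for r x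
  proof -
    have hb: "h (b k \<odot>\<^bsub>V\<^esub> (r \<odot>\<^bsub>V\<^esub> x)) = b k \<odot>\<^bsub>W\<^esub> (r \<odot>\<^bsub>W\<^esub> f x)" if k: "k \<in> K" for k
    proof -
      have bx: "\<And>j. j \<in> K \<Longrightarrow> b j \<odot>\<^bsub>V\<^esub> x \<in> ?eV" using bV x by simp
      have br: "b k \<otimes> r \<otimes> a j \<in> carrier R" "e \<otimes> (b k \<otimes> r \<otimes> a j) = b k \<otimes> r \<otimes> a j"
        "b k \<otimes> r \<otimes> a j \<otimes> e = b k \<otimes> r \<otimes> a j" if "j \<in> K" for j
        using k r that by (auto simp: R.m_assoc a_e) (auto simp: e_b simp flip: R.m_assoc)
      have in_eV: "(b k \<otimes> r \<otimes> a j) \<odot>\<^bsub>V\<^esub> (b j \<odot>\<^bsub>V\<^esub> x) \<in> ?eV" if "j \<in> K" for j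
        using br[OF that] bx[OF that] that by (simp add: cV V.lm_closed flip: V.lm_assoc)
      have "b k \<odot>\<^bsub>V\<^esub> (r \<odot>\<^bsub>V\<^esub> x) = (b k \<otimes> r) \<odot>\<^bsub>V\<^esub> finsum V (\<lambda>j. a j \<odot>\<^bsub>V\<^esub> (b j \<odot>\<^bsub>V\<^esub> x)) K"
        using decompose[OF V x] k r x by (simp add: V.lm_assoc)
      also have "\<dots> = finsum V (\<lambda>j. (b k \<otimes> r) \<odot>\<^bsub>V\<^esub> (a j \<odot>\<^bsub>V\<^esub> (b j \<odot>\<^bsub>V\<^esub> x))) K"
        using k r x finite_K by (intro V.smult_finsum_right) (auto simp: V.lm_closed)
      also have "\<dots> = finsum V (\<lambda>j. (b k \<otimes> r \<otimes> a j) \<odot>\<^bsub>V\<^esub> (b j \<odot>\<^bsub>V\<^esub> x)) K"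
        using k r x by (intro V.V.finsum_cong') (auto simp: V.lm_closed V.lm_assoc)
      also have "\<dots> = finsum (corner_obj e \<iota> V) (\<lambda>j. (b k \<otimes> r \<otimes> a j) \<odot>\<^bsub>V\<^esub> (b j \<odot>\<^bsub>V\<^esub> x)) K"
        using in_eV finite_K by (intro finsum_corner[OF V]) auto
      finally have "h (b k \<odot>\<^bsub>V\<^esub> (r \<odot>\<^bsub>V\<^esub> x)) =
          h (finsum (corner_obj e \<iota> V) (\<lambda>j. (b k \<otimes> r \<otimes> a j) \<odot>\<^bsub>V\<^esub> (b j \<odot>\<^bsub>V\<^esub> x)) K)" by simp
      also have "\<dots> = finsum W (\<lambda>j. h ((b k \<otimes> r \<otimes> a j) \<odot>\<^bsub>V\<^esub> (b j \<odot>\<^bsub>V\<^esub> x))) K"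
        using in_eV finite_K h_closed h_add
        by (intro additive_finsum FV.V.abelian_group_axioms W.V.abelian_group_axioms) (auto simp: corner_simps)
      also have "\<dots> = finsum W (\<lambda>j. (b k \<otimes> r) \<odot>\<^bsub>W\<^esub> (a j \<odot>\<^bsub>W\<^esub> h (b j \<odot>\<^bsub>V\<^esub> x))) K"
        using br bx h_corner h_closed k r by (intro W.V.finsum_cong') (auto simp: W.lm_closed W.lm_assoc)
      also have "\<dots> = (b k \<otimes> r) \<odot>\<^bsub>W\<^esub> f x"
        unfolding f_def using k r x finite_K bx h_closed
        by (simp add: W.smult_finsum_right W.lm_closed)
      finally show ?thesis using k r x f_closed by (simp add: W.lm_assoc)
    qed
    have "f (r \<odot>\<^bsub>V\<^esub> x) = finsum W (\<lambda>k. a k \<odot>\<^bsub>W\<^esub> (b k \<odot>\<^bsub>W\<^esub> (r \<odot>\<^bsub>W\<^esub> f x))) K"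
      unfolding f_def[THEN fun_cong, of "r \<odot>\<^bsub>V\<^esub> x"] using r x f_closed hb
      by (auto simp: V.lm_closed W.lm_closed intro!: W.V.finsum_cong')
    then show ?thesis using decompose[OF W, of "r \<odot>\<^bsub>W\<^esub> f x"] r x f_closed W.lm_closed by simp
  qed
  have f_h: "f x = h x" if x: "x \<in> ?eV" for x
  proof -
    have xV: "x \<in> carrier V" and ex: "e \<odot>\<^bsub>V\<^esub> x = x" using x by (auto simp: cV)
    have be: "b k \<otimes> e \<in> carrier R" "e \<otimes> (b k \<otimes> e) = b k \<otimes> e" "b k \<otimes> e \<otimes> e = b k \<otimes> e"
      if "k \<in> K" for k
      using that by (auto simp: R.m_assoc) (auto simp: e_b simp flip: R.m_assoc)
    have hb: "h (b k \<odot>\<^bsub>V\<^esub> x) = b k \<odot>\<^bsub>W\<^esub> h x" if k: "k \<in> K" for k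
    proof -
      have "b k \<odot>\<^bsub>V\<^esub> x = (b k \<otimes> e) \<odot>\<^bsub>V\<^esub> x" using k xV ex by (simp add: V.lm_assoc)
      then have "h (b k \<odot>\<^bsub>V\<^esub> x) = (b k \<otimes> e) \<odot>\<^bsub>W\<^esub> h x" using h_corner[OF be[OF k] x] by simp
      then show ?thesis using h_eW[OF x] k by (simp add: cW W.lm_assoc)
    qed
    have "f x = finsum W (\<lambda>k. a k \<odot>\<^bsub>W\<^esub> (b k \<odot>\<^bsub>W\<^esub> h x)) K"
      unfolding f_def using xV hb h_closed[OF x]
      by (auto simp: W.lm_closed intro!: W.V.finsum_cong')
    then show ?thesis using decompose[OF W h_closed[OF x]] by simp
  qed
  have "f \<in> module_hom R V W"
    using f_closed f_add f_smult by (auto simp: module_hom_def f_def)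
  moreover have "corner_map V W f = h"
    by (rule extensionalityI[of _ ?eV]) (use f_h h in \<open>auto simp: module_hom_def PiE_def\<close>)
  ultimately show ?thesis by blast
qed

end

context full_corner
begin

subsection \<open>Coinduction\<close>

definition eR :: "'r set" where
  "eR = {x \<in> carrier R. e \<otimes> x = x}"

text \<open>The coinduced module \<open>Hom\<^sub>B(e R, W)\<close>. Compared with \<open>R e \<otimes>\<^sub>B W\<close>, which is isomorphic to it when \<open>e\<close>
  is full, it has the advantage that its elements are functions and need no quotient.\<close>

definition coinduced :: "('b, 'm) module \<Rightarrow> ('r, 'r \<Rightarrow> 'm) module" where
  "coinduced W =
     \<lparr>carrier = {\<phi> \<in> eR \<rightarrow>\<^sub>E carrier W.
        (\<forall>x \<in> eR. \<forall>y \<in> eR. \<phi> (x \<oplus> y) = \<phi> x \<oplus>\<^bsub>W\<^esub> \<phi> y) \<and>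
        (\<forall>s \<in> carrier B. \<forall>x \<in> eR. \<phi> (\<iota> s \<otimes> x) = s \<odot>\<^bsub>W\<^esub> \<phi> x)},
      mult = undefined, one = undefined,
      zero = (\<lambda>x \<in> eR. \<zero>\<^bsub>W\<^esub>),
      add = (\<lambda>\<phi> \<psi>. \<lambda>x \<in> eR. \<phi> x \<oplus>\<^bsub>W\<^esub> \<psi> x),
      smult = (\<lambda>r \<phi>. \<lambda>x \<in> eR. \<phi> (x \<otimes> r))\<rparr>"

lemma eR_closed:
  "x \<in> eR \<Longrightarrow> x \<in> carrier R"
  "x \<in> eR \<Longrightarrow> y \<in> eR \<Longrightarrow> x \<oplus> y \<in> eR"
  "x \<in> eR \<Longrightarrow> r \<in> carrier R \<Longrightarrow> x \<otimes> r \<in> eR"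
  "s \<in> carrier B \<Longrightarrow> r \<in> carrier R \<Longrightarrow> \<iota> s \<otimes> r \<in> eR"
  "e \<in> eR" "k \<in> K \<Longrightarrow> b k \<in> eR"
  by (auto simp: eR_def R.r_distr e_b e_\<iota> simp flip: R.m_assoc)

lemma coinducedD:
  assumes "\<phi> \<in> carrier (coinduced W)"
  shows "x \<in> eR \<Longrightarrow> \<phi> x \<in> carrier W"
    "x \<in> eR \<Longrightarrow> y \<in> eR \<Longrightarrow> \<phi> (x \<oplus> y) = \<phi> x \<oplus>\<^bsub>W\<^esub> \<phi> y"
    "s \<in> carrier B \<Longrightarrow> x \<in> eR \<Longrightarrow> \<phi> (\<iota> s \<otimes> x) = s \<odot>\<^bsub>W\<^esub> \<phi> x"
    "\<phi> \<in> extensional eR"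
  using assms by (auto simp: coinduced_def PiE_def)

lemma coinducedI:
  assumes "\<And>x. x \<in> eR \<Longrightarrow> \<phi> x \<in> carrier W" "\<phi> \<in> extensional eR"
    "\<And>x y. x \<in> eR \<Longrightarrow> y \<in> eR \<Longrightarrow> \<phi> (x \<oplus> y) = \<phi> x \<oplus>\<^bsub>W\<^esub> \<phi> y"
    "\<And>s x. s \<in> carrier B \<Longrightarrow> x \<in> eR \<Longrightarrow> \<phi> (\<iota> s \<otimes> x) = s \<odot>\<^bsub>W\<^esub> \<phi> x"
  shows "\<phi> \<in> carrier (coinduced W)"
  using assms by (auto simp: coinduced_def PiE_def)

lemma coinduced_simps:
  "\<zero>\<^bsub>coinduced W\<^esub> = (\<lambda>x \<in> eR. \<zero>\<^bsub>W\<^esub>)"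
  "\<phi> \<oplus>\<^bsub>coinduced W\<^esub> \<psi> = (\<lambda>x \<in> eR. \<phi> x \<oplus>\<^bsub>W\<^esub> \<psi> x)"
  "r \<odot>\<^bsub>coinduced W\<^esub> \<phi> = (\<lambda>x \<in> eR. \<phi> (x \<otimes> r))"
  by (auto simp: coinduced_def)

lemma left_module_coinduced:
  assumes W: "left_module B W"
  shows "left_module R (coinduced W)"
proof -
  interpret W: left_module B W by fact
  note D = coinducedD[where W = W] and S = coinduced_simps
  have smult_zero: "s \<odot>\<^bsub>W\<^esub> \<zero>\<^bsub>W\<^esub> = \<zero>\<^bsub>W\<^esub>" if "s \<in> carrier B" for s
    using W.smult_finsum_right[of s "{}"] that by simp
  have smult_neg: "s \<odot>\<^bsub>W\<^esub> (\<ominus>\<^bsub>W\<^esub> x) = \<ominus>\<^bsub>W\<^esub> (s \<odot>\<^bsub>W\<^esub> x)" if "s \<in> carrier B" "x \<in> carrier W" for s x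
  proof (rule W.V.minus_equality[symmetric])
    show "s \<odot>\<^bsub>W\<^esub> (\<ominus>\<^bsub>W\<^esub> x) \<oplus>\<^bsub>W\<^esub> s \<odot>\<^bsub>W\<^esub> x = \<zero>\<^bsub>W\<^esub>"
      using that smult_zero W.lm_r_distr[of s "\<ominus>\<^bsub>W\<^esub> x" x] by (simp add: W.V.l_neg)
  qed (use that W.lm_closed in auto)
  have zero: "\<zero>\<^bsub>coinduced W\<^esub> \<in> carrier (coinduced W)"
    by (rule coinducedI) (auto simp: S smult_zero eR_closed)
  have add: "\<phi> \<oplus>\<^bsub>coinduced W\<^esub> \<psi> \<in> carrier (coinduced W)"
    if "\<phi> \<in> carrier (coinduced W)" "\<psi> \<in> carrier (coinduced W)" for \<phi> \<psi>
    by (rule coinducedI) (use D[OF that(1)] D[OF that(2)] in \<open>auto simp: S eR_closed W.lm_r_distr W.V.a_ac\<close>)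
  have smult: "r \<odot>\<^bsub>coinduced W\<^esub> \<phi> \<in> carrier (coinduced W)"
    if "\<phi> \<in> carrier (coinduced W)" "r \<in> carrier R" for r \<phi>
    by (rule coinducedI) (use D[OF that(1)] that(2) in \<open>auto simp: S eR_closed R.l_distr R.m_assoc\<close>)
  have "abelian_group (coinduced W)"
  proof (rule abelian_groupI)
    fix \<phi> assume phi: "\<phi> \<in> carrier (coinduced W)"
    show "\<zero>\<^bsub>coinduced W\<^esub> \<oplus>\<^bsub>coinduced W\<^esub> \<phi> = \<phi>"
      by (rule extensionalityI[of _ eR]) (use D[OF phi] in \<open>auto simp: S\<close>)
    have "(\<lambda>x \<in> eR. \<ominus>\<^bsub>W\<^esub> \<phi> x) \<in> carrier (coinduced W)"
      by (rule coinducedI) (use D[OF phi] in \<open>auto simp: eR_closed smult_neg W.V.minus_add\<close>)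
    moreover have "(\<lambda>x \<in> eR. \<ominus>\<^bsub>W\<^esub> \<phi> x) \<oplus>\<^bsub>coinduced W\<^esub> \<phi> = \<zero>\<^bsub>coinduced W\<^esub>"
      using D[OF phi] by (auto simp: S W.V.l_neg intro!: restrict_ext)
    ultimately show "\<exists>\<psi>\<in>carrier (coinduced W). \<psi> \<oplus>\<^bsub>coinduced W\<^esub> \<phi> = \<zero>\<^bsub>coinduced W\<^esub>" by blast
  next
    fix \<phi> \<psi> assume phi: "\<phi> \<in> carrier (coinduced W)" "\<psi> \<in> carrier (coinduced W)"
    show "\<phi> \<oplus>\<^bsub>coinduced W\<^esub> \<psi> = \<psi> \<oplus>\<^bsub>coinduced W\<^esub> \<phi>"
      using D[OF phi(1)] D[OF phi(2)] by (auto simp: S W.V.a_ac intro!: restrict_ext)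
    fix \<chi> assume chi: "\<chi> \<in> carrier (coinduced W)"
    show "\<phi> \<oplus>\<^bsub>coinduced W\<^esub> \<psi> \<oplus>\<^bsub>coinduced W\<^esub> \<chi> = \<phi> \<oplus>\<^bsub>coinduced W\<^esub> (\<psi> \<oplus>\<^bsub>coinduced W\<^esub> \<chi>)"
      using D[OF phi(1)] D[OF phi(2)] D[OF chi] by (auto simp: S W.V.a_assoc intro!: restrict_ext)
  qed (use zero add in auto)
  then show ?thesis
  proof (intro left_module.intro left_module_axioms.intro R.ring_axioms)
    fix \<phi> assume phi: "\<phi> \<in> carrier (coinduced W)"
    show "\<one> \<odot>\<^bsub>coinduced W\<^esub> \<phi> = \<phi>"
      by (rule extensionalityI[of _ eR]) (use D[OF phi] in \<open>auto simp: S eR_closed\<close>)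
    fix r assume r: "r \<in> carrier R"
    fix s assume s: "s \<in> carrier R"
    show "(r \<oplus> s) \<odot>\<^bsub>coinduced W\<^esub> \<phi> = r \<odot>\<^bsub>coinduced W\<^esub> \<phi> \<oplus>\<^bsub>coinduced W\<^esub> s \<odot>\<^bsub>coinduced W\<^esub> \<phi>"
      using D[OF phi] r s by (auto simp: S R.r_distr eR_closed intro!: restrict_ext)
    show "(r \<otimes> s) \<odot>\<^bsub>coinduced W\<^esub> \<phi> = r \<odot>\<^bsub>coinduced W\<^esub> (s \<odot>\<^bsub>coinduced W\<^esub> \<phi>)"
      using D[OF phi] r s by (auto simp: S R.m_assoc eR_closed intro!: restrict_ext)
  next
    fix r \<phi> \<psi> assume r: "r \<in> carrier R" and phi: "\<phi> \<in> carrier (coinduced W)" "\<psi> \<in> carrier (coinduced W)"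
    show "r \<odot>\<^bsub>coinduced W\<^esub> (\<phi> \<oplus>\<^bsub>coinduced W\<^esub> \<psi>) = r \<odot>\<^bsub>coinduced W\<^esub> \<phi> \<oplus>\<^bsub>coinduced W\<^esub> r \<odot>\<^bsub>coinduced W\<^esub> \<psi>"
      using D[OF phi(1)] D[OF phi(2)] r by (auto simp: S eR_closed intro!: restrict_ext)
  qed (use smult in auto)
qed

text \<open>The element \<open>c \<cdot> 1\<close> of \<open>R\<close> acts by right multiplication on the argument of \<open>\<phi>\<close>. Being central, it can be
  moved to the left, where it is \<open>\<iota> (c \<cdot> 1)\<close> on \<open>e R\<close>.\<close>

lemma scalar_coinduced:
  assumes "\<phi> \<in> carrier (coinduced W)" "x \<in> eR"
  shows "(scalar R c \<odot>\<^bsub>coinduced W\<^esub> \<phi>) x = scalar B c \<odot>\<^bsub>W\<^esub> \<phi> x"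
proof -
  have x: "x \<in> carrier R" "e \<otimes> x = x" using assms(2) by (auto simp: eR_def)
  have "x \<otimes> scalar R c = scalar R c \<otimes> (e \<otimes> x)" using R.scalar_commute[OF x(1), of c] x(2) by simp
  also have "\<dots> = \<iota> (scalar B c) \<otimes> x"
    using R.scalar_commute[OF e_closed, of c] x(1) by (simp add: \<iota>_scalar flip: R.m_assoc)
  finally have "x \<otimes> scalar R c = \<iota> (scalar B c) \<otimes> x" .
  then show ?thesis using coinducedD[OF assms(1)] assms(2) by (simp add: coinduced_simps)
qed

text \<open>For \<open>y \<in> R e\<close> the product \<open>x y\<close> lies in \<open>e R e\<close> and acts on \<open>W\<close> through the inverse of \<open>\<iota>\<close>.\<close>

definition tensor_map :: "('b, 'm) module \<Rightarrow> 'r \<Rightarrow> 'm \<Rightarrow> 'r \<Rightarrow> 'm" where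
  "tensor_map W y w = (\<lambda>x \<in> eR. inv_into (carrier B) \<iota> (x \<otimes> y) \<odot>\<^bsub>W\<^esub> w)"

lemma \<iota>_inverse:
  assumes "x \<in> eR" "y \<in> carrier R" "y \<otimes> e = y"
  shows "inv_into (carrier B) \<iota> (x \<otimes> y) \<in> carrier B" "\<iota> (inv_into (carrier B) \<iota> (x \<otimes> y)) = x \<otimes> y"
proof -
  have "\<exists>s \<in> carrier B. \<iota> s = x \<otimes> y"
    using assms by (intro corner_is_image) (auto simp: eR_def R.m_assoc simp flip: R.m_assoc[of e])
  then have "x \<otimes> y \<in> \<iota> ` carrier B" by (metis imageI)
  then show "inv_into (carrier B) \<iota> (x \<otimes> y) \<in> carrier B" "\<iota> (inv_into (carrier B) \<iota> (x \<otimes> y)) = x \<otimes> y"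
    by (rule inv_into_into, rule f_inv_into_f)
qed

lemma tensor_map_in_coinduced:
  assumes W: "left_module B W" and y: "y \<in> carrier R" "y \<otimes> e = y" and w: "w \<in> carrier W"
  shows "tensor_map W y w \<in> carrier (coinduced W)"
proof -
  interpret W: left_module B W by fact
  let ?\<rho> = "inv_into (carrier B) \<iota>"
  note \<rho> = \<iota>_inverse[OF _ y]
  show ?thesis
  proof (rule coinducedI)
    fix x z assume xz: "x \<in> eR" "z \<in> eR"
    have "?\<rho> ((x \<oplus> z) \<otimes> y) = ?\<rho> (x \<otimes> y) \<oplus>\<^bsub>B\<^esub> ?\<rho> (z \<otimes> y)"
      by (rule inj_onD[OF \<iota>_inj]) (use xz y \<rho> \<rho>[of "x \<oplus> z"] in \<open>auto simp: eR_closed \<iota>_add R.l_distr\<close>)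
    then show "tensor_map W y w (x \<oplus> z) = tensor_map W y w x \<oplus>\<^bsub>W\<^esub> tensor_map W y w z"
      using xz \<rho> w by (simp add: tensor_map_def eR_closed W.lm_l_distr)
  next
    fix s x assume s: "s \<in> carrier B" and x: "x \<in> eR"
    have "?\<rho> ((\<iota> s \<otimes> x) \<otimes> y) = s \<otimes>\<^bsub>B\<^esub> ?\<rho> (x \<otimes> y)"
      by (rule inj_onD[OF \<iota>_inj]) (use x s y \<rho> \<rho>[of "\<iota> s \<otimes> x"] in \<open>auto simp: eR_closed \<iota>_mult R.m_assoc\<close>)
    then show "tensor_map W y w (\<iota> s \<otimes> x) = s \<odot>\<^bsub>W\<^esub> tensor_map W y w x"
      using x s \<rho> w by (simp add: tensor_map_def eR_closed W.lm_assoc)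
  qed (use \<rho> w W.lm_closed in \<open>auto simp: tensor_map_def\<close>)
qed

text \<open>Write \<open>x = \<Sum>\<^sub>k (x a\<^sub>k) b\<^sub>k\<close> with \<open>x a\<^sub>k \<in> e R e\<close> and use linearity of \<open>\<phi>\<close> over \<open>e R e\<close>. This
  bounds the size of the coinduced module, both its dimension and its cardinality.\<close>

lemma coinduced_expansion:
  assumes W: "left_module B W" and phi: "\<phi> \<in> carrier (coinduced W)" and x: "x \<in> eR"
  shows "\<phi> x = finsum W (\<lambda>k. tensor_map W (a k) (\<phi> (b k)) x) K"
proof -
  interpret W: left_module B W by fact
  note D = coinducedD[OF phi]
  let ?eR = "R\<lparr>carrier := eR\<rparr>"
  have add_eR: "abelian_group ?eR"
  proof (rule abelian_groupI)
    fix z assume z: "z \<in> carrier ?eR"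
    have "e \<otimes> (\<ominus> z) = \<ominus> z" using z by (simp add: eR_def R.r_minus)
    then show "\<exists>y\<in>carrier ?eR. y \<oplus>\<^bsub>?eR\<^esub> z = \<zero>\<^bsub>?eR\<^esub>"
      using z by (intro bexI[of _ "\<ominus> z"]) (auto simp: eR_def R.l_neg)
  qed (auto simp: eR_def R.r_distr R.a_ac)
  interpret E: abelian_group ?eR by (fact add_eR)
  have in_eR: "x \<otimes> a k \<otimes> b k \<in> eR" if "k \<in> K" for k
    using x that by (simp add: eR_closed)
  have "x = x \<otimes> finsum R (\<lambda>k. a k \<otimes> b k) K" using x by (simp add: eR_closed flip: full)
  also have "\<dots> = finsum R (\<lambda>k. x \<otimes> a k \<otimes> b k) K"
    using x finite_K by (subst R.finsum_rdistr) (auto simp: eR_closed R.m_assoc intro!: R.finsum_cong')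
  also have "\<dots> = finsum ?eR (\<lambda>k. x \<otimes> a k \<otimes> b k) K"
    using in_eR finite_K
    by (intro additive_finsum[OF add_eR R.abelian_group_axioms, of "\<lambda>x. x", symmetric]) (auto simp: eR_closed)
  finally have "\<phi> x = \<phi> (finsum ?eR (\<lambda>k. x \<otimes> a k \<otimes> b k) K)" by simp
  also have "\<dots> = finsum W (\<lambda>k. \<phi> (x \<otimes> a k \<otimes> b k)) K"
    using D in_eR finite_K by (intro additive_finsum add_eR W.V.abelian_group_axioms) auto
  also have "\<dots> = finsum W (\<lambda>k. tensor_map W (a k) (\<phi> (b k)) x) K"
  proof (rule W.V.finsum_cong')
    show "(\<lambda>k. tensor_map W (a k) (\<phi> (b k)) x) \<in> K \<rightarrow> carrier W"
      using x D by (auto intro!: coinducedD(1)[OF tensor_map_in_coinduced[OF W]] simp: a_e eR_closed)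
  next
    fix k assume k: "k \<in> K"
    show "\<phi> (x \<otimes> a k \<otimes> b k) = tensor_map W (a k) (\<phi> (b k)) x"
      using D(3)[of "inv_into (carrier B) \<iota> (x \<otimes> a k)" "b k"] \<iota>_inverse[OF x, of "a k"] k x
      by (simp add: a_e tensor_map_def eR_closed)
  qed simp
  finally show ?thesis .
qed

lemma coinduced_lepoll:
  assumes W: "left_module B W"
  shows "carrier (coinduced W) \<lesssim> (K \<rightarrow>\<^sub>E carrier W)"
  unfolding lepoll_def
proof (intro exI[of _ "\<lambda>\<phi>. \<lambda>k \<in> K. \<phi> (b k)"] conjI inj_onI)
  fix \<phi> \<psi> assume phi: "\<phi> \<in> carrier (coinduced W)" "\<psi> \<in> carrier (coinduced W)"
    and eq: "(\<lambda>k \<in> K. \<phi> (b k)) = (\<lambda>k \<in> K. \<psi> (b k))"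
  interpret W: left_module B W by fact
  have eq': "\<phi> (b k) = \<psi> (b k)" if "k \<in> K" for k using fun_cong[OF eq, of k] that by simp
  show "\<phi> = \<psi>"
  proof (rule extensionalityI[of _ eR])
    fix x assume x: "x \<in> eR"
    show "\<phi> x = \<psi> x"
      unfolding coinduced_expansion[OF W phi(1) x] coinduced_expansion[OF W phi(2) x]
      using x coinducedD(1)[OF phi(2)] eq'
      by (intro W.V.finsum_cong') (auto intro!: coinducedD(1)[OF tensor_map_in_coinduced[OF W]] simp: a_e eR_closed)
  qed (use phi in \<open>auto dest: coinducedD(4)\<close>)
next
  show "(\<lambda>\<phi>. \<lambda>k \<in> K. \<phi> (b k)) ` carrier (coinduced W) \<subseteq> K \<rightarrow>\<^sub>E carrier W"
    by (auto simp: eR_closed coinducedD(1))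
qed

lemma coinduced_embeds:
  fixes W :: "('b, 'm) module"
  assumes W: "left_module B W"
  shows "\<exists>f :: ('r \<Rightarrow> 'm) \<Rightarrow> 'm. inj_on f (carrier (coinduced W))"
proof -
  have "(K \<rightarrow>\<^sub>E carrier W) \<lesssim> carrier W"
    using fdmod_object_infinite_or_zero[OF B.complex_algebra_axioms W]
  proof
    assume "carrier W = {\<zero>\<^bsub>W\<^esub>}"
    then have "(K \<rightarrow>\<^sub>E carrier W) = {\<lambda>k \<in> K. \<zero>\<^bsub>W\<^esub>}" by (simp add: PiE_singleton)
    then show ?thesis using \<open>carrier W = {\<zero>\<^bsub>W\<^esub>}\<close> by (simp add: singleton_lepoll)
  qed (rule PiE_lepoll_infinite[OF finite_K])
  then have "carrier (coinduced W) \<lesssim> carrier W" by (rule lepoll_trans[OF coinduced_lepoll[OF W]])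
  then show ?thesis unfolding lepoll_def by blast
qed

text \<open>If \<open>S\<close> spans \<open>W\<close>, expanding the values \<open>\<phi> (b\<^sub>k)\<close> in \<open>S\<close> shows that the maps \<open>x \<mapsto> (x a\<^sub>k) u\<close> with
  \<open>u \<in> S\<close> span the coinduced module.\<close>

lemma fin_dim_coinduced:
  fixes W :: "('b, 'm) module"
  assumes W: "left_module B W" and fin: "fin_dim B W"
  shows "fin_dim R (coinduced W)"
proof -
  interpret W: left_module B W by fact
  interpret C: left_module R "coinduced W" using left_module_coinduced[OF W] .
  obtain S where S: "finite S" "S \<subseteq> carrier W"
    and span: "\<And>x. x \<in> carrier W \<Longrightarrow> \<exists>c. x = finsum W (\<lambda>u. scalar B (c u) \<odot>\<^bsub>W\<^esub> u) S"
    using fin unfolding fin_dim_def by auto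
  have tm: "tensor_map W (a k) u \<in> carrier (coinduced W)" if "k \<in> K" "u \<in> carrier W" for k u
    using that by (intro tensor_map_in_coinduced[OF W]) (auto simp: a_e)
  have eval: "(finsum (coinduced W) g J) x = finsum W (\<lambda>j. g j x) J"
    if "x \<in> eR" "finite J" "g \<in> J \<rightarrow> carrier (coinduced W)" for x J and g :: "'j \<Rightarrow> _"
    using that coinducedD(1)
    by (intro additive_finsum[where f = "\<lambda>\<phi>. \<phi> x"] C.V.abelian_group_axioms W.V.abelian_group_axioms)
       (auto simp: coinduced_simps)
  show ?thesis
  proof (rule fin_dimI[OF R.complex_algebra_axioms C.left_module_axioms])
    let ?S = "(\<lambda>(k, u). tensor_map W (a k) u) ` (K \<times> S)"
    show "finite ?S" "?S \<subseteq> carrier (coinduced W)" using finite_K S tm by auto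
    fix \<phi> U
    assume phi: "\<phi> \<in> carrier (coinduced W)" and U: "\<zero>\<^bsub>coinduced W\<^esub> \<in> U"
      "\<And>y z. \<lbrakk>y \<in> U; z \<in> U\<rbrakk> \<Longrightarrow> y \<oplus>\<^bsub>coinduced W\<^esub> z \<in> U" "U \<subseteq> carrier (coinduced W)"
      "\<And>c y. y \<in> ?S \<Longrightarrow> scalar R c \<odot>\<^bsub>coinduced W\<^esub> y \<in> U"
    have "\<forall>k\<in>K. \<exists>c. \<phi> (b k) = finsum W (\<lambda>u. scalar B (c u) \<odot>\<^bsub>W\<^esub> u) S"
      using span coinducedD(1)[OF phi] by (simp add: eR_closed)
    then obtain c where c: "\<And>k. k \<in> K \<Longrightarrow> \<phi> (b k) = finsum W (\<lambda>u. scalar B (c k u) \<odot>\<^bsub>W\<^esub> u) S"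
      by metis
    have inU: "(\<lambda>u. scalar R (c k u) \<odot>\<^bsub>coinduced W\<^esub> tensor_map W (a k) u) \<in> S \<rightarrow> U" if "k \<in> K" for k
      using that U(4) by auto
    define \<psi> where "\<psi> k = finsum (coinduced W) (\<lambda>u. scalar R (c k u) \<odot>\<^bsub>coinduced W\<^esub> tensor_map W (a k) u) S" for k
    have \<psi>_U: "\<psi> k \<in> U" if "k \<in> K" for k
      unfolding \<psi>_def using U S inU[OF that] by (intro C.V.finsum_in_closed_subset) auto
    have \<psi>_x: "\<psi> k x = tensor_map W (a k) (\<phi> (b k)) x" if k: "k \<in> K" and x: "x \<in> eR" for k x
    proof -
      let ?r = "inv_into (carrier B) \<iota> (x \<otimes> a k)"
      note r = \<iota>_inverse(1)[OF x a_closed[OF k] a_e[OF k]]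
      have "\<psi> k x = finsum W (\<lambda>u. (scalar R (c k u) \<odot>\<^bsub>coinduced W\<^esub> tensor_map W (a k) u) x) S"
        unfolding \<psi>_def using x S inU[OF k] U by (intro eval) auto
      also have "\<dots> = finsum W (\<lambda>u. ?r \<odot>\<^bsub>W\<^esub> (scalar B (c k u) \<odot>\<^bsub>W\<^esub> u)) S"
      proof (rule W.V.finsum_cong')
        fix u assume "u \<in> S"
        then have u: "u \<in> carrier W" using S by auto
        show "(scalar R (c k u) \<odot>\<^bsub>coinduced W\<^esub> tensor_map W (a k) u) x = ?r \<odot>\<^bsub>W\<^esub> (scalar B (c k u) \<odot>\<^bsub>W\<^esub> u)"
          using r x u B.scalar_commute[OF r, of "c k u"]
          by (simp add: scalar_coinduced[OF tm[OF k u] x]) (simp add: tensor_map_def flip: W.lm_assoc)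
      qed (use r S W.lm_closed in auto)
      also have "\<dots> = ?r \<odot>\<^bsub>W\<^esub> finsum W (\<lambda>u. scalar B (c k u) \<odot>\<^bsub>W\<^esub> u) S"
        using r S W.lm_closed by (intro W.smult_finsum_right[symmetric]) auto
      finally show ?thesis using x c[OF k] by (simp add: tensor_map_def)
    qed
    have "\<phi> = finsum (coinduced W) \<psi> K"
    proof (rule extensionalityI[of _ eR])
      have "finsum (coinduced W) \<psi> K \<in> carrier (coinduced W)"
        using \<psi>_U U by (intro C.V.finsum_closed) auto
      then show "finsum (coinduced W) \<psi> K \<in> extensional eR" by (rule coinducedD(4))
    next
      fix x assume x: "x \<in> eR"
      have "finsum (coinduced W) \<psi> K x = finsum W (\<lambda>k. \<psi> k x) K"
        using x finite_K \<psi>_U U by (intro eval) auto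
      also have "\<dots> = finsum W (\<lambda>k. tensor_map W (a k) (\<phi> (b k)) x) K"
        using x \<psi>_x coinducedD(1)[OF phi]
        by (intro W.V.finsum_cong') (auto intro!: coinducedD(1)[OF tm] simp: eR_closed)
      finally show "\<phi> x = finsum (coinduced W) \<psi> K x" using coinduced_expansion[OF W phi x] by simp
    qed (rule coinducedD(4)[OF phi])
    also have "\<dots> \<in> U" using \<psi>_U U finite_K by (intro C.V.finsum_in_closed_subset) auto
    finally show "\<phi> \<in> U" .
  qed
qed

text \<open>Evaluation at \<open>e\<close> identifies \<open>e Hom\<^sub>B(e R, W)\<close> with \<open>W\<close>: if \<open>e \<phi> = \<phi>\<close>, then
  \<open>\<phi> z = \<phi> (z e) = (z e) \<phi> e\<close>, and conversely \<open>w\<close> is the value of \<open>z \<mapsto> (z e) w\<close>.\<close>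

lemma essentially_surjective:
  fixes W :: "('b, 'm) module"
  assumes "W \<in> Ob (fdmod B)"
  shows "\<exists>V \<in> Ob (fdmod R :: (('r, 'm) module, 'm \<Rightarrow> 'm) cat). \<exists>f. is_iso (fdmod B) (corner_obj e \<iota> V) W f"
proof -
  have W: "left_module B W" "fin_dim B W" using assms by (auto simp: fdmod_def)
  interpret W: left_module B W by (fact W)
  obtain j :: "('r \<Rightarrow> 'm) \<Rightarrow> 'm" where j: "inj_on j (carrier (coinduced W))"
    using coinduced_embeds[OF W(1)] by blast
  interpret C: left_module R "coinduced W" using left_module_coinduced[OF W(1)] .
  define V where "V = transport j (coinduced W)"
  have V: "left_module R V" "fin_dim R V"
    unfolding V_def
    using left_module_transport[OF C.left_module_axioms j]
      fin_dim_transport[OF R.complex_algebra_axioms C.left_module_axioms j fin_dim_coinduced[OF W]] by auto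
  interpret V: left_module R V by (fact V)
  let ?eV = "corner_obj e \<iota> V"
  have FV: "left_module B ?eV" "fin_dim B ?eV"
    using left_module_corner[OF V(1)] fin_dim_corner[OF V] by auto
  have eV: "x \<in> carrier ?eV \<longleftrightarrow> (\<exists>\<phi> \<in> carrier (coinduced W). x = j \<phi> \<and> e \<odot>\<^bsub>coinduced W\<^esub> \<phi> = \<phi>)" for x
    unfolding corner_carrier[OF V(1)]
    using j C.lm_closed[of e] by (auto simp: V_def transport_def inj_on_eq_iff)
  note D = coinducedD[where W = W]
  define f where "f = (\<lambda>x \<in> carrier ?eV. inv_into (carrier (coinduced W)) j x e)"
  have f_j: "f (j \<phi>) = \<phi> e" if "\<phi> \<in> carrier (coinduced W)" "e \<odot>\<^bsub>coinduced W\<^esub> \<phi> = \<phi>" for \<phi>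
    using that j eV by (auto simp: f_def)
  have j_ops: "j \<phi> \<oplus>\<^bsub>?eV\<^esub> j \<psi> = j (\<phi> \<oplus>\<^bsub>coinduced W\<^esub> \<psi>)" "s \<odot>\<^bsub>?eV\<^esub> j \<phi> = j (\<iota> s \<odot>\<^bsub>coinduced W\<^esub> \<phi>)"
    if "\<phi> \<in> carrier (coinduced W)" "\<psi> \<in> carrier (coinduced W)" for \<phi> \<psi> s
    using that j by (auto simp: corner_simps V_def transport_def)
  have hom: "f \<in> module_hom B ?eV W"
    unfolding module_hom_def
  proof (intro CollectI conjI ballI PiE_I)
    fix x assume "x \<in> carrier ?eV"
    then obtain \<phi> where phi: "\<phi> \<in> carrier (coinduced W)" "x = j \<phi>" "e \<odot>\<^bsub>coinduced W\<^esub> \<phi> = \<phi>" using eV by auto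
    then show "f x \<in> carrier W" using D(1)[OF phi(1)] by (simp add: f_j eR_closed)
    {
      fix y assume "y \<in> carrier ?eV"
      then obtain \<psi> where psi: "\<psi> \<in> carrier (coinduced W)" "y = j \<psi>" "e \<odot>\<^bsub>coinduced W\<^esub> \<psi> = \<psi>" using eV by auto
      have "f (j (\<phi> \<oplus>\<^bsub>coinduced W\<^esub> \<psi>)) = (\<phi> \<oplus>\<^bsub>coinduced W\<^esub> \<psi>) e"
        using phi psi by (intro f_j) (auto simp: C.lm_r_distr)
      then show "f (x \<oplus>\<^bsub>?eV\<^esub> y) = f x \<oplus>\<^bsub>W\<^esub> f y"
        using phi psi by (simp add: j_ops f_j) (simp add: coinduced_simps eR_closed)
    next
      fix s assume s: "s \<in> carrier B"
      have "f (j (\<iota> s \<odot>\<^bsub>coinduced W\<^esub> \<phi>)) = (\<iota> s \<odot>\<^bsub>coinduced W\<^esub> \<phi>) e"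
        using phi s by (intro f_j) (auto simp: C.lm_closed e_\<iota> simp flip: C.lm_assoc)
      also have "\<dots> = s \<odot>\<^bsub>W\<^esub> \<phi> e"
        using D(3)[OF phi(1) s, of e] s by (simp add: coinduced_simps eR_closed e_\<iota> \<iota>_e)
      finally show "f (s \<odot>\<^bsub>?eV\<^esub> x) = s \<odot>\<^bsub>W\<^esub> f x"
        using phi by (simp add: j_ops f_j)
    }
  qed (simp add: f_def)
  have "bij_betw f (carrier ?eV) (carrier W)"
    unfolding bij_betw_def
  proof (intro conjI inj_onI equalityI subsetI)
    fix x y assume "x \<in> carrier ?eV" "y \<in> carrier ?eV" and eq: "f x = f y"
    then obtain \<phi> \<psi> where phi: "\<phi> \<in> carrier (coinduced W)" "x = j \<phi>" "e \<odot>\<^bsub>coinduced W\<^esub> \<phi> = \<phi>"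
      and psi: "\<psi> \<in> carrier (coinduced W)" "y = j \<psi>" "e \<odot>\<^bsub>coinduced W\<^esub> \<psi> = \<psi>" using eV by auto
    have eq_e: "\<phi> e = \<psi> e" using eq phi psi by (simp add: f_j)
    have "\<phi> = \<psi>"
    proof (rule extensionalityI[of _ eR])
      fix z assume z: "z \<in> eR"
      let ?r = "inv_into (carrier B) \<iota> (z \<otimes> e)"
      note r = \<iota>_inverse[OF z e_closed e_idem]
      have at_z: "\<chi> z = ?r \<odot>\<^bsub>W\<^esub> \<chi> e"
        if chi: "\<chi> \<in> carrier (coinduced W)" "e \<odot>\<^bsub>coinduced W\<^esub> \<chi> = \<chi>" for \<chi>
      proof -
        have "\<chi> z = \<chi> (\<iota> ?r)" using fun_cong[OF chi(2), of z] z r by (simp add: coinduced_simps)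
        also have "\<dots> = \<chi> (\<iota> ?r \<otimes> e)" using \<iota>_e[OF r(1)] by simp
        also have "\<dots> = ?r \<odot>\<^bsub>W\<^esub> \<chi> e" using r by (intro D(3)[OF chi(1)]) (auto simp: eR_closed)
        finally show ?thesis .
      qed
      show "\<phi> z = \<psi> z" using at_z[OF phi(1,3)] at_z[OF psi(1,3)] eq_e by simp
    qed (use D(4) phi psi in auto)
    then show "x = y" using phi psi by simp
  next
    fix w assume "w \<in> f ` carrier ?eV"
    then show "w \<in> carrier W" using hom by (auto simp: module_hom_def dest: PiE_mem)
  next
    fix w assume w: "w \<in> carrier W"
    let ?\<phi> = "tensor_map W e w"
    have phi: "?\<phi> \<in> carrier (coinduced W)" using w by (intro tensor_map_in_coinduced[OF W(1)]) auto
    have e_phi: "e \<odot>\<^bsub>coinduced W\<^esub> ?\<phi> = ?\<phi>"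
      unfolding coinduced_simps tensor_map_def by (rule restrict_ext) (simp add: eR_closed R.m_assoc)
    have "inv_into (carrier B) \<iota> e = \<one>\<^bsub>B\<^esub>"
      using inv_into_f_f[OF \<iota>_inj, of "\<one>\<^bsub>B\<^esub>"] by (simp add: \<iota>_one)
    then have "f (j ?\<phi>) = w" using f_j[OF phi e_phi] w by (simp add: tensor_map_def eR_closed W.lm_one)
    moreover have "j ?\<phi> \<in> carrier ?eV" using eV phi e_phi by auto
    ultimately show "w \<in> f ` carrier ?eV" by (intro image_eqI[of _ _ "j ?\<phi>"]) auto
  qed
  then have "is_iso (fdmod B) ?eV W f"
    using hom FV assms by (intro is_iso_of_bijective) (auto simp: fdmod_def)
  then show ?thesis using V by (intro bexI[of _ V]) (auto simp: fdmod_def)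
qed

theorem corner_equivalence:
  "equivalence_of_categories (fdmod R :: (('r, 'm) module, 'm \<Rightarrow> 'm) cat) (fdmod B) (corner_obj e \<iota>) corner_map"
proof (rule equivalence_of_fully_faithful_ess_surj[OF cat_functor_corner])
  fix V W :: "('r, 'm) module" and g
  assume "V \<in> Ob (fdmod R)" "W \<in> Ob (fdmod R)" "g \<in> Hom (fdmod B) (corner_obj e \<iota> V) (corner_obj e \<iota> W)"
  then show "\<exists>f\<in>Hom (fdmod R) V W. corner_map V W f = g"
    using full_on_homs[of V W g] by (simp add: fdmod_def)
next
  fix V W :: "('r, 'm) module" and f f'
  assume "V \<in> Ob (fdmod R)" "W \<in> Ob (fdmod R)" "f \<in> Hom (fdmod R) V W" "f' \<in> Hom (fdmod R) V W"
    "corner_map V W f = corner_map V W f'"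
  then show "f = f'" using faithful[of V W f f'] by (simp add: fdmod_def)
qed (rule essentially_surjective)

end

section \<open>Free modules and monoid algebras\<close>

lemma lookup_scale [simp]: "Poly_Mapping.lookup (scale c x) a = c * Poly_Mapping.lookup x a"
  by (auto simp: scale_def Poly_Mapping.map.rep_eq when_def)

lemma scale_simps [simp]:
  "scale 0 x = 0" "scale 1 x = x" "scale c 0 = 0" "scale c (Poly_Mapping.single a d) = Poly_Mapping.single a (c * d)"
  "scale c (scale d x) = scale (c * d) x"
  by (auto intro!: poly_mapping_eqI simp: lookup_single when_def mult.assoc)

lemma scale_add: "scale (c + d) x = scale c x + scale d x" "scale c (x + y) = scale c x + scale c y"
  by (auto intro!: poly_mapping_eqI simp: lookup_add algebra_simps)

lemma scale_diff: "scale (c - d) x = scale c x - scale d x" "scale c (x - y) = scale c x - scale c y"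
  by (auto intro!: poly_mapping_eqI simp: lookup_minus left_diff_distrib right_diff_distrib)

lemma scale_sum: "scale c (sum f A) = (\<Sum>a\<in>A. scale c (f a))"
  by (induction A rule: infinite_finite_induct) (auto simp: scale_add)

lemma keys_scale: "Poly_Mapping.keys (scale c x) \<subseteq> Poly_Mapping.keys x"
  by (auto simp: in_keys_iff)

lemma keys_sum_subset:
  assumes "\<And>a. a \<in> A \<Longrightarrow> Poly_Mapping.keys (f a) \<subseteq> C"
  shows "Poly_Mapping.keys (sum f A) \<subseteq> C"
  using assms
proof (induction A rule: infinite_finite_induct)
  case (insert a A)
  then show ?case using keys_add[of "f a" "sum f A"] by (simp add: subset_trans)
qed auto

lemma lin_ext_superset:
  assumes "finite A" "Poly_Mapping.keys x \<subseteq> A"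
  shows "lin_ext g x = (\<Sum>a\<in>A. scale (Poly_Mapping.lookup x a) (g a))"
  unfolding lin_ext_def using assms by (intro sum.mono_neutral_left) (auto simp: in_keys_iff)

lemma lin_ext_add: "lin_ext g (x + y) = lin_ext g x + lin_ext g y"
proof -
  let ?A = "Poly_Mapping.keys x \<union> Poly_Mapping.keys y"
  have "lin_ext g (x + y) = (\<Sum>a\<in>?A. scale (Poly_Mapping.lookup (x + y) a) (g a))"
    using keys_add[of x y] by (intro lin_ext_superset) auto
  then show ?thesis
    using lin_ext_superset[of ?A x g] lin_ext_superset[of ?A y g]
    by (simp add: lookup_add scale_add sum.distrib)
qed

lemma lin_ext_scale: "lin_ext g (scale c x) = scale c (lin_ext g x)"
proof -
  have "lin_ext g (scale c x) = (\<Sum>a\<in>Poly_Mapping.keys x. scale (Poly_Mapping.lookup (scale c x) a) (g a))"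
    using keys_scale[of c x] by (intro lin_ext_superset) auto
  then show ?thesis by (simp add: lin_ext_def scale_sum)
qed

lemma lin_ext_zero [simp]: "lin_ext g 0 = 0"
  by (simp add: lin_ext_def)

lemma lin_ext_diff: "lin_ext g (x - y) = lin_ext g x - lin_ext g y"
  using lin_ext_add[of g "x - y" y] by simp

lemma lin_ext_uminus: "lin_ext g (- x) = - lin_ext g x"
  using lin_ext_diff[of g 0 x] by simp

lemma lin_ext_single [simp]: "lin_ext g (Poly_Mapping.single a c) = scale c (g a)"
  by (simp add: lin_ext_def)

lemma lin_ext_sum: "lin_ext g (sum f A) = (\<Sum>a\<in>A. lin_ext g (f a))"
  by (induction A rule: infinite_finite_induct) (auto simp: lin_ext_add)

lemma lin_ext_cong:
  "(\<And>a. a \<in> Poly_Mapping.keys x \<Longrightarrow> g a = h a) \<Longrightarrow> lin_ext g x = lin_ext h x"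
  by (simp add: lin_ext_def)

lemma lin_ext_lin_ext: "lin_ext f (lin_ext g x) = lin_ext (\<lambda>a. lin_ext f (g a)) x"
  unfolding lin_ext_def[of g] lin_ext_def[of "\<lambda>a. lin_ext f (g a)"] by (simp add: lin_ext_sum lin_ext_scale)

lemma lin_ext_basis [simp]: "lin_ext basis x = x"
  by (rule poly_mapping_eqI) (simp add: lin_ext_def lookup_sum lookup_single when_def in_keys_iff)

lemma lin_ext_fun_add: "lin_ext (\<lambda>a. g a + h a) x = lin_ext g x + lin_ext h x"
  by (simp add: lin_ext_def scale_add sum.distrib)

lemma lin_ext_fun_sum: "lin_ext (\<lambda>i. \<Sum>a\<in>S. g a i) x = (\<Sum>a\<in>S. lin_ext (g a) x)"
proof (induction S rule: infinite_finite_induct)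
  case (insert a S)
  then show ?case by (simp add: lin_ext_fun_add)
qed (simp_all add: lin_ext_def)

lemma keys_lin_ext:
  assumes "\<And>a. a \<in> Poly_Mapping.keys x \<Longrightarrow> Poly_Mapping.keys (g a) \<subseteq> C"
  shows "Poly_Mapping.keys (lin_ext g x) \<subseteq> C"
  unfolding lin_ext_def by (intro keys_sum_subset subset_trans[OF keys_scale] assms)

lemma poly_mapping_span_induct [consumes 1, case_names zero single add]:
  fixes x :: "'a \<Rightarrow>\<^sub>0 'k::comm_monoid_add"
  assumes "Poly_Mapping.keys x \<subseteq> C" "P 0"
    and "\<And>a c. a \<in> C \<Longrightarrow> P (Poly_Mapping.single a c)"
    and "\<And>x y. P x \<Longrightarrow> P y \<Longrightarrow> P (x + y)"
  shows "P x"
proof -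
  have P_sum: "P (sum f A)" if "finite A" "\<And>a. a \<in> A \<Longrightarrow> P (f a)" for f and A :: "'a set"
    using that by (induction A) (auto intro: assms)
  have "P (\<Sum>a\<in>Poly_Mapping.keys x. Poly_Mapping.single a (Poly_Mapping.lookup x a))"
    by (rule P_sum) (use assms(1,3) in auto)
  also have "(\<Sum>a\<in>Poly_Mapping.keys x. Poly_Mapping.single a (Poly_Mapping.lookup x a)) = x"
    by (rule poly_mapping_eqI) (simp add: lookup_sum lookup_single when_def in_keys_iff)
  finally show ?thesis .
qed

text \<open>Over the integers, linear combinations are obtained from the basis by addition and negation alone, so that
  scalars do not have to be treated in inductions.\<close>

lemma int_poly_mapping_induct [consumes 1, case_names zero basis add uminus]:
  fixes x :: "'a \<Rightarrow>\<^sub>0 int"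
  assumes "Poly_Mapping.keys x \<subseteq> C" "P 0"
    and basis: "\<And>a. a \<in> C \<Longrightarrow> P (basis a)"
    and add: "\<And>x y. P x \<Longrightarrow> P y \<Longrightarrow> P (x + y)"
    and uminus: "\<And>x. P x \<Longrightarrow> P (- x)"
  shows "P x"
  using assms(1)
proof (induction rule: poly_mapping_span_induct)
  case (single a c)
  have nat: "P (Poly_Mapping.single a (int n))" for n
    by (induction n) (auto simp: assms(2) single_add intro!: add basis single)
  show ?case
  proof (cases c rule: int_cases2)
    case (nonpos n)
    then show ?thesis using uminus[OF nat[of n]] by (simp flip: single_uminus)
  qed (simp add: nat)
qed (use assms in auto)

lemma monoid_algebra_simps [simp]:
  "carrier (monoid_algebra M) = {x. Poly_Mapping.keys x \<subseteq> carrier M}"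
  "x \<oplus>\<^bsub>monoid_algebra M\<^esub> y = x + y" "\<zero>\<^bsub>monoid_algebra M\<^esub> = 0" "\<one>\<^bsub>monoid_algebra M\<^esub> = basis \<one>\<^bsub>M\<^esub>"
  "c \<odot>\<^bsub>monoid_algebra M\<^esub> x = scale c x"
  by (auto simp: monoid_algebra_def)

lemma monoid_algebra_mult:
  "x \<otimes>\<^bsub>monoid_algebra M\<^esub> y = lin_ext (\<lambda>a. lin_ext (\<lambda>b. basis (a \<otimes>\<^bsub>M\<^esub> b)) y) x"
  by (simp add: monoid_algebra_def)

lemma monoid_algebra_mult_simps:
  "(x + y) \<otimes>\<^bsub>monoid_algebra M\<^esub> z = x \<otimes>\<^bsub>monoid_algebra M\<^esub> z + y \<otimes>\<^bsub>monoid_algebra M\<^esub> z"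
  "x \<otimes>\<^bsub>monoid_algebra M\<^esub> (y + z) = x \<otimes>\<^bsub>monoid_algebra M\<^esub> y + x \<otimes>\<^bsub>monoid_algebra M\<^esub> z"
  "(x - y) \<otimes>\<^bsub>monoid_algebra M\<^esub> z = x \<otimes>\<^bsub>monoid_algebra M\<^esub> z - y \<otimes>\<^bsub>monoid_algebra M\<^esub> z"
  "x \<otimes>\<^bsub>monoid_algebra M\<^esub> (y - z) = x \<otimes>\<^bsub>monoid_algebra M\<^esub> y - x \<otimes>\<^bsub>monoid_algebra M\<^esub> z"
  "(- x) \<otimes>\<^bsub>monoid_algebra M\<^esub> z = - (x \<otimes>\<^bsub>monoid_algebra M\<^esub> z)"
  "x \<otimes>\<^bsub>monoid_algebra M\<^esub> (- z) = - (x \<otimes>\<^bsub>monoid_algebra M\<^esub> z)"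
  "0 \<otimes>\<^bsub>monoid_algebra M\<^esub> z = 0" "x \<otimes>\<^bsub>monoid_algebra M\<^esub> 0 = 0"
  "Poly_Mapping.single a c \<otimes>\<^bsub>monoid_algebra M\<^esub> Poly_Mapping.single b d = Poly_Mapping.single (a \<otimes>\<^bsub>M\<^esub> b) (c * d)"
proof -
  show add: "x \<otimes>\<^bsub>monoid_algebra M\<^esub> (y + z) = x \<otimes>\<^bsub>monoid_algebra M\<^esub> y + x \<otimes>\<^bsub>monoid_algebra M\<^esub> z" for x y z
    by (simp add: monoid_algebra_mult lin_ext_add lin_ext_fun_add)
  show diff: "x \<otimes>\<^bsub>monoid_algebra M\<^esub> (y - z) = x \<otimes>\<^bsub>monoid_algebra M\<^esub> y - x \<otimes>\<^bsub>monoid_algebra M\<^esub> z" for x y z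
    using add[of x "y - z" z] by simp
  show "x \<otimes>\<^bsub>monoid_algebra M\<^esub> 0 = 0" using add[of x 0 0] by simp
  then show "x \<otimes>\<^bsub>monoid_algebra M\<^esub> (- z) = - (x \<otimes>\<^bsub>monoid_algebra M\<^esub> z)" using diff[of x 0 z] by simp
qed (simp_all add: monoid_algebra_mult lin_ext_add lin_ext_diff lin_ext_uminus lin_ext_scale)

lemma ring_monoid_algebra:
  assumes "monoid M" shows "ring (monoid_algebra M :: ('k::comm_ring_1, 'a \<Rightarrow>\<^sub>0 'k) module)"
proof -
  interpret M: monoid M by fact
  let ?A = "monoid_algebra M :: ('k, 'a \<Rightarrow>\<^sub>0 'k) module"
  have "abelian_group ?A"
  proof (rule abelian_groupI)
    fix x assume "x \<in> carrier ?A"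
    then show "\<exists>y\<in>carrier ?A. y \<oplus>\<^bsub>?A\<^esub> x = \<zero>\<^bsub>?A\<^esub>"
      by (intro bexI[of _ "- x"]) (auto simp: in_keys_iff subset_iff)
  qed (auto dest!: subsetD[OF keys_add] simp: add_ac)
  moreover have "monoid ?A"
  proof (rule monoidI)
    fix x y z :: "'a \<Rightarrow>\<^sub>0 'k"
    assume x: "x \<in> carrier ?A" and y: "y \<in> carrier ?A" and z: "z \<in> carrier ?A"
    show "x \<otimes>\<^bsub>?A\<^esub> y \<in> carrier ?A"
      unfolding monoid_algebra_mult monoid_algebra_simps mem_Collect_eq
      by (intro keys_lin_ext) (use x y in auto)
    show "x \<otimes>\<^bsub>?A\<^esub> y \<otimes>\<^bsub>?A\<^esub> z = x \<otimes>\<^bsub>?A\<^esub> (y \<otimes>\<^bsub>?A\<^esub> z)"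
      unfolding monoid_algebra_mult lin_ext_lin_ext lin_ext_single scale_simps
      using x y z by (intro lin_ext_cong) (auto intro!: M.m_assoc arg_cong[where f = basis])
  next
    fix x :: "'a \<Rightarrow>\<^sub>0 'k" assume x: "x \<in> carrier ?A"
    have "\<one>\<^bsub>?A\<^esub> \<otimes>\<^bsub>?A\<^esub> x = lin_ext basis x"
      unfolding monoid_algebra_mult monoid_algebra_simps lin_ext_single scale_simps
      using x by (intro lin_ext_cong) auto
    then show "\<one>\<^bsub>?A\<^esub> \<otimes>\<^bsub>?A\<^esub> x = x" by simp
    have "x \<otimes>\<^bsub>?A\<^esub> \<one>\<^bsub>?A\<^esub> = lin_ext basis x"
      unfolding monoid_algebra_mult monoid_algebra_simps lin_ext_single scale_simps
      using x by (intro lin_ext_cong) auto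
    then show "x \<otimes>\<^bsub>?A\<^esub> \<one>\<^bsub>?A\<^esub> = x" by simp
  qed simp
  ultimately show ?thesis
    by (rule ringI) (auto simp: monoid_algebra_mult_simps)
qed

section \<open>Base change\<close>

text \<open>Of the axioms of an algebra these are the ones on which the ring structure of the base change
  rests: the kernel of the tensor product is an ideal because scalars can be moved out of products.\<close>

locale algebra_over = ring A for A :: "('z, 'a) module" (structure) +
  assumes smult_closed [simp]: "a \<in> carrier A \<Longrightarrow> z \<odot> a \<in> carrier A"
    and smult_mult_left: "\<lbrakk>a \<in> carrier A; b \<in> carrier A\<rbrakk> \<Longrightarrow> (z \<odot> a) \<otimes> b = z \<odot> (a \<otimes> b)"
    and smult_mult_right: "\<lbrakk>a \<in> carrier A; b \<in> carrier A\<rbrakk> \<Longrightarrow> a \<otimes> (z \<odot> b) = z \<odot> (a \<otimes> b)"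

lemma pairs_ring_carrier:
  "carrier (pairs_ring A) = {x. Poly_Mapping.keys x \<subseteq> carrier A \<times> UNIV}"
  by (simp add: pairs_ring_def complex_ring_def)

lemma pairs_ring_simps:
  "x \<oplus>\<^bsub>pairs_ring A\<^esub> y = x + y" "\<zero>\<^bsub>pairs_ring A\<^esub> = 0" "\<one>\<^bsub>pairs_ring A\<^esub> = basis (\<one>\<^bsub>A\<^esub>, 1)"
  by (simp_all add: pairs_ring_def complex_ring_def)

lemma pairs_ring_basis_mult:
  "basis (a, c) \<otimes>\<^bsub>pairs_ring A\<^esub> basis (b, d) = basis (a \<otimes>\<^bsub>A\<^esub> b, c * d)"
  by (simp add: pairs_ring_def complex_ring_def monoid_algebra_mult_simps)

lemma basis_in_pairs_ring: "basis (a, c) \<in> carrier (pairs_ring A) \<longleftrightarrow> a \<in> carrier A"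
  by (simp add: pairs_ring_carrier)

lemma pairs_ring_carrier_closed:
  "0 \<in> carrier (pairs_ring A)"
  "x \<in> carrier (pairs_ring A) \<Longrightarrow> y \<in> carrier (pairs_ring A) \<Longrightarrow> x + y \<in> carrier (pairs_ring A)"
  "x \<in> carrier (pairs_ring A) \<Longrightarrow> y \<in> carrier (pairs_ring A) \<Longrightarrow> x - y \<in> carrier (pairs_ring A)"
  "x \<in> carrier (pairs_ring A) \<Longrightarrow> - x \<in> carrier (pairs_ring A)"
  using keys_add[of x y] Poly_Mapping.keys_diff[of x y] keys_add[of 0 "- x"]
  by (auto simp: pairs_ring_carrier)

lemma pairs_ring_mult_simps:
  "(x + y) \<otimes>\<^bsub>pairs_ring A\<^esub> z = x \<otimes>\<^bsub>pairs_ring A\<^esub> z + y \<otimes>\<^bsub>pairs_ring A\<^esub> z"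
  "x \<otimes>\<^bsub>pairs_ring A\<^esub> (y + z) = x \<otimes>\<^bsub>pairs_ring A\<^esub> y + x \<otimes>\<^bsub>pairs_ring A\<^esub> z"
  "(x - y) \<otimes>\<^bsub>pairs_ring A\<^esub> z = x \<otimes>\<^bsub>pairs_ring A\<^esub> z - y \<otimes>\<^bsub>pairs_ring A\<^esub> z"
  "x \<otimes>\<^bsub>pairs_ring A\<^esub> (y - z) = x \<otimes>\<^bsub>pairs_ring A\<^esub> y - x \<otimes>\<^bsub>pairs_ring A\<^esub> z"
  "(- x) \<otimes>\<^bsub>pairs_ring A\<^esub> z = - (x \<otimes>\<^bsub>pairs_ring A\<^esub> z)"
  "x \<otimes>\<^bsub>pairs_ring A\<^esub> (- z) = - (x \<otimes>\<^bsub>pairs_ring A\<^esub> z)"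
  "0 \<otimes>\<^bsub>pairs_ring A\<^esub> z = 0" "x \<otimes>\<^bsub>pairs_ring A\<^esub> 0 = 0"
  unfolding pairs_ring_def by (rule monoid_algebra_mult_simps)+

context algebra_over
begin

lemma ring_pairs_ring: "ring (pairs_ring A)"
  unfolding pairs_ring_def
proof (rule ring_monoid_algebra, rule DirProd_monoid)
  show "monoid complex_ring" by (rule monoidI) (auto simp: complex_ring_def)
qed (rule monoid_axioms)

lemma a_inv_pairs_ring: "x \<in> carrier (pairs_ring A) \<Longrightarrow> inv\<^bsub>add_monoid (pairs_ring A)\<^esub> x = - x"
proof -
  assume x: "x \<in> carrier (pairs_ring A)"
  interpret P: ring "pairs_ring A" by (rule ring_pairs_ring)
  have "\<ominus>\<^bsub>pairs_ring A\<^esub> x = - x"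
    by (rule P.minus_equality) (use x in \<open>auto simp: pairs_ring_simps pairs_ring_carrier_closed\<close>)
  then show ?thesis by (simp add: a_inv_def)
qed

lemma tensor_relations_cases [consumes 1, case_names add_left add_right scalar]:
  assumes "t \<in> tensor_relations \<phi> A"
  obtains p q d where "t = basis (p \<oplus> q, d) - basis (p, d) - basis (q, d)" "p \<in> carrier A" "q \<in> carrier A"
    | p d d' where "t = basis (p, d + d') - basis (p, d) - basis (p, d')" "p \<in> carrier A"
    | z p d where "t = basis (z \<odot> p, d) - basis (p, \<phi> z * d)" "p \<in> carrier A"
  using assms unfolding tensor_relations_def by auto

lemma in_tensor_relations:
  "p \<in> carrier A \<Longrightarrow> q \<in> carrier A \<Longrightarrow> basis (p \<oplus> q, d) - basis (p, d) - basis (q, d) \<in> tensor_relations \<phi> A"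
  "p \<in> carrier A \<Longrightarrow> basis (p, d + d') - basis (p, d) - basis (p, d') \<in> tensor_relations \<phi> A"
  "p \<in> carrier A \<Longrightarrow> basis (z \<odot> p, d) - basis (p, \<phi> z * d) \<in> tensor_relations \<phi> A"
  unfolding tensor_relations_def by blast+

lemma tensor_relations_subset: "tensor_relations \<phi> A \<subseteq> carrier (pairs_ring A)"
  by (auto simp: tensor_relations_def basis_in_pairs_ring intro!: pairs_ring_carrier_closed)

lemma tensor_kernel_closed:
  "0 \<in> tensor_kernel \<phi> A"
  "x \<in> tensor_relations \<phi> A \<Longrightarrow> x \<in> tensor_kernel \<phi> A"
  "x \<in> tensor_kernel \<phi> A \<Longrightarrow> y \<in> tensor_kernel \<phi> A \<Longrightarrow> x + y \<in> tensor_kernel \<phi> A"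
  "x \<in> tensor_kernel \<phi> A \<Longrightarrow> - x \<in> tensor_kernel \<phi> A"
  "tensor_kernel \<phi> A \<subseteq> carrier (pairs_ring A)"
proof -
  interpret P: ring "pairs_ring A" by (rule ring_pairs_ring)
  have sub: "subgroup (tensor_kernel \<phi> A) (add_monoid (pairs_ring A))"
    unfolding tensor_kernel_def
    by (rule group.generate_is_subgroup[OF P.a_group]) (use tensor_relations_subset in simp)
  show carrier: "tensor_kernel \<phi> A \<subseteq> carrier (pairs_ring A)" using subgroup.subset[OF sub] by simp
  show "0 \<in> tensor_kernel \<phi> A" using subgroup.one_closed[OF sub] by (simp add: pairs_ring_simps)
  show "x \<in> tensor_relations \<phi> A \<Longrightarrow> x \<in> tensor_kernel \<phi> A"
    unfolding tensor_kernel_def by (rule generate.incl)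
  show "x \<in> tensor_kernel \<phi> A \<Longrightarrow> y \<in> tensor_kernel \<phi> A \<Longrightarrow> x + y \<in> tensor_kernel \<phi> A"
    using subgroup.m_closed[OF sub] by (simp add: pairs_ring_simps)
  show "x \<in> tensor_kernel \<phi> A \<Longrightarrow> - x \<in> tensor_kernel \<phi> A"
    using subgroup.m_inv_closed[OF sub, of x] a_inv_pairs_ring[of x] carrier by auto
qed

lemma additive_into_kernel:
  fixes F :: "('a \<times> complex \<Rightarrow>\<^sub>0 int) \<Rightarrow> ('c \<Rightarrow>\<^sub>0 int)"
  assumes "x \<in> tensor_kernel \<phi> A" "0 \<in> U" "\<And>x y. x \<in> U \<Longrightarrow> y \<in> U \<Longrightarrow> x + y \<in> U" "\<And>x. x \<in> U \<Longrightarrow> - x \<in> U"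
    and F: "\<And>x y. F (x + y) = F x + F y" "\<And>x. x \<in> tensor_relations \<phi> A \<Longrightarrow> F x \<in> U"
  shows "F x \<in> U"
proof -
  have F0: "F 0 = 0" using F(1)[of 0 0] by simp
  have Fm: "F (- x) = - F x" for x using F(1)[of x "- x"] by (simp add: F0 eq_neg_iff_add_eq_0 add.commute)
  show ?thesis
    using assms(1) unfolding tensor_kernel_def
  proof (induction rule: generate.induct)
    case (inv h)
    have "h \<in> carrier (pairs_ring A)" using inv tensor_relations_subset by (rule subsetD[rotated])
    then show ?case using F(2)[OF inv] by (simp add: a_inv_pairs_ring Fm assms(4))
  qed (auto simp: F0 F assms pairs_ring_simps)
qed

text \<open>The product of a relation with a basis element is again a relation of the same kind.\<close>

lemma mult_in_tensor_kernel:
  assumes x: "x \<in> carrier (pairs_ring A)" and k: "k \<in> tensor_kernel \<phi> A"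
  shows "x \<otimes>\<^bsub>pairs_ring A\<^esub> k \<in> tensor_kernel \<phi> A" "k \<otimes>\<^bsub>pairs_ring A\<^esub> x \<in> tensor_kernel \<phi> A"
proof -
  note closed = tensor_kernel_closed[where \<phi> = \<phi>]
  have rel: "basis (a, c) \<otimes>\<^bsub>pairs_ring A\<^esub> t \<in> tensor_relations \<phi> A \<and> t \<otimes>\<^bsub>pairs_ring A\<^esub> basis (a, c) \<in> tensor_relations \<phi> A"
    if t: "t \<in> tensor_relations \<phi> A" and a: "a \<in> carrier A" for t a c
  proof -
    from t show ?thesis
    proof (cases rule: tensor_relations_cases)
      case (add_left p q d)
      then show ?thesis
        using a in_tensor_relations(1)[of "a \<otimes> p" "a \<otimes> q" "c * d" \<phi>]
          in_tensor_relations(1)[of "p \<otimes> a" "q \<otimes> a" "d * c" \<phi>]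
        by (simp add: pairs_ring_mult_simps pairs_ring_basis_mult l_distr r_distr)
    next
      case (add_right p d d')
      then show ?thesis
        using a in_tensor_relations(2)[of "a \<otimes> p" "c * d" "c * d'" \<phi>]
          in_tensor_relations(2)[of "p \<otimes> a" "d * c" "d' * c" \<phi>]
        by (simp add: pairs_ring_mult_simps pairs_ring_basis_mult distrib_left distrib_right)
    next
      case (scalar z p d)
      then show ?thesis
        using a in_tensor_relations(3)[of "a \<otimes> p" z "c * d" \<phi>] in_tensor_relations(3)[of "p \<otimes> a" z "d * c" \<phi>]
        by (simp add: pairs_ring_mult_simps pairs_ring_basis_mult smult_mult_left smult_mult_right mult_ac)
    qed
  qed
  have basis_case: "basis (a, c) \<otimes>\<^bsub>pairs_ring A\<^esub> k \<in> tensor_kernel \<phi> A \<and> k \<otimes>\<^bsub>pairs_ring A\<^esub> basis (a, c) \<in> tensor_kernel \<phi> A"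
    if "a \<in> carrier A" for a c
    using that rel closed
    by (intro conjI additive_into_kernel[OF k, where F = "\<lambda>k. basis (a, c) \<otimes>\<^bsub>pairs_ring A\<^esub> k"]
        additive_into_kernel[OF k, where F = "\<lambda>k. k \<otimes>\<^bsub>pairs_ring A\<^esub> basis (a, c)"])
       (auto simp: pairs_ring_mult_simps)
  have "x \<otimes>\<^bsub>pairs_ring A\<^esub> k \<in> tensor_kernel \<phi> A \<and> k \<otimes>\<^bsub>pairs_ring A\<^esub> x \<in> tensor_kernel \<phi> A"
    using x unfolding pairs_ring_carrier mem_Collect_eq
    by (induction rule: int_poly_mapping_induct)
       (auto simp: pairs_ring_mult_simps closed basis_case)
  then show "x \<otimes>\<^bsub>pairs_ring A\<^esub> k \<in> tensor_kernel \<phi> A" "k \<otimes>\<^bsub>pairs_ring A\<^esub> x \<in> tensor_kernel \<phi> A"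
    by auto
qed

lemma ideal_tensor_kernel: "ideal (tensor_kernel \<phi> A) (pairs_ring A)"
proof -
  interpret P: ring "pairs_ring A" by (rule ring_pairs_ring)
  show ?thesis
  proof (rule idealI[OF P.ring_axioms])
    show "subgroup (tensor_kernel \<phi> A) (add_monoid (pairs_ring A))"
      unfolding tensor_kernel_def
      by (rule group.generate_is_subgroup[OF P.a_group]) (use tensor_relations_subset in simp)
  qed (rule mult_in_tensor_kernel; assumption)+
qed

abbreviation "tensor_class \<phi> x \<equiv> tensor_kernel \<phi> A +>\<^bsub>pairs_ring A\<^esub> x"

lemma base_change_fields:
  "carrier (base_change \<phi> A) = carrier (pairs_ring A Quot tensor_kernel \<phi> A)"
  "mult (base_change \<phi> A) = mult (pairs_ring A Quot tensor_kernel \<phi> A)"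
  "one (base_change \<phi> A) = one (pairs_ring A Quot tensor_kernel \<phi> A)"
  "add (base_change \<phi> A) = add (pairs_ring A Quot tensor_kernel \<phi> A)"
  "zero (base_change \<phi> A) = zero (pairs_ring A Quot tensor_kernel \<phi> A)"
  by (simp_all add: base_change_def ring.defs module.defs)

lemma ring_base_change: "ring (base_change \<phi> A)"
proof -
  interpret Q: ring "pairs_ring A Quot tensor_kernel \<phi> A"
    by (rule ideal.quotient_is_ring[OF ideal_tensor_kernel])
  show ?thesis
  proof (rule ringI)
    show "abelian_group (base_change \<phi> A)"
      by (rule abelian_groupI)
         (auto simp: base_change_fields Q.a_ac intro: bexI[of _ "\<ominus>\<^bsub>pairs_ring A Quot tensor_kernel \<phi> A\<^esub> _"] Q.l_neg)
    show "monoid (base_change \<phi> A)"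
      by (rule monoidI) (auto simp: base_change_fields Q.m_assoc)
  qed (auto simp: base_change_fields Q.l_distr Q.r_distr)
qed

lemma tensor_class_closed: "x \<in> carrier (pairs_ring A) \<Longrightarrow> tensor_class \<phi> x \<in> carrier (base_change \<phi> A)"
  by (auto simp: base_change_fields FactRing_def A_RCOSETS_def')

lemma tensor_class_hom:
  assumes "x \<in> carrier (pairs_ring A)" "y \<in> carrier (pairs_ring A)"
  shows "tensor_class \<phi> x \<oplus>\<^bsub>base_change \<phi> A\<^esub> tensor_class \<phi> y = tensor_class \<phi> (x + y)"
    "tensor_class \<phi> x \<otimes>\<^bsub>base_change \<phi> A\<^esub> tensor_class \<phi> y = tensor_class \<phi> (x \<otimes>\<^bsub>pairs_ring A\<^esub> y)"
proof -
  interpret I: ideal "tensor_kernel \<phi> A" "pairs_ring A" by (rule ideal_tensor_kernel)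
  show "tensor_class \<phi> x \<oplus>\<^bsub>base_change \<phi> A\<^esub> tensor_class \<phi> y = tensor_class \<phi> (x + y)"
    "tensor_class \<phi> x \<otimes>\<^bsub>base_change \<phi> A\<^esub> tensor_class \<phi> y = tensor_class \<phi> (x \<otimes>\<^bsub>pairs_ring A\<^esub> y)"
    using ring_hom_add[OF I.rcos_ring_hom assms]
      ring_hom_mult[OF I.rcos_ring_hom assms]
    by (simp_all add: base_change_fields pairs_ring_simps)
qed

lemma tensor_class_zero: "\<zero>\<^bsub>base_change \<phi> A\<^esub> = tensor_kernel \<phi> A"
  by (simp add: base_change_fields FactRing_def)

lemma tensor_class_eqI:
  assumes "x \<in> carrier (pairs_ring A)" "y \<in> carrier (pairs_ring A)" "x - y \<in> tensor_kernel \<phi> A"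
  shows "tensor_class \<phi> x = tensor_class \<phi> y"
proof -
  interpret I: ideal "tensor_kernel \<phi> A" "pairs_ring A" by (rule ideal_tensor_kernel)
  have "x \<in> tensor_class \<phi> y" unfolding a_r_coset_def'
    using assms(3) by (auto simp: pairs_ring_simps intro!: bexI[of _ "x - y"])
  then show ?thesis using I.a_repr_independence[OF _ assms(2) I.a_subgroup] by simp
qed

lemma tensor_class_self: "x \<in> carrier (pairs_ring A) \<Longrightarrow> x \<in> tensor_class \<phi> x"
  unfolding a_r_coset_def' using tensor_kernel_closed(1)
  by (auto simp: pairs_ring_simps intro!: bexI[of _ 0])

lemma tensor_class_member:
  assumes "x \<in> carrier (pairs_ring A)" "y \<in> tensor_class \<phi> x"
  obtains k where "k \<in> tensor_kernel \<phi> A" "y = k + x"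
  using assms(2) unfolding a_r_coset_def' by (auto simp: pairs_ring_simps)

lemma pure_tensor_class: "pure_tensor \<phi> A a c = tensor_class \<phi> (basis (a, c))"
  by (simp add: pure_tensor_def)

lemma pure_tensor_closed [simp]: "a \<in> carrier A \<Longrightarrow> pure_tensor \<phi> A a c \<in> carrier (base_change \<phi> A)"
  unfolding pure_tensor_class by (intro tensor_class_closed) (simp add: basis_in_pairs_ring)

lemma pure_tensor_mult:
  "\<lbrakk>a \<in> carrier A; b \<in> carrier A\<rbrakk> \<Longrightarrow>
    pure_tensor \<phi> A a c \<otimes>\<^bsub>base_change \<phi> A\<^esub> pure_tensor \<phi> A b d = pure_tensor \<phi> A (a \<otimes> b) (c * d)"
  unfolding pure_tensor_class by (simp add: tensor_class_hom basis_in_pairs_ring pairs_ring_basis_mult)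

lemma pure_tensor_one: "\<one>\<^bsub>base_change \<phi> A\<^esub> = pure_tensor \<phi> A \<one> 1"
  by (simp add: base_change_fields FactRing_def pairs_ring_simps pure_tensor_class)

lemma pure_tensor_add_left:
  assumes "a \<in> carrier A" "b \<in> carrier A"
  shows "pure_tensor \<phi> A (a \<oplus> b) c = pure_tensor \<phi> A a c \<oplus>\<^bsub>base_change \<phi> A\<^esub> pure_tensor \<phi> A b c"
proof -
  have "basis (a \<oplus> b, c) - basis (a, c) - basis (b, c) \<in> tensor_relations \<phi> A"
    using assms by (intro in_tensor_relations)
  then have "tensor_class \<phi> (basis (a \<oplus> b, c)) = tensor_class \<phi> (basis (a, c) + basis (b, c))"
    using assms by (intro tensor_class_eqI)
      (simp_all add: basis_in_pairs_ring pairs_ring_carrier_closed diff_diff_eq tensor_kernel_closed(2))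
  then show ?thesis
    unfolding pure_tensor_class using assms by (simp add: tensor_class_hom basis_in_pairs_ring)
qed

lemma pure_tensor_add_right:
  assumes "a \<in> carrier A"
  shows "pure_tensor \<phi> A a (c + d) = pure_tensor \<phi> A a c \<oplus>\<^bsub>base_change \<phi> A\<^esub> pure_tensor \<phi> A a d"
proof -
  have "basis (a, c + d) - basis (a, c) - basis (a, d) \<in> tensor_relations \<phi> A"
    using assms by (intro in_tensor_relations)
  then have "tensor_class \<phi> (basis (a, c + d)) = tensor_class \<phi> (basis (a, c) + basis (a, d))"
    using assms by (intro tensor_class_eqI)
      (simp_all add: basis_in_pairs_ring pairs_ring_carrier_closed diff_diff_eq tensor_kernel_closed(2))
  then show ?thesis
    unfolding pure_tensor_class using assms by (simp add: tensor_class_hom basis_in_pairs_ring)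
qed

lemma pure_tensor_uminus:
  assumes "a \<in> carrier A"
  shows "tensor_class \<phi> (- basis (a, c)) = pure_tensor \<phi> A a (- c)"
proof -
  have r: "basis (a, c + - c) - basis (a, c) - basis (a, - c) \<in> tensor_relations \<phi> A"
    "basis (a, 0 + 0) - basis (a, 0) - basis (a, 0) \<in> tensor_relations \<phi> A"
    by (rule in_tensor_relations(2)[OF assms])+
  \<comment> \<open>the second relation is the negative of \<open>(a, 0)\<close>\<close>
  have "(basis (a, c + - c) - basis (a, c) - basis (a, - c)) + (basis (a, 0 + 0) - basis (a, 0) - basis (a, 0)) \<in> tensor_kernel \<phi> A"
    by (intro tensor_kernel_closed(2,3) r)
  then show ?thesis
    unfolding pure_tensor_class using assms
    by (intro tensor_class_eqI) (auto simp: basis_in_pairs_ring pairs_ring_carrier_closed algebra_simps)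
qed

text \<open>Every element is a sum of pure tensors. Negatives need no separate step since
  \<open>- (a \<otimes> c) = a \<otimes> (- c)\<close>.\<close>

lemma base_change_induct [consumes 1, case_names zero pure_tensor add]:
  assumes "x \<in> carrier (base_change \<phi> A)"
    and zero: "P \<zero>\<^bsub>base_change \<phi> A\<^esub>"
    and pure: "\<And>a c. a \<in> carrier A \<Longrightarrow> P (pure_tensor \<phi> A a c)"
    and add: "\<And>x y. \<lbrakk>x \<in> carrier (base_change \<phi> A); y \<in> carrier (base_change \<phi> A); P x; P y\<rbrakk>
        \<Longrightarrow> P (x \<oplus>\<^bsub>base_change \<phi> A\<^esub> y)"
  shows "P x"
proof -
  interpret I: ideal "tensor_kernel \<phi> A" "pairs_ring A" by (rule ideal_tensor_kernel)
  obtain u where u: "u \<in> carrier (pairs_ring A)" "x = tensor_class \<phi> u"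
    using assms(1) by (auto simp: base_change_fields FactRing_def A_RCOSETS_def')
  have class0: "tensor_class \<phi> 0 = \<zero>\<^bsub>base_change \<phi> A\<^esub>"
    unfolding tensor_class_zero using I.a_rcos_const[of 0] tensor_kernel_closed(1) by simp
  have "u \<in> carrier (pairs_ring A) \<and> P (tensor_class \<phi> u) \<and> P (tensor_class \<phi> (- u))"
    using u(1)[unfolded pairs_ring_carrier mem_Collect_eq]
  proof (induction rule: int_poly_mapping_induct)
    case zero
    then show ?case using assms(2) by (simp add: class0 pairs_ring_carrier_closed)
  next
    case (basis p)
    then obtain a c where p: "p = (a, c)" "a \<in> carrier A" by auto
    then show ?case using pure[of a c] pure[of a "- c"] pure_tensor_uminus[of a \<phi> c] by (simp add: pure_tensor_class basis_in_pairs_ring)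
  next
    case (add x y)
    have mem: "x \<in> carrier (pairs_ring A)" "y \<in> carrier (pairs_ring A)" using add by auto
    have "P (tensor_class \<phi> x \<oplus>\<^bsub>base_change \<phi> A\<^esub> tensor_class \<phi> y)" "P (tensor_class \<phi> (- x) \<oplus>\<^bsub>base_change \<phi> A\<^esub> tensor_class \<phi> (- y))"
      using add mem by (auto intro!: assms(4) tensor_class_closed pairs_ring_carrier_closed)
    moreover have "tensor_class \<phi> (- x) \<oplus>\<^bsub>base_change \<phi> A\<^esub> tensor_class \<phi> (- y) = tensor_class \<phi> (- (x + y))"
      using mem by (subst tensor_class_hom) (auto simp: pairs_ring_carrier_closed)
    moreover have "x + y \<in> carrier (pairs_ring A)" using mem by (rule pairs_ring_carrier_closed)
    ultimately show ?case using mem by (simp add: tensor_class_hom)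
  next
    case (uminus x)
    then show ?case by (simp add: pairs_ring_carrier_closed)
  qed
  with u show ?thesis by simp
qed

end

text \<open>Maps out of the tensor product are defined as a union over all representatives of a class. For an additive \<open>F\<close>
  compatible with the relations all members of this union agree.\<close>

lemma coset_union_eq:
  fixes F :: "('a \<times> complex \<Rightarrow>\<^sub>0 int) \<Rightarrow> ('b \<times> complex \<Rightarrow>\<^sub>0 int)"
  assumes A: "algebra_over A" and B: "algebra_over B"
    and F: "\<And>x y. F (x + y) = F x + F y" "\<And>x. x \<in> carrier (pairs_ring A) \<Longrightarrow> F x \<in> carrier (pairs_ring B)"
      "\<And>x. x \<in> tensor_relations \<phi> A \<Longrightarrow> F x \<in> tensor_kernel \<phi> B"
    and x: "x \<in> carrier (pairs_ring A)"
  shows "(\<Union>y \<in> tensor_kernel \<phi> A +>\<^bsub>pairs_ring A\<^esub> x. tensor_kernel \<phi> B +>\<^bsub>pairs_ring B\<^esub> F y)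
    = tensor_kernel \<phi> B +>\<^bsub>pairs_ring B\<^esub> F x"
proof -
  interpret A: algebra_over A by fact
  interpret B: algebra_over B by fact
  have kernel: "F k \<in> tensor_kernel \<phi> B" if "k \<in> tensor_kernel \<phi> A" for k
    by (rule A.additive_into_kernel[OF that]) (use F(1,3) B.tensor_kernel_closed in auto)
  have same: "B.tensor_class \<phi> (F y) = B.tensor_class \<phi> (F x)" if "y \<in> A.tensor_class \<phi> x" for y
    using x that
  proof (rule A.tensor_class_member)
    fix k assume k: "k \<in> tensor_kernel \<phi> A" "y = k + x"
    then have "y \<in> carrier (pairs_ring A)" using A.tensor_kernel_closed(5) x pairs_ring_carrier_closed(2) by blast
    then have "F y \<in> carrier (pairs_ring B)" by (rule F(2))
    moreover have "F y - F x \<in> tensor_kernel \<phi> B" using k kernel by (simp add: F(1))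
    ultimately show ?thesis using F(2)[OF x] by (intro B.tensor_class_eqI)
  qed
  have "(\<Union>y \<in> A.tensor_class \<phi> x. B.tensor_class \<phi> (F y)) = (\<Union>y \<in> A.tensor_class \<phi> x. B.tensor_class \<phi> (F x))"
    by (intro SUP_cong refl same)
  moreover have "A.tensor_class \<phi> x \<noteq> {}" using A.tensor_class_self[OF x, of \<phi>] by blast
  ultimately show ?thesis by (simp only: UN_constant if_False)
qed

context algebra_over
begin

lemma smult_base_change:
  assumes "x \<in> carrier (pairs_ring A)"
  shows "c \<odot>\<^bsub>base_change \<phi> A\<^esub> tensor_class \<phi> x = tensor_class \<phi> (lin_ext (\<lambda>(a, d). basis (a, c * d)) x)"
proof -
  let ?L = "lin_ext (\<lambda>(a, d). basis (a, c * d)) :: ('a \<times> complex \<Rightarrow>\<^sub>0 int) \<Rightarrow> _"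
  have "c \<odot>\<^bsub>base_change \<phi> A\<^esub> tensor_class \<phi> x = (\<Union>y \<in> tensor_class \<phi> x. tensor_class \<phi> (?L y))"
    by (simp add: base_change_def ring.defs module.defs)
  also have "\<dots> = tensor_class \<phi> (?L x)"
  proof (rule coset_union_eq[OF _ _ _ _ _ assms])
    show "?L y \<in> carrier (pairs_ring A)" if "y \<in> carrier (pairs_ring A)" for y
      using that unfolding pairs_ring_carrier mem_Collect_eq by (intro keys_lin_ext) auto
    fix t assume "t \<in> tensor_relations \<phi> A"
    then have "?L t \<in> tensor_relations \<phi> A"
    proof (cases rule: tensor_relations_cases)
      case (add_left p q d)
      then show ?thesis using in_tensor_relations(1)[of p q "c * d" \<phi>] by (simp add: lin_ext_diff)
    next
      case (add_right p d d')
      then show ?thesis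
        using in_tensor_relations(2)[of p "c * d" "c * d'" \<phi>] by (simp add: lin_ext_diff distrib_left)
    next
      case (scalar z p d)
      then show ?thesis using in_tensor_relations(3)[of p z "c * d" \<phi>] by (simp add: lin_ext_diff mult_ac)
    qed
    then show "?L t \<in> tensor_kernel \<phi> A" by (rule tensor_kernel_closed(2))
  qed (auto simp: lin_ext_add algebra_over_axioms)
  finally show ?thesis .
qed

lemma scalar_base_change: "scalar (base_change \<phi> A) c = pure_tensor \<phi> A \<one> c"
  by (simp add: pure_tensor_one) (simp add: pure_tensor_class smult_base_change basis_in_pairs_ring)

lemma complex_algebra_base_change: "complex_algebra (base_change \<phi> A)"
proof -
  interpret R: ring "base_change \<phi> A" by (rule ring_base_change)
  show ?thesis
  proof (unfold_locales, unfold scalar_base_change)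
    fix x c assume "x \<in> carrier (base_change \<phi> A)"
    then show "pure_tensor \<phi> A \<one> c \<otimes>\<^bsub>base_change \<phi> A\<^esub> x = x \<otimes>\<^bsub>base_change \<phi> A\<^esub> pure_tensor \<phi> A \<one> c"
    proof (induction rule: base_change_induct)
      case (pure_tensor a d)
      then show ?case by (simp add: pure_tensor_mult mult.commute)
    next
      case (add x y)
      then show ?case by (simp add: R.l_distr R.r_distr)
    qed simp
  qed (simp_all add: pure_tensor_one pure_tensor_mult flip: pure_tensor_add_right)
qed

end

locale algebra_over_map = B: algebra_over B + A: algebra_over A
  for B :: "('z, 'b) module" and A :: "('z, 'a) module" +
  fixes h :: "'b \<Rightarrow> 'a"
  assumes h_closed: "x \<in> carrier B \<Longrightarrow> h x \<in> carrier A"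
    and h_add: "\<lbrakk>x \<in> carrier B; y \<in> carrier B\<rbrakk> \<Longrightarrow> h (x \<oplus>\<^bsub>B\<^esub> y) = h x \<oplus>\<^bsub>A\<^esub> h y"
    and h_smult: "x \<in> carrier B \<Longrightarrow> h (z \<odot>\<^bsub>B\<^esub> x) = z \<odot>\<^bsub>A\<^esub> h x"
begin

lemma base_change_map_class:
  assumes "x \<in> carrier (pairs_ring B)"
  shows "base_change_map \<phi> A h (B.tensor_class \<phi> x) = A.tensor_class \<phi> (lin_ext (\<lambda>(b, c). basis (h b, c)) x)"
    and "lin_ext (\<lambda>(b, c). basis (h b, c)) x \<in> carrier (pairs_ring A)"
proof -
  let ?L = "lin_ext (\<lambda>(b, c). basis (h b, c)) :: ('b \<times> complex \<Rightarrow>\<^sub>0 int) \<Rightarrow> _"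
  have carrier: "?L y \<in> carrier (pairs_ring A)" if "y \<in> carrier (pairs_ring B)" for y
    using that unfolding pairs_ring_carrier mem_Collect_eq by (intro keys_lin_ext) (auto simp: h_closed)
  show "?L x \<in> carrier (pairs_ring A)" using assms by (rule carrier)
  show "base_change_map \<phi> A h (B.tensor_class \<phi> x) = A.tensor_class \<phi> (?L x)"
    unfolding base_change_map_def
  proof (rule coset_union_eq[OF _ _ _ _ _ assms])
    fix t assume "t \<in> tensor_relations \<phi> B"
    then have "?L t \<in> tensor_relations \<phi> A"
    proof (cases rule: B.tensor_relations_cases)
      case (add_left p q d)
      then show ?thesis
        using A.in_tensor_relations(1)[of "h p" "h q" d \<phi>] by (simp add: lin_ext_diff h_add h_closed)
    next
      case (add_right p d d')
      then show ?thesis using A.in_tensor_relations(2)[of "h p" d d' \<phi>] by (simp add: lin_ext_diff h_closed)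
    next
      case (scalar z p d)
      then show ?thesis
        using A.in_tensor_relations(3)[of "h p" z d \<phi>] by (simp add: lin_ext_diff h_smult h_closed)
    qed
    then show "?L t \<in> tensor_kernel \<phi> A" by (rule A.tensor_kernel_closed(2))
  qed (auto simp: lin_ext_add carrier B.algebra_over_axioms A.algebra_over_axioms)
qed

lemma base_change_map_pure_tensor:
  "x \<in> carrier B \<Longrightarrow> base_change_map \<phi> A h (pure_tensor \<phi> B x c) = pure_tensor \<phi> A (h x) c"
  unfolding A.pure_tensor_class B.pure_tensor_class by (simp add: base_change_map_class basis_in_pairs_ring)

lemma base_change_map_closed:
  assumes "x \<in> carrier (base_change \<phi> B)"
  shows "base_change_map \<phi> A h x \<in> carrier (base_change \<phi> A)"
proof -
  obtain u where "u \<in> carrier (pairs_ring B)" "x = B.tensor_class \<phi> u"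
    using assms by (auto simp: B.base_change_fields FactRing_def A_RCOSETS_def')
  then show ?thesis by (simp add: base_change_map_class A.tensor_class_closed)
qed

lemma base_change_map_add:
  assumes "x \<in> carrier (base_change \<phi> B)" "y \<in> carrier (base_change \<phi> B)"
  shows "base_change_map \<phi> A h (x \<oplus>\<^bsub>base_change \<phi> B\<^esub> y) =
       base_change_map \<phi> A h x \<oplus>\<^bsub>base_change \<phi> A\<^esub> base_change_map \<phi> A h y"
proof -
  obtain u w where u: "u \<in> carrier (pairs_ring B)" "x = B.tensor_class \<phi> u" and w: "w \<in> carrier (pairs_ring B)" "y = B.tensor_class \<phi> w"
    using assms by (auto simp: B.base_change_fields FactRing_def A_RCOSETS_def')
  show ?thesis
    using base_change_map_class[OF u(1)] base_change_map_class[OF w(1)] u w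
    by (simp add: A.tensor_class_hom B.tensor_class_hom base_change_map_class pairs_ring_carrier_closed lin_ext_add)
qed

lemma base_change_map_zero: "base_change_map \<phi> A h \<zero>\<^bsub>base_change \<phi> B\<^esub> = \<zero>\<^bsub>base_change \<phi> A\<^esub>"
proof -
  interpret RA: ring "base_change \<phi> A" by (rule A.ring_base_change)
  interpret RB: ring "base_change \<phi> B" by (rule B.ring_base_change)
  show ?thesis
    by (rule additive_zero[OF RB.abelian_group_axioms RA.abelian_group_axioms])
       (simp_all add: base_change_map_closed base_change_map_add)
qed

end

text \<open>Functoriality of the base change turns the maps \<open>\<iota>\<close> and \<open>\<rho>\<close>, of which \<open>\<rho>\<close> is \<open>x \<mapsto> e x e\<close> up to \<open>\<iota>\<close>,
  into maps with the same composites; the remaining identities hold for pure tensors and hence everywhere.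
  Stating bijectivity onto \<open>e A e\<close> through \<open>\<rho>\<close> is what makes it stable under base change: an injective map
  need not stay injective.\<close>

lemma full_corner_base_change:
  fixes A :: "('z, 'a) module" and B :: "('z, 'b) module"
  assumes i: "algebra_over_map B A \<iota>" and r: "algebra_over_map A B \<rho>"
    and \<iota>_mult: "\<And>x y. \<lbrakk>x \<in> carrier B; y \<in> carrier B\<rbrakk> \<Longrightarrow> \<iota> (x \<otimes>\<^bsub>B\<^esub> y) = \<iota> x \<otimes>\<^bsub>A\<^esub> \<iota> y"
    and \<iota>_one: "\<iota> \<one>\<^bsub>B\<^esub> = e"
    and \<rho>_\<iota>: "\<And>x. x \<in> carrier B \<Longrightarrow> \<rho> (\<iota> x) = x"
    and \<iota>_\<rho>: "\<And>x. x \<in> carrier A \<Longrightarrow> \<iota> (\<rho> x) = e \<otimes>\<^bsub>A\<^esub> x \<otimes>\<^bsub>A\<^esub> e"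
    and K: "finite K"
    and a: "\<And>k. k \<in> K \<Longrightarrow> a k \<in> carrier A" "\<And>k. k \<in> K \<Longrightarrow> a k \<otimes>\<^bsub>A\<^esub> e = a k"
    and b: "\<And>k. k \<in> K \<Longrightarrow> b k \<in> carrier A" "\<And>k. k \<in> K \<Longrightarrow> e \<otimes>\<^bsub>A\<^esub> b k = b k"
    and full: "\<one>\<^bsub>A\<^esub> = finsum A (\<lambda>k. a k \<otimes>\<^bsub>A\<^esub> b k) K"
  shows "full_corner (base_change \<phi> A) (base_change \<phi> B) (pure_tensor \<phi> A e 1) (base_change_map \<phi> A \<iota>) K
    (\<lambda>k. pure_tensor \<phi> A (a k) 1) (\<lambda>k. pure_tensor \<phi> A (b k) 1)"
proof -
  interpret i: algebra_over_map B A \<iota> by (fact i)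
  interpret r: algebra_over_map A B \<rho> by (fact r)
  interpret RA: complex_algebra "base_change \<phi> A" by (rule i.A.complex_algebra_base_change)
  interpret RB: complex_algebra "base_change \<phi> B" by (rule i.B.complex_algebra_base_change)
  let ?\<iota> = "base_change_map \<phi> A \<iota>" and ?\<rho> = "base_change_map \<phi> B \<rho>" and ?e = "pure_tensor \<phi> A e 1"
  have e [simp]: "e \<in> carrier A" using i.h_closed[of "\<one>\<^bsub>B\<^esub>"] \<iota>_one by simp
  have ee: "e \<otimes>\<^bsub>A\<^esub> e = e" using \<iota>_mult[of "\<one>\<^bsub>B\<^esub>" "\<one>\<^bsub>B\<^esub>"] \<iota>_one by simp
  note pt = i.A.pure_tensor_mult i.B.pure_tensor_mult i.base_change_map_pure_tensor r.base_change_map_pure_tensor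
    i.base_change_map_zero r.base_change_map_zero i.base_change_map_closed r.base_change_map_closed
    i.base_change_map_add r.base_change_map_add
  have \<rho>_\<iota>': "?\<rho> (?\<iota> x) = x" if "x \<in> carrier (base_change \<phi> B)" for x
    using that by (induction rule: i.B.base_change_induct) (simp_all add: pt i.h_closed \<rho>_\<iota>)
  have \<iota>_\<rho>': "?\<iota> (?\<rho> x) = ?e \<otimes>\<^bsub>base_change \<phi> A\<^esub> x \<otimes>\<^bsub>base_change \<phi> A\<^esub> ?e" if "x \<in> carrier (base_change \<phi> A)" for x
    using that
    by (induction rule: i.A.base_change_induct)
       (simp_all add: pt r.h_closed \<iota>_\<rho> RA.l_distr RA.r_distr)
  have \<iota>_mult': "?\<iota> (x \<otimes>\<^bsub>base_change \<phi> B\<^esub> y) = ?\<iota> x \<otimes>\<^bsub>base_change \<phi> A\<^esub> ?\<iota> y"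
    if x: "x \<in> carrier (base_change \<phi> B)" and y: "y \<in> carrier (base_change \<phi> B)" for x y
    using x
  proof (induction rule: i.B.base_change_induct)
    case (pure_tensor p c)
    show ?case using y
      by (induction rule: i.B.base_change_induct)
         (simp_all add: pt i.h_closed \<iota>_mult RA.r_distr RB.r_distr pure_tensor)
  qed (simp_all add: pt y RA.l_distr RB.l_distr)
  show ?thesis
  proof (unfold_locales)
    show "inj_on ?\<iota> (carrier (base_change \<phi> B))" by (rule inj_on_inverseI[where g = ?\<rho>]) (rule \<rho>_\<iota>')
    show "?\<iota> (scalar (base_change \<phi> B) c) = ?e \<otimes>\<^bsub>base_change \<phi> A\<^esub> scalar (base_change \<phi> A) c" for c
      unfolding i.B.scalar_base_change i.A.scalar_base_change by (simp add: pt \<iota>_one)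
    show "\<exists>s\<in>carrier (base_change \<phi> B). ?\<iota> s = ?e \<otimes>\<^bsub>base_change \<phi> A\<^esub> x \<otimes>\<^bsub>base_change \<phi> A\<^esub> ?e"
      if "x \<in> carrier (base_change \<phi> A)" for x
      using \<iota>_\<rho>'[OF that] that by (intro bexI[of _ "?\<rho> x"]) (simp_all add: pt)
    have "\<one>\<^bsub>base_change \<phi> A\<^esub> = pure_tensor \<phi> A (finsum A (\<lambda>k. a k \<otimes>\<^bsub>A\<^esub> b k) K) 1"
      by (simp add: i.A.pure_tensor_one full)
    also have "\<dots> = finsum (base_change \<phi> A) (\<lambda>k. pure_tensor \<phi> A (a k \<otimes>\<^bsub>A\<^esub> b k) 1) K"
      using a b K i.A.pure_tensor_add_left
      by (intro additive_finsum[where f = "\<lambda>x. pure_tensor \<phi> A x 1"] i.A.abelian_group_axioms RA.abelian_group_axioms) auto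
    also have "\<dots> = finsum (base_change \<phi> A)
        (\<lambda>k. pure_tensor \<phi> A (a k) 1 \<otimes>\<^bsub>base_change \<phi> A\<^esub> pure_tensor \<phi> A (b k) 1) K"
      using a b by (intro RA.finsum_cong') (auto simp: pt)
    finally show "\<one>\<^bsub>base_change \<phi> A\<^esub> = finsum (base_change \<phi> A)
        (\<lambda>k. pure_tensor \<phi> A (a k) 1 \<otimes>\<^bsub>base_change \<phi> A\<^esub> pure_tensor \<phi> A (b k) 1) K" .
  qed (use K a b in \<open>simp_all add: pt \<iota>_mult' i.B.pure_tensor_one \<iota>_one\<close>)
qed

section \<open>The Hecke action on generators\<close>

definition word_monoid :: "nat \<Rightarrow> hecke_gen list monoid" where
  "word_monoid r = \<lparr>carrier = lists (hecke_gens r), mult = (@), one = []\<rparr>"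

lemma free_hecke_eq: "free_hecke r = monoid_algebra (word_monoid r)"
  by (simp add: free_hecke_def free_algebra_def word_monoid_def)

lemma word_monoid_simps [simp]:
  "carrier (word_monoid r) = lists (hecke_gens r)" "x \<otimes>\<^bsub>word_monoid r\<^esub> y = x @ y" "\<one>\<^bsub>word_monoid r\<^esub> = []"
  by (simp_all add: word_monoid_def)

lemma ring_free_hecke: "ring (free_hecke r)"
  unfolding free_hecke_eq
  by (rule ring_monoid_algebra, rule monoidI) auto

lemma free_hecke_simps:
  "carrier (free_hecke r) = {x. Poly_Mapping.keys x \<subseteq> lists (hecke_gens r)}"
  "x \<oplus>\<^bsub>free_hecke r\<^esub> y = x + y" "\<one>\<^bsub>free_hecke r\<^esub> = basis []" "\<zero>\<^bsub>free_hecke r\<^esub> = 0"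
  "scale c x \<otimes>\<^bsub>free_hecke r\<^esub> y = scale c (x \<otimes>\<^bsub>free_hecke r\<^esub> y)"
  "(x + y) \<otimes>\<^bsub>free_hecke r\<^esub> z = x \<otimes>\<^bsub>free_hecke r\<^esub> z + y \<otimes>\<^bsub>free_hecke r\<^esub> z"
  "x \<otimes>\<^bsub>free_hecke r\<^esub> (y + z) = x \<otimes>\<^bsub>free_hecke r\<^esub> y + x \<otimes>\<^bsub>free_hecke r\<^esub> z"
  "(x - y) \<otimes>\<^bsub>free_hecke r\<^esub> z = x \<otimes>\<^bsub>free_hecke r\<^esub> z - y \<otimes>\<^bsub>free_hecke r\<^esub> z"
  "x \<otimes>\<^bsub>free_hecke r\<^esub> (y - z) = x \<otimes>\<^bsub>free_hecke r\<^esub> y - x \<otimes>\<^bsub>free_hecke r\<^esub> z"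
  "Poly_Mapping.single u c \<otimes>\<^bsub>free_hecke r\<^esub> Poly_Mapping.single w d = Poly_Mapping.single (u @ w) (c * d)"
  by (simp_all add: free_hecke_eq monoid_algebra_mult_simps) (simp add: monoid_algebra_mult lin_ext_scale)

lemma free_hecke_closed:
  "x \<in> carrier (free_hecke r) \<Longrightarrow> scale c x \<in> carrier (free_hecke r)"
  "x \<in> carrier (free_hecke r) \<Longrightarrow> y \<in> carrier (free_hecke r) \<Longrightarrow> x + y \<in> carrier (free_hecke r)"
  "x \<in> carrier (free_hecke r) \<Longrightarrow> y \<in> carrier (free_hecke r) \<Longrightarrow> x - y \<in> carrier (free_hecke r)"
  "set w \<subseteq> hecke_gens r \<Longrightarrow> Poly_Mapping.single w c \<in> carrier (free_hecke r)"
proof -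
  show "set w \<subseteq> hecke_gens r \<Longrightarrow> Poly_Mapping.single w c \<in> carrier (free_hecke r)"
    by (auto simp: free_hecke_simps(1))
qed (unfold free_hecke_simps(1) mem_Collect_eq, rule subset_trans[OF keys_scale],
    assumption, rule subset_trans[OF keys_add Un_least], assumption+,
    rule subset_trans[OF Poly_Mapping.keys_diff Un_least], assumption+)

lemma hecke_gens_iff [simp]:
  "T i \<in> hecke_gens r \<longleftrightarrow> i \<in> {1..<r}" "X j \<in> hecke_gens r \<longleftrightarrow> j \<in> {1..r}" "Xinv j \<in> hecke_gens r \<longleftrightarrow> j \<in> {1..r}"
  by (auto simp: hecke_gens_def)

lemma hecke_relations_subset: "hecke_relations r \<subseteq> carrier (free_hecke r)"
proof -
  interpret F: ring "free_hecke r" by (rule ring_free_hecke)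
  show ?thesis
    unfolding hecke_relations_def
    by (intro Un_least subsetI; elim CollectE exE conjE)
       (auto intro!: free_hecke_closed F.m_closed)
qed

lemma in_hecke_relations:
  "j \<in> {1..r} \<Longrightarrow> basis [X j, Xinv j] - basis [] \<in> hecke_relations r"
  "j \<in> {1..r} \<Longrightarrow> basis [Xinv j, X j] - basis [] \<in> hecke_relations r"
  "k \<in> {1..<r} \<Longrightarrow> j \<in> {1..r} \<Longrightarrow> j \<noteq> k \<Longrightarrow> j \<noteq> k + 1 \<Longrightarrow> basis [X j, T k] - basis [T k, X j] \<in> hecke_relations r"
  "k \<in> {1..<r} \<Longrightarrow> basis [T k, X k, T k] - scale (v^2) (basis [X (k+1)]) \<in> hecke_relations r"
  "k \<in> {1..<r} \<Longrightarrow> (basis [T k] + basis []) \<otimes>\<^bsub>free_hecke r\<^esub> (basis [T k] - scale (v^2) (basis [])) \<in> hecke_relations r"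
  unfolding hecke_relations_def by blast+

lemma ideal_hecke_ideal: "ideal (hecke_ideal r) (free_hecke r)"
  unfolding hecke_ideal_def
  by (rule ring.genideal_ideal[OF ring_free_hecke hecke_relations_subset])

abbreviation hecke_class :: "nat \<Rightarrow> (hecke_gen list \<Rightarrow>\<^sub>0 laurent) \<Rightarrow> hecke_elt" where
  "hecke_class r p \<equiv> hecke_ideal r +>\<^bsub>free_hecke r\<^esub> p"

lemma hecke_fields:
  "carrier (hecke r) = carrier (free_hecke r Quot hecke_ideal r)"
  "mult (hecke r) = mult (free_hecke r Quot hecke_ideal r)"
  "one (hecke r) = hecke_class r (basis [])"
  "add (hecke r) = add (free_hecke r Quot hecke_ideal r)"
  by (simp_all add: hecke_def quotient_algebra_def ring.defs module.defs FactRing_def free_hecke_simps)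

lemma carrier_hecke: "carrier (hecke r) = hecke_class r ` carrier (free_hecke r)"
  by (auto simp: hecke_fields FactRing_def A_RCOSETS_def')

lemma hecke_class_closed: "p \<in> carrier (free_hecke r) \<Longrightarrow> hecke_class r p \<in> carrier (hecke r)"
  by (simp add: carrier_hecke)

lemma hecke_class_hom:
  assumes "p \<in> carrier (free_hecke r)" "q \<in> carrier (free_hecke r)"
  shows "hecke_class r (p + q) = hecke_class r p \<oplus>\<^bsub>hecke r\<^esub> hecke_class r q"
    "hecke_class r (p \<otimes>\<^bsub>free_hecke r\<^esub> q) = hecke_class r p \<otimes>\<^bsub>hecke r\<^esub> hecke_class r q"
proof -
  interpret I: ideal "hecke_ideal r" "free_hecke r" by (rule ideal_hecke_ideal)
  show "hecke_class r (p + q) = hecke_class r p \<oplus>\<^bsub>hecke r\<^esub> hecke_class r q"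
    "hecke_class r (p \<otimes>\<^bsub>free_hecke r\<^esub> q) = hecke_class r p \<otimes>\<^bsub>hecke r\<^esub> hecke_class r q"
    using ring_hom_add[OF I.rcos_ring_hom assms] ring_hom_mult[OF I.rcos_ring_hom assms]
    by (simp_all add: hecke_fields free_hecke_simps)
qed

lemma hecke_class_eqI:
  assumes "q \<in> carrier (free_hecke r)" "p - q \<in> hecke_ideal r"
  shows "hecke_class r p = hecke_class r q"
proof -
  interpret I: ideal "hecke_ideal r" "free_hecke r" by (rule ideal_hecke_ideal)
  have "p \<in> hecke_class r q" unfolding a_r_coset_def'
    using assms(2) by (auto simp: free_hecke_simps intro!: bexI[of _ "p - q"])
  then show ?thesis using I.a_repr_independence[OF _ assms(1) I.a_subgroup] by simp
qed

lemma scale_hecke_ideal: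
  assumes "k \<in> hecke_ideal r" shows "scale c k \<in> hecke_ideal r"
proof -
  interpret I: ideal "hecke_ideal r" "free_hecke r" by (rule ideal_hecke_ideal)
  have "scale c (basis []) \<otimes>\<^bsub>free_hecke r\<^esub> k \<in> hecke_ideal r"
    using assms by (intro I.I_l_closed free_hecke_closed) auto
  moreover have "scale c (basis []) \<otimes>\<^bsub>free_hecke r\<^esub> k = scale c (\<one>\<^bsub>free_hecke r\<^esub> \<otimes>\<^bsub>free_hecke r\<^esub> k)"
    by (simp only: free_hecke_simps)
  ultimately show ?thesis using I.l_one[OF I.a_Hcarr[OF assms]] by simp
qed

lemma hecke_class_scale:
  assumes "p \<in> carrier (free_hecke r)"
  shows "hecke_class r (scale c p) = c \<odot>\<^bsub>hecke r\<^esub> hecke_class r p"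
proof -
  interpret I: ideal "hecke_ideal r" "free_hecke r" by (rule ideal_hecke_ideal)
  have smult: "smult (free_hecke r) = scale" by (simp add: free_hecke_eq monoid_algebra_def)
  have "c \<odot>\<^bsub>hecke r\<^esub> hecke_class r p = (\<Union>q \<in> hecke_class r p. hecke_class r (scale c q))"
    by (simp add: hecke_def quotient_algebra_def ring.defs module.defs smult)
  also have "\<dots> = (\<Union>q \<in> hecke_class r p. hecke_class r (scale c p))"
  proof (intro SUP_cong refl)
    fix q assume "q \<in> hecke_class r p"
    then obtain k where k: "k \<in> hecke_ideal r" "q = k + p" by (auto simp: a_r_coset_def' free_hecke_simps)
    then show "hecke_class r (scale c q) = hecke_class r (scale c p)"
      using assms by (intro hecke_class_eqI free_hecke_closed) (simp_all add: scale_hecke_ideal flip: scale_diff)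
  qed
  also have "\<dots> = hecke_class r (scale c p)"
  proof -
    have "p \<in> hecke_class r p" by (rule I.a_rcos_self[OF assms])
    then have "hecke_class r p \<noteq> {}" by blast
    then show ?thesis by (simp only: UN_constant if_False)
  qed
  finally show ?thesis by simp
qed

lemma hecke_class_relation:
  assumes "p - q \<in> hecke_relations r" "q \<in> carrier (free_hecke r)"
  shows "hecke_class r p = hecke_class r q"
  using assms ring.genideal_self[OF ring_free_hecke hecke_relations_subset, of r]
  by (intro hecke_class_eqI) (auto simp: hecke_ideal_def)

lemma hgen_eq: "hgen r g = hecke_class r (basis [g])"
  by (simp add: hgen_def)

lemma hgen_closed [simp]: "g \<in> hecke_gens r \<Longrightarrow> hgen r g \<in> carrier (hecke r)"
  unfolding hgen_eq by (intro hecke_class_closed free_hecke_closed) auto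

lemma tensor_space_closed:
  "0 \<in> tensor_space r"
  "x \<in> tensor_space r \<Longrightarrow> y \<in> tensor_space r \<Longrightarrow> x + y \<in> tensor_space r"
  "x \<in> tensor_space r \<Longrightarrow> y \<in> tensor_space r \<Longrightarrow> x - y \<in> tensor_space r"
  "x \<in> tensor_space r \<Longrightarrow> scale c x \<in> tensor_space r"
  "length i = r \<Longrightarrow> Poly_Mapping.single i c \<in> tensor_space r"
  using keys_add[of x y] Poly_Mapping.keys_diff[of x y] keys_scale[of c x] by (auto simp: tensor_space_def)

context affine_tensor_module
begin

text \<open>The action of the free algebra, in which words act letter by letter.\<close>

abbreviation wact :: "tens \<Rightarrow> (hecke_gen list \<Rightarrow>\<^sub>0 laurent) \<Rightarrow> tens" where
  "wact x p \<equiv> act x (hecke_class r p)"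

abbreviation gact :: "tens \<Rightarrow> hecke_gen \<Rightarrow> tens" where
  "gact x g \<equiv> act x (hgen r g)"

lemma gact_closed: "x \<in> tensor_space r \<Longrightarrow> g \<in> hecke_gens r \<Longrightarrow> gact x g \<in> tensor_space r"
  by (simp add: act_closed)

lemma gact_add: "x \<in> tensor_space r \<Longrightarrow> y \<in> tensor_space r \<Longrightarrow> g \<in> hecke_gens r \<Longrightarrow> gact (x + y) g = gact x g + gact y g"
  by (simp add: act_add_left)

lemma gact_scale: "x \<in> tensor_space r \<Longrightarrow> g \<in> hecke_gens r \<Longrightarrow> gact (scale c x) g = scale c (gact x g)"
  by (simp add: act_scale_left)

lemma wact_Nil: "x \<in> tensor_space r \<Longrightarrow> wact x (basis []) = x"
  using act_one by (simp add: hecke_fields)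

lemma wact_Cons:
  assumes "x \<in> tensor_space r" "set (g # w) \<subseteq> hecke_gens r"
  shows "wact x (basis (g # w)) = wact (gact x g) (basis w)"
proof -
  have "basis (g # w) = basis [g] \<otimes>\<^bsub>free_hecke r\<^esub> (basis w :: _ \<Rightarrow>\<^sub>0 laurent)" by (simp add: free_hecke_simps)
  then show ?thesis
    using assms by (simp add: hecke_class_hom hgen_eq act_mult hecke_class_closed free_hecke_closed)
qed

lemma wact_add:
  assumes "x \<in> tensor_space r" "p \<in> carrier (free_hecke r)" "q \<in> carrier (free_hecke r)"
  shows "wact x (p + q) = wact x p + wact x q"
  using assms by (simp add: hecke_class_hom act_add_right hecke_class_closed)

lemma wact_scale:
  assumes "x \<in> tensor_space r" "p \<in> carrier (free_hecke r)"
  shows "wact x (scale c p) = scale c (wact x p)"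
  using assms by (simp add: hecke_class_scale[symmetric, THEN sym] act_scale_right hecke_class_closed)

lemma wact_relation:
  assumes "p - q \<in> hecke_relations r" "q \<in> carrier (free_hecke r)"
  shows "wact x p = wact x q"
  using hecke_class_relation[OF assms] by simp

lemmas wact_simps = wact_Nil wact_Cons wact_add wact_scale gact_closed free_hecke_closed

lemma X_Xinv:
  assumes "x \<in> tensor_space r" "j \<in> {1..r}"
  shows "gact (gact x (X j)) (Xinv j) = x" "gact (gact x (Xinv j)) (X j) = x"
proof -
  have "wact x (basis [X j, Xinv j]) = wact x (basis [])" "wact x (basis [Xinv j, X j]) = wact x (basis [])"
    by (rule wact_relation, rule in_hecke_relations; use assms in \<open>auto simp del: scale_simps intro!: free_hecke_closed\<close>)+
  then show "gact (gact x (X j)) (Xinv j) = x" "gact (gact x (Xinv j)) (X j) = x"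
    using assms by (simp_all add: wact_simps)
qed

lemma X_T_commute:
  assumes "x \<in> tensor_space r" "k \<in> {1..<r}" "j \<in> {1..r}" "j \<noteq> k" "j \<noteq> k + 1"
  shows "gact (gact x (X j)) (T k) = gact (gact x (T k)) (X j)"
proof -
  have "wact x (basis [X j, T k]) = wact x (basis [T k, X j])"
    by (rule wact_relation, rule in_hecke_relations; use assms in \<open>auto simp del: scale_simps intro!: free_hecke_closed\<close>)
  then show ?thesis using assms by (simp add: wact_simps)
qed

lemma T_X_T:
  assumes "x \<in> tensor_space r" "k \<in> {1..<r}"
  shows "gact (gact (gact x (T k)) (X k)) (T k) = scale (v^2) (gact x (X (k + 1)))"
proof -
  have "wact x (basis [T k, X k, T k]) = wact x (scale (v^2) (basis [X (k + 1)]))"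
    by (rule wact_relation, rule in_hecke_relations; use assms in \<open>auto simp del: scale_simps intro!: free_hecke_closed\<close>)
  then show ?thesis using assms by (simp add: wact_simps del: scale_simps)
qed

text \<open>The quadratic relation, solved for the square of \<open>T\<^sub>k\<close>.\<close>

lemma T_T:
  assumes "x \<in> tensor_space r" "k \<in> {1..<r}"
  shows "gact (gact x (T k)) (T k) = scale (v^2 - 1) (gact x (T k)) + scale (v^2) x"
proof -
  let ?q = "scale (v^2 - 1) (basis [T k]) + scale (v^2) (basis []) :: hecke_gen list \<Rightarrow>\<^sub>0 laurent"
  have "(basis [T k] + basis []) \<otimes>\<^bsub>free_hecke r\<^esub> (basis [T k] - scale (v^2) (basis [])) = basis [T k, T k] - ?q"
    by (simp add: free_hecke_simps single_diff)
  then have "basis [T k, T k] - ?q \<in> hecke_relations r"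
    using in_hecke_relations(5)[OF assms(2)] by simp
  then have "wact x (basis [T k, T k]) = wact x ?q"
    by (rule wact_relation) (use assms in \<open>auto intro!: free_hecke_closed\<close>)
  then show ?thesis using assms by (simp add: wact_simps del: scale_simps)
qed

end

section \<open>Maps commuting with the Hecke action\<close>

text \<open>\<open>v\<close> is invertible.\<close>

lemma scale_v_cancel:
  assumes "scale (v^2) x = scale (v^2) y" shows "x = y"
proof -
  have "Poly_Mapping.single (-2) 1 * v^2 = (1 :: laurent)"
    by (simp add: v_def power2_eq_square mult_single)
  moreover have "scale (Poly_Mapping.single (-2) 1) (scale (v^2) x) = scale (Poly_Mapping.single (-2) 1) (scale (v^2) y)"
    using assms by simp
  ultimately show ?thesis by simp
qed

context affine_tensor_module
begin

text \<open>The Bernstein relations, by which \<open>T\<^sub>k\<close> moves past \<open>X\<^sub>k\<close>. Here one multiplies \<open>T\<^sub>k X\<^sub>k T\<^sub>k = v\<^sup>2 X\<^bsub>k+1\<^esub>\<close> by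
  \<open>T\<^sub>k\<close> from the right, replaces the square of \<open>T\<^sub>k\<close> and cancels \<open>v\<^sup>2\<close>; for the next lemma from the left.\<close>

lemma T_X:
  assumes x: "x \<in> tensor_space r" and k: "k \<in> {1..<r}"
  shows "gact (gact x (T k)) (X k) = gact (gact x (X (k + 1))) (T k) - scale (v^2 - 1) (gact x (X (k + 1)))"
proof -
  let ?y = "gact (gact x (T k)) (X k)" and ?z = "gact x (X (k + 1))"
  have closed: "?y \<in> tensor_space r" "?z \<in> tensor_space r" using x k by (auto intro!: gact_closed)
  have "scale (v^2) (scale (v^2 - 1) ?z + ?y) = scale (v^2 - 1) (gact ?y (T k)) + scale (v^2) ?y"
    using T_X_T[OF x k] by (simp add: scale_add mult.commute)
  also have "\<dots> = gact (gact ?y (T k)) (T k)" using T_T[OF closed(1) k] by simp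
  also have "\<dots> = scale (v^2) (gact ?z (T k))" using T_X_T[OF x k] closed k by (simp add: gact_scale)
  finally have "scale (v^2 - 1) ?z + ?y = gact ?z (T k)" by (rule scale_v_cancel)
  then show ?thesis by (simp add: algebra_simps)
qed

lemma X_T:
  assumes x: "x \<in> tensor_space r" and k: "k \<in> {1..<r}"
  shows "gact (gact x (X k)) (T k) = gact (gact x (T k)) (X (k + 1)) - scale (v^2 - 1) (gact x (X (k + 1)))"
proof -
  let ?t = "gact x (T k)" and ?z = "gact x (X (k + 1))"
  have closed: "?t \<in> tensor_space r" "?z \<in> tensor_space r" "gact x (X k) \<in> tensor_space r" "gact ?t (X k) \<in> tensor_space r"
    using x k by (auto intro!: gact_closed)
  have "scale (v^2) (scale (v^2 - 1) ?z + gact (gact x (X k)) (T k))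
      = scale (v^2 - 1) (gact (gact ?t (X k)) (T k)) + scale (v^2) (gact (gact x (X k)) (T k))"
    using T_X_T[OF x k] by (simp add: scale_add mult.commute)
  also have "\<dots> = gact (gact (scale (v^2 - 1) ?t + scale (v^2) x) (X k)) (T k)"
    using x k closed by (simp add: gact_add gact_scale tensor_space_closed)
  also have "\<dots> = gact (gact (gact ?t (T k)) (X k)) (T k)" using T_T[OF x k] by simp
  also have "\<dots> = scale (v^2) (gact ?t (X (k + 1)))" using T_X_T[OF closed(1) k] .
  finally have "scale (v^2 - 1) ?z + gact (gact x (X k)) (T k) = gact ?t (X (k + 1))" by (rule scale_v_cancel)
  then show ?thesis by (simp add: algebra_simps)
qed

lemma X_cancel:
  assumes "x \<in> tensor_space r" "y \<in> tensor_space r" "j \<in> {1..r}" "gact x (X j) = gact y (X j)"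
  shows "x = y"
  using X_Xinv(1)[OF assms(1,3)] unfolding assms(4) X_Xinv(1)[OF assms(2,3)] by simp

lemma X_shift:
  assumes "length i = r" "t \<in> {1..r}"
  shows "gact (\<omega> i) (X t) = \<omega> (i[t - 1 := i ! (t - 1) - int n])"
proof -
  let ?i = "i[t - 1 := i ! (t - 1) - int n]"
  have "t - 1 < length i" using assms by auto
  then have "gact (\<omega> ?i) (Xinv t) = \<omega> i" using act_Xinv[of ?i t] assms by simp
  then show ?thesis using X_Xinv(2)[of "\<omega> ?i" t] assms by (simp add: tensor_space_closed)
qed

end

text \<open>A linear map between two tensor spaces, with possibly different \<open>m\<close> and \<open>n\<close>, for which compatibility is
  assumed exactly where the action is given by explicit formulas.\<close>

locale tensor_space_map = M: affine_tensor_module m r act + N: affine_tensor_module n r act'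
  for m n r :: nat and act act' :: "tens \<Rightarrow> hecke_elt \<Rightarrow> tens" +
  fixes F :: "tens \<Rightarrow> tens"
  assumes m_pos: "0 < m"
    and F_closed: "x \<in> tensor_space r \<Longrightarrow> F x \<in> tensor_space r"
    and F_add: "\<lbrakk>x \<in> tensor_space r; y \<in> tensor_space r\<rbrakk> \<Longrightarrow> F (x + y) = F x + F y"
    and F_scale: "x \<in> tensor_space r \<Longrightarrow> F (scale c x) = scale c (F x)"
    and F_Xinv_basis: "\<lbrakk>length i = r; j \<in> {1..r}\<rbrakk>
        \<Longrightarrow> F (act (\<omega> i) (hgen r (Xinv j))) = act' (F (\<omega> i)) (hgen r (Xinv j))"
    and F_T_fundamental: "\<lbrakk>length i = r; set i \<subseteq> {1..int m}; k \<in> {1..<r}\<rbrakk>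
        \<Longrightarrow> F (act (\<omega> i) (hgen r (T k))) = act' (F (\<omega> i)) (hgen r (T k))"
begin

lemma F_diff: "x \<in> tensor_space r \<Longrightarrow> y \<in> tensor_space r \<Longrightarrow> F (x - y) = F x - F y"
  using F_add[of "x - y" y] tensor_space_closed by simp

lemma F_zero: "F 0 = 0"
  using F_add[of 0 0] tensor_space_closed by simp

lemma commute_on_basis:
  assumes g: "g \<in> hecke_gens r" and x: "x \<in> tensor_space r"
    and basis: "\<And>i. length i = r \<Longrightarrow> F (M.gact (\<omega> i) g) = N.gact (F (\<omega> i)) g"
  shows "F (M.gact x g) = N.gact (F x) g"
proof -
  have "x \<in> tensor_space r \<and> F (M.gact x g) = N.gact (F x) g"
    using x[unfolded tensor_space_def mem_Collect_eq]
  proof (induction rule: poly_mapping_span_induct)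
    case zero
    have "M.gact 0 g = 0" "N.gact 0 g = 0"
      using M.gact_scale[of 0 g 0] N.gact_scale[of 0 g 0] g tensor_space_closed by auto
    then show ?case by (simp add: F_zero tensor_space_closed)
  next
    case (single i c)
    then have i: "\<omega> i \<in> tensor_space r" "length i = r" by (auto simp: tensor_space_closed)
    have "F (M.gact (scale c (\<omega> i)) g) = N.gact (F (scale c (\<omega> i))) g"
      using i g basis by (simp add: M.gact_scale N.gact_scale M.gact_closed F_scale F_closed del: scale_simps)
    then show ?case using i by (simp add: tensor_space_closed)
  next
    case (add x y)
    then show ?case using g
      by (simp add: tensor_space_closed M.gact_add N.gact_add M.gact_closed F_add F_closed)
  qed
  then show ?thesis ..
qed

lemma F_Xinv:
  assumes "x \<in> tensor_space r" "j \<in> {1..r}"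
  shows "F (M.gact x (Xinv j)) = N.gact (F x) (Xinv j)"
  by (rule commute_on_basis[OF _ assms(1) F_Xinv_basis[OF _ assms(2)]]) (use assms(2) in simp_all)

text \<open>\<open>X\<^sub>j\<close> is inverse to \<open>X\<^sub>j\<^sup>-\<^sup>1\<close>.\<close>

lemma F_X:
  assumes "x \<in> tensor_space r" "j \<in> {1..r}"
  shows "F (M.gact x (X j)) = N.gact (F x) (X j)"
proof -
  have closed: "M.gact x (X j) \<in> tensor_space r" using assms by (intro M.gact_closed) auto
  have "N.gact (F (M.gact x (X j))) (Xinv j) = F x"
    using F_Xinv[OF closed assms(2)] M.X_Xinv[OF assms] by simp
  then show ?thesis using N.X_Xinv(2)[OF F_closed[OF closed] assms(2)] by simp
qed

abbreviation "commutes_T k x \<equiv> F (M.gact x (T k)) = N.gact (F x) (T k)"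

text \<open>In all three cases the commutation relation of \<open>X\<^sub>j\<close> and \<open>T\<^sub>k\<close> has the form \<open>X\<^sub>j T\<^sub>k = T\<^sub>k X\<^bsub>j'\<^esub> + c X\<^bsub>k+1\<^esub>\<close> for a
  scalar \<open>c\<close>, and \<open>F\<close> commutes with the \<open>X\<close>'s. So the two sides for \<open>x X\<^sub>j\<close> differ from
  those for \<open>x\<close> only by an application of \<open>X\<^bsub>j'\<^esub>\<close> and a common summand.\<close>

lemma commutes_T_X_iff:
  assumes x: "x \<in> tensor_space r" and k: "k \<in> {1..<r}" and j: "j \<in> {1..r}"
  shows "commutes_T k (M.gact x (X j)) \<longleftrightarrow> commutes_T k x"
proof -
  have k': "k \<in> {1..r}" "k + 1 \<in> {1..r}" using k by auto
  have closed: "M.gact x (T k) \<in> tensor_space r" "F x \<in> tensor_space r" "N.gact (F x) (T k) \<in> tensor_space r"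
    using k x by (auto intro!: M.gact_closed N.gact_closed F_closed)
  have closed_X: "M.gact x (X i) \<in> tensor_space r" "M.gact (M.gact x (T k)) (X i) \<in> tensor_space r"
    if "i \<in> {1..r}" for i
    using that x closed by (auto intro!: M.gact_closed)
  have "\<exists>j' \<in> {1..r}. \<exists>d. F (M.gact (M.gact x (X j)) (T k)) = N.gact (F (M.gact x (T k))) (X j') + d \<and>
      N.gact (F (M.gact x (X j))) (T k) = N.gact (N.gact (F x) (T k)) (X j') + d"
  proof -
    consider (eq) "j = k" | (Suc) "j = k + 1" | (other) "j \<noteq> k" "j \<noteq> k + 1" by blast
    then show ?thesis
    proof cases
      case eq
      let ?d = "- scale (v^2 - 1) (N.gact (F x) (X (k + 1)))"
      have "F (M.gact (M.gact x (X k)) (T k)) = N.gact (F (M.gact x (T k))) (X (k + 1)) + ?d"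
        "N.gact (F (M.gact x (X k))) (T k) = N.gact (N.gact (F x) (T k)) (X (k + 1)) + ?d"
        unfolding M.X_T[OF x k] F_X[OF x k'(1)] N.X_T[OF closed(2) k]
        using x k' closed closed_X by (simp_all only: F_X F_diff F_scale tensor_space_closed) (rule diff_conv_add_uminus)+
      then show ?thesis using k'(2) unfolding eq by blast
    next
      case Suc
      let ?d = "scale (v^2 - 1) (N.gact (F x) (X (k + 1)))"
      have "M.gact (M.gact x (X (k + 1))) (T k) = M.gact (M.gact x (T k)) (X k) + scale (v^2 - 1) (M.gact x (X (k + 1)))"
        "N.gact (N.gact (F x) (X (k + 1))) (T k) = N.gact (N.gact (F x) (T k)) (X k) + ?d"
        unfolding M.T_X[OF x k] N.T_X[OF closed(2) k] by (simp_all only: diff_add_cancel)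
      then have "F (M.gact (M.gact x (X (k + 1))) (T k)) = N.gact (F (M.gact x (T k))) (X k) + ?d"
        "N.gact (F (M.gact x (X (k + 1)))) (T k) = N.gact (N.gact (F x) (T k)) (X k) + ?d"
        using x k' closed closed_X by (simp_all only: F_X F_add F_scale tensor_space_closed)
      then show ?thesis using k'(1) unfolding Suc by blast
    next
      case other
      have "F (M.gact (M.gact x (X j)) (T k)) = N.gact (F (M.gact x (T k))) (X j) + 0"
        "N.gact (F (M.gact x (X j))) (T k) = N.gact (N.gact (F x) (T k)) (X j) + 0"
        unfolding F_X[OF x j] M.X_T_commute[OF x k j other] N.X_T_commute[OF closed(2) k j other]
        using closed j by (simp_all only: F_X add_0_right)
      then show ?thesis using j by blast
    qed
  qed
  then obtain j' d where j': "j' \<in> {1..r}"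
    and FT: "F (M.gact (M.gact x (X j)) (T k)) = N.gact (F (M.gact x (T k))) (X j') + d"
      "N.gact (F (M.gact x (X j))) (T k) = N.gact (N.gact (F x) (T k)) (X j') + d" by blast
  show ?thesis
    unfolding FT add_right_cancel
    using N.X_cancel[OF F_closed[OF closed(1)] closed(3) j'] by metis
qed

lemma commutes_T_shift:
  assumes k: "k \<in> {1..<r}" and i: "length i = r" and t: "t < r" and good: "commutes_T k (\<omega> i)"
  shows "commutes_T k (\<omega> (i[t := i ! t + q * int m]))"
proof (induction q rule: int_induct[where k = 0])
  case base
  then show ?case using good by simp
next
  case (step1 q)
  let ?i = "i[t := i ! t + q * int m]"
  let ?j = "i[t := i ! t + (q + 1) * int m]"
  have "M.gact (\<omega> ?j) (X (t + 1)) = \<omega> ?i"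
    using M.X_shift[of ?j "t + 1"] i t by (simp add: algebra_simps)
  then show ?case using commutes_T_X_iff[of "\<omega> ?j" k "t + 1"] step1 i t k by (simp add: tensor_space_closed)
next
  case (step2 q)
  let ?i = "i[t := i ! t + q * int m]"
  have "M.gact (\<omega> ?i) (X (t + 1)) = \<omega> (i[t := i ! t + (q - 1) * int m])"
    using M.X_shift[of ?i "t + 1"] i t by (simp add: algebra_simps)
  then show ?case using commutes_T_X_iff[of "\<omega> ?i" k "t + 1"] step2 i t k by (simp add: tensor_space_closed)
qed

text \<open>A list is brought into the fundamental domain \<open>{1..m}\<close> by shifting one entry after the other by a multiple
  of \<open>m\<close>, that is by applying powers of the \<open>X\<^sub>j\<close>.\<close>

lemma F_T_basis:
  assumes k: "k \<in> {1..<r}"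
  shows "length i = r \<Longrightarrow> commutes_T k (\<omega> i)"
proof (induction "card {t. t < r \<and> i ! t \<notin> {1..int m}}" arbitrary: i rule: less_induct)
  case less
  show ?case
  proof (cases "set i \<subseteq> {1..int m}")
    case True
    then show ?thesis using F_T_fundamental[OF less.prems _ k] by simp
  next
    case False
    then obtain t where t: "t < r" "i ! t \<notin> {1..int m}" using less.prems by (metis in_set_conv_nth subsetI)
    define z where "z = (i ! t - 1) mod int m + 1"
    have "0 < int m" using m_pos by simp
    then have z: "z \<in> {1..int m}" "i ! t = z + ((i ! t - 1) div int m) * int m"
      using pos_mod_bound[of "int m" "i ! t - 1"] pos_mod_sign[of "int m" "i ! t - 1"]
        div_mult_mod_eq[of "i ! t - 1" "int m"]
      unfolding z_def atLeastAtMost_iff by linarith+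
    let ?i = "i[t := z]"
    have "{s. s < r \<and> ?i ! s \<notin> {1..int m}} \<subset> {s. s < r \<and> i ! s \<notin> {1..int m}}"
      using t z less.prems by (auto simp: nth_list_update)
    then have "card {s. s < r \<and> ?i ! s \<notin> {1..int m}} < card {s. s < r \<and> i ! s \<notin> {1..int m}}"
      by (intro psubset_card_mono) auto
    then have "commutes_T k (\<omega> ?i)" using less.prems by (intro less.hyps) auto
    then have "commutes_T k (\<omega> (?i[t := ?i ! t + ((i ! t - 1) div int m) * int m]))"
      using k t less.prems by (intro commutes_T_shift) auto
    moreover have "?i[t := ?i ! t + ((i ! t - 1) div int m) * int m] = i"
      using t less.prems z(2)[symmetric] by simp
    ultimately show ?thesis by simp
  qed
qed

lemma commutes_gen:
  assumes g: "g \<in> hecke_gens r" and x: "x \<in> tensor_space r"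
  shows "F (M.gact x g) = N.gact (F x) g"
proof (cases g)
  case (T k)
  with g have k: "k \<in> {1..<r}" by simp
  show ?thesis
    unfolding T by (rule commute_on_basis[OF _ x F_T_basis[OF k]]) (use k in simp_all)
next
  case (X j)
  with g have "j \<in> {1..r}" by simp
  then show ?thesis unfolding X by (rule F_X[OF x])
next
  case (Xinv j)
  with g have "j \<in> {1..r}" by simp
  then show ?thesis unfolding Xinv by (rule F_Xinv[OF x])
qed

lemma commutes_word:
  assumes "set w \<subseteq> hecke_gens r" "x \<in> tensor_space r"
  shows "F (M.wact x (basis w)) = N.wact (F x) (basis w)"
  using assms
proof (induct w arbitrary: x)
  case Nil
  show ?case unfolding M.wact_Nil[OF Nil(2)] N.wact_Nil[OF F_closed[OF Nil(2)]] by (rule refl)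
next
  case (Cons g w)
  have g: "g \<in> hecke_gens r" and w: "set w \<subseteq> hecke_gens r" using Cons(2) by simp_all
  have x: "x \<in> tensor_space r" by (rule Cons(3))
  show ?case
    unfolding M.wact_Cons[OF x Cons(2)] N.wact_Cons[OF F_closed[OF x] Cons(2)] commutes_gen[OF g x, symmetric]
    by (rule Cons(1)[OF w M.gact_closed[OF x g]])
qed

text \<open>The generators generate the Hecke algebra, so commutation with each of them is enough.\<close>

theorem commutes:
  assumes x: "x \<in> tensor_space r" and h: "h \<in> carrier (hecke r)"
  shows "F (act x h) = act' (F x) h"
proof -
  obtain p where p: "p \<in> carrier (free_hecke r)" "h = hecke_class r p" using h unfolding carrier_hecke by (rule imageE)
  note Fx = F_closed[OF x]
  have "p \<in> carrier (free_hecke r) \<and> F (M.wact x p) = N.wact (F x) p"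
    using p(1)[unfolded free_hecke_simps mem_Collect_eq]
  proof (induction rule: poly_mapping_span_induct)
    case zero
    have z: "0 \<in> carrier (free_hecke r)" by (simp add: free_hecke_simps)
    have "M.wact x 0 = 0" using M.wact_add[OF x z z] by simp
    moreover have "N.wact (F x) 0 = 0" using N.wact_add[OF Fx z z] by simp
    ultimately show ?case using z by (simp add: F_zero)
  next
    case (single w c)
    then have w: "set w \<subseteq> hecke_gens r" by auto
    have "F (M.wact x (scale c (basis w))) = N.wact (F x) (scale c (basis w))"
      using w x Fx
      by (simp add: M.wact_scale N.wact_scale free_hecke_closed commutes_word F_scale M.act_closed hecke_class_closed del: scale_simps)
    then show ?case using w by (simp add: free_hecke_closed)
  next
    case (add p q)
    then show ?case using x Fx
      by (simp add: M.wact_add N.wact_add free_hecke_closed F_add M.act_closed hecke_class_closed)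
  qed
  then show ?thesis using p by simp
qed

end

section \<open>The Schur algebra as an endomorphism algebra\<close>

definition intertwines ::
  "nat \<Rightarrow> (tens \<Rightarrow> hecke_elt \<Rightarrow> tens) \<Rightarrow> (tens \<Rightarrow> hecke_elt \<Rightarrow> tens) \<Rightarrow> (tens \<Rightarrow> tens) \<Rightarrow> bool" where
  "intertwines r act act' F \<longleftrightarrow>
     (\<forall>x \<in> tensor_space r. F x \<in> tensor_space r) \<and>
     (\<forall>x \<in> tensor_space r. \<forall>y \<in> tensor_space r. F (x + y) = F x + F y) \<and>
     (\<forall>z. \<forall>x \<in> tensor_space r. F (scale z x) = scale z (F x)) \<and>
     (\<forall>h \<in> carrier (hecke r). \<forall>x \<in> tensor_space r. F (act x h) = act' (F x) h)"

lemma (in tensor_space_map) intertwines: "intertwines r act act' F"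
  unfolding intertwines_def using F_closed F_add F_scale commutes by blast

lemma intertwines_comp:
  "intertwines r act' act'' G \<Longrightarrow> intertwines r act act' F \<Longrightarrow> intertwines r act act'' (\<lambda>x. G (F x))"
  unfolding intertwines_def by simp

lemma intertwinesD:
  assumes "intertwines r act act' F"
  shows "x \<in> tensor_space r \<Longrightarrow> F x \<in> tensor_space r"
    "x \<in> tensor_space r \<Longrightarrow> y \<in> tensor_space r \<Longrightarrow> F (x + y) = F x + F y"
    "x \<in> tensor_space r \<Longrightarrow> F (scale z x) = scale z (F x)"
    "x \<in> tensor_space r \<Longrightarrow> h \<in> carrier (hecke r) \<Longrightarrow> F (act x h) = act' (F x) h"
  using assms by (auto simp: intertwines_def)

lemma schur_carrier_iff:
  "f \<in> carrier (schur r act) \<longleftrightarrow> intertwines r act act f \<and> f \<in> extensional (tensor_space r)"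
  unfolding schur_def intertwines_def PiE_def Pi_def by auto

lemma schur_simps:
  "\<one>\<^bsub>schur r act\<^esub> = (\<lambda>x \<in> tensor_space r. x)"
  "\<zero>\<^bsub>schur r act\<^esub> = (\<lambda>x \<in> tensor_space r. 0)"
  "f \<otimes>\<^bsub>schur r act\<^esub> g = (\<lambda>x \<in> tensor_space r. f (g x))"
  "f \<oplus>\<^bsub>schur r act\<^esub> g = (\<lambda>x \<in> tensor_space r. f x + g x)"
  "z \<odot>\<^bsub>schur r act\<^esub> f = (\<lambda>x \<in> tensor_space r. scale z (f x))"
  by (simp_all add: schur_def compose_def)

lemma schur_eqI:
  assumes "f \<in> extensional (tensor_space r)" "g \<in> extensional (tensor_space r)"
    and "\<And>x. x \<in> tensor_space r \<Longrightarrow> f x = g x"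
  shows "f = g"
  using assms by (rule extensionalityI)

context affine_tensor_module
begin


lemma restrict_in_schur: "intertwines r act act F \<Longrightarrow> restrict F (tensor_space r) \<in> carrier (schur r act)"
  unfolding schur_carrier_iff intertwines_def by (simp add: tensor_space_closed act_closed)

lemma intertwines_lincomb:
  assumes F: "intertwines r act act F" and G: "intertwines r act act G"
  shows "intertwines r act act (\<lambda>x. scale c (F x) + scale d (G x))"
  using intertwinesD[OF F] intertwinesD[OF G]
  by (simp add: intertwines_def tensor_space_closed scale_add act_add_left act_scale_left mult.commute add_ac)

lemma intertwines_zero: "intertwines r act act (\<lambda>x. 0)"
proof -
  have "act 0 h = 0" if "h \<in> carrier (hecke r)" for h
    using act_scale_left[of 0 h 0] that tensor_space_closed by simp
  then show ?thesis by (simp add: intertwines_def tensor_space_closed)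
qed

lemma intertwines_id: "intertwines r act act (\<lambda>x. x)"
  by (simp add: intertwines_def)

lemma algebra_over_schur: "algebra_over (schur r act)"
proof -
  let ?S = "schur r act"
  note S = schur_simps and iff = schur_carrier_iff
  have val: "f x \<in> tensor_space r" if "f \<in> carrier ?S" "x \<in> tensor_space r" for f x
    using that by (auto simp: iff dest: intertwinesD)
  have lin: "f (x + y) = f x + f y" "f (scale z x) = scale z (f x)"
    if "f \<in> carrier ?S" "x \<in> tensor_space r" "y \<in> tensor_space r" for f x y z
    using that by (auto simp: iff dest: intertwinesD)
  have add: "f \<oplus>\<^bsub>?S\<^esub> g \<in> carrier ?S" if "f \<in> carrier ?S" "g \<in> carrier ?S" for f g
    unfolding S using intertwines_lincomb[of f g 1 1] that by (intro restrict_in_schur) (simp add: iff)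
  have smult: "z \<odot>\<^bsub>?S\<^esub> f \<in> carrier ?S" if "f \<in> carrier ?S" for z f
    unfolding S using intertwines_lincomb[of f f z 0] that by (intro restrict_in_schur) (simp add: iff)
  have neg: "(\<lambda>x \<in> tensor_space r. - f x) \<in> carrier ?S" if "f \<in> carrier ?S" for f
  proof -
    have "scale (- 1) x = - x" for x :: tens
      using scale_diff(1)[of 0 1 x] by simp
    then show ?thesis
      using intertwines_lincomb[of f f "- 1" 0] that by (intro restrict_in_schur) (simp add: iff)
  qed
  have abelian: "abelian_group ?S"
  proof (rule abelian_groupI)
    fix f assume f: "f \<in> carrier ?S"
    show "\<exists>g\<in>carrier ?S. g \<oplus>\<^bsub>?S\<^esub> f = \<zero>\<^bsub>?S\<^esub>"
      by (rule bexI[OF _ neg[OF f]]) (simp add: S cong: restrict_cong)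
    show "\<zero>\<^bsub>?S\<^esub> \<oplus>\<^bsub>?S\<^esub> f = f"
      by (rule schur_eqI[where r = r]) (use f in \<open>auto simp: S iff\<close>)
    fix g assume g: "g \<in> carrier ?S"
    show "f \<oplus>\<^bsub>?S\<^esub> g \<in> carrier ?S" using f g by (rule add)
    show "f \<oplus>\<^bsub>?S\<^esub> g = g \<oplus>\<^bsub>?S\<^esub> f" unfolding S by (rule restrict_ext) (rule add.commute)
    fix h
    show "f \<oplus>\<^bsub>?S\<^esub> g \<oplus>\<^bsub>?S\<^esub> h = f \<oplus>\<^bsub>?S\<^esub> (g \<oplus>\<^bsub>?S\<^esub> h)"
      unfolding S by (rule restrict_ext) (simp add: add.assoc)
  next
    show "\<zero>\<^bsub>?S\<^esub> \<in> carrier ?S" unfolding S by (rule restrict_in_schur[OF intertwines_zero])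
  qed
  have monoid: "monoid ?S"
  proof (rule monoidI)
    fix f g assume fg: "f \<in> carrier ?S" "g \<in> carrier ?S"
    then show "f \<otimes>\<^bsub>?S\<^esub> g \<in> carrier ?S"
      unfolding S iff using intertwines_comp[of r act act f act g]
      by (intro conjI restrict_in_schur[unfolded iff, THEN conjunct1]) simp_all
    fix h assume h: "h \<in> carrier ?S"
    show "f \<otimes>\<^bsub>?S\<^esub> g \<otimes>\<^bsub>?S\<^esub> h = f \<otimes>\<^bsub>?S\<^esub> (g \<otimes>\<^bsub>?S\<^esub> h)"
      unfolding S by (rule restrict_ext) (simp add: val[OF h])
  next
    show "\<one>\<^bsub>?S\<^esub> \<in> carrier ?S" unfolding S by (rule restrict_in_schur[OF intertwines_id])
  next
    fix f assume f: "f \<in> carrier ?S"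
    show "\<one>\<^bsub>?S\<^esub> \<otimes>\<^bsub>?S\<^esub> f = f"
      by (rule schur_eqI[where r = r]) (use f val[OF f] in \<open>auto simp: S iff\<close>)
    show "f \<otimes>\<^bsub>?S\<^esub> \<one>\<^bsub>?S\<^esub> = f"
      by (rule schur_eqI[where r = r]) (use f in \<open>auto simp: S iff\<close>)
  qed
  have ring: "ring ?S"
  proof (rule ringI[OF abelian monoid])
    fix f g h assume f: "f \<in> carrier ?S" and g: "g \<in> carrier ?S" and h: "h \<in> carrier ?S"
    show "(f \<oplus>\<^bsub>?S\<^esub> g) \<otimes>\<^bsub>?S\<^esub> h = f \<otimes>\<^bsub>?S\<^esub> h \<oplus>\<^bsub>?S\<^esub> g \<otimes>\<^bsub>?S\<^esub> h"
      unfolding S by (rule restrict_ext) (simp add: val[OF h])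
    show "h \<otimes>\<^bsub>?S\<^esub> (f \<oplus>\<^bsub>?S\<^esub> g) = h \<otimes>\<^bsub>?S\<^esub> f \<oplus>\<^bsub>?S\<^esub> h \<otimes>\<^bsub>?S\<^esub> g"
      unfolding S by (rule restrict_ext) (simp add: lin(1)[OF h] val[OF f] val[OF g])
  qed
  show ?thesis
  proof (intro algebra_over.intro ring algebra_over_axioms.intro smult)
    fix f g z assume f: "f \<in> carrier ?S" and g: "g \<in> carrier ?S"
    show "(z \<odot>\<^bsub>?S\<^esub> f) \<otimes>\<^bsub>?S\<^esub> g = z \<odot>\<^bsub>?S\<^esub> (f \<otimes>\<^bsub>?S\<^esub> g)"
      unfolding S by (rule restrict_ext) (simp add: val[OF g])
    show "f \<otimes>\<^bsub>?S\<^esub> (z \<odot>\<^bsub>?S\<^esub> g) = z \<odot>\<^bsub>?S\<^esub> (f \<otimes>\<^bsub>?S\<^esub> g)"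
      unfolding S by (rule restrict_ext) (simp add: lin(2)[OF f] val[OF g])
  qed
qed

lemma finsum_schur_apply:
  assumes "finite S" "F \<in> S \<rightarrow> carrier (schur r act)" "x \<in> tensor_space r"
  shows "finsum (schur r act) F S x = (\<Sum>s\<in>S. F s x)"
proof -
  interpret A: algebra_over "schur r act" by (rule algebra_over_schur)
  show ?thesis using assms(1,2)
  proof (induction S)
    case empty
    then show ?case using assms(3) by (simp add: schur_simps)
  next
    case (insert s S)
    then show ?case using assms(3) by (simp add: A.finsum_insert Pi_iff schur_simps)
  qed
qed

end

section \<open>Relabelling maps between tensor spaces\<close>

text \<open>The representative of \<open>z\<close> modulo \<open>m\<close> in \<open>{1..m}\<close>, the index set of the fundamental domain.\<close>

definition residue :: "nat \<Rightarrow> int \<Rightarrow> int" where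
  "residue m z = (z - 1) mod int m + 1"

text \<open>The extension of \<open>g\<close> from \<open>{1..m}\<close> to the integers with \<open>z + m \<mapsto> g z + n\<close>.\<close>

definition periodic :: "nat \<Rightarrow> nat \<Rightarrow> (int \<Rightarrow> int) \<Rightarrow> int \<Rightarrow> int" where
  "periodic m n g z = g (residue m z) + ((z - 1) div int m) * int n"

definition residues :: "nat \<Rightarrow> int list \<Rightarrow> int multiset" where
  "residues m i = mset (map (residue m) i)"

text \<open>Lists are relabelled entry by entry, and those that violate \<open>Q\<close> are killed. The condition
  depends on the multiset of residues only, since this is what shifts and swaps preserve.\<close>

definition relab :: "nat \<Rightarrow> nat \<Rightarrow> (int multiset \<Rightarrow> bool) \<Rightarrow> (int \<Rightarrow> int) \<Rightarrow> tens \<Rightarrow> tens" where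
  "relab m n Q g = lin_ext (\<lambda>i. if Q (residues m i) then \<omega> (map (periodic m n g) i) else 0)"

lemma residue_bounds:
  assumes "0 < m" shows "residue m z \<in> {1..int m}"
proof -
  have "0 < int m" using assms by simp
  then show ?thesis
    using pos_mod_bound[of "int m" "z - 1"] pos_mod_sign[of "int m" "z - 1"]
    unfolding residue_def atLeastAtMost_iff by linarith
qed

lemma residue_fundamental: "z \<in> {1..int m} \<Longrightarrow> residue m z = z"
  by (simp add: residue_def)

lemma residue_shift: "residue m (z + q * int m) = residue m z"
proof -
  have "z + q * int m - 1 = (z - 1) + q * int m" by simp
  then show ?thesis unfolding residue_def by (simp only: mod_mult_self1)
qed

lemma periodic_shift: "0 < m \<Longrightarrow> periodic m n g (z + int m) = periodic m n g z + int n"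
proof -
  assume "0 < m"
  then have "(z + int m - 1) div int m = (z - 1) div int m + 1"
    using div_mult_self1[of "int m" "z - 1" 1] by (simp add: algebra_simps)
  then show ?thesis using residue_shift[of m z 1] by (simp add: periodic_def algebra_simps)
qed

lemma periodic_fundamental: "z \<in> {1..int m} \<Longrightarrow> periodic m n g z = g z"
  by (simp add: periodic_def residue_fundamental)

lemma residue_periodic: "g (residue m z) \<in> {1..int n} \<Longrightarrow> residue n (periodic m n g z) = g (residue m z)"
  unfolding periodic_def residue_shift by (rule residue_fundamental)

lemma periodic_periodic:
  assumes "0 < n" "g (residue m z) \<in> {1..int n}"
  shows "periodic n p g' (periodic m n g z) = periodic m p (\<lambda>z. g' (g z)) z"
proof -
  have "(periodic m n g z - 1) div int n = (g (residue m z) - 1 + (z - 1) div int m * int n) div int n"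
    by (simp add: periodic_def algebra_simps)
  also have "\<dots> = (z - 1) div int m" using assms by simp
  finally show ?thesis by (simp add: periodic_def[of n p] residue_periodic[of g, OF assms(2)]) (simp add: periodic_def)
qed

lemma periodic_id:
  assumes "g (residue m z) = residue m z" shows "periodic m m g z = z"
  using assms by (simp add: periodic_def) (simp add: residue_def)

lemma set_residues: "set_mset (residues m i) = residue m ` set i"
  by (simp add: residues_def)

lemma residues_shift:
  assumes "t < length i"
  shows "residues m (i[t := i ! t + int m]) = residues m i"
proof -
  have "map (residue m) (i[t := i ! t + int m]) = (map (residue m) i)[t := map (residue m) i ! t]"
    using residue_shift[of m "i ! t" 1] assms by (simp only: map_update nth_map mult_1)
  then show ?thesis by (simp only: residues_def list_update_id)
qed

lemma mset_swap:
  assumes "k \<in> {1..<length i}" shows "mset (swap k i) = mset i"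
proof -
  have "k - 1 < length i" "k < length i" using assms by auto
  then show ?thesis unfolding swap_def by (intro mset_swap)
qed

lemma residues_swap: "k \<in> {1..<length i} \<Longrightarrow> residues m (swap k i) = residues m i"
  by (simp add: residues_def mset_swap)

lemma map_swap:
  assumes "k \<in> {1..<length i}" shows "map f (swap k i) = swap k (map f i)"
proof -
  have "k - 1 < length i" "k < length i" using assms by auto
  then show ?thesis by (simp add: swap_def map_update)
qed

lemma relab_basis: "relab m n Q g (\<omega> i) = (if Q (residues m i) then \<omega> (map (periodic m n g) i) else 0)"
  by (simp add: relab_def)

lemma relab_relab:
  assumes "0 < n" and g: "\<And>i. Q (residues m i) \<Longrightarrow> g ` residue m ` set i \<subseteq> {1..int n}"
  shows "relab n p Q' g' (relab m n Q g x) =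
    lin_ext (\<lambda>i. if Q (residues m i) \<and> Q' (image_mset g (residues m i)) then \<omega> (map (periodic m p (\<lambda>z. g' (g z))) i) else 0) x"
  unfolding relab_def lin_ext_lin_ext
proof (intro lin_ext_cong)
  fix i
  show "lin_ext (\<lambda>i. if Q' (residues n i) then \<omega> (map (periodic n p g') i) else 0)
      (if Q (residues m i) then \<omega> (map (periodic m n g) i) else 0) =
    (if Q (residues m i) \<and> Q' (image_mset g (residues m i)) then \<omega> (map (periodic m p (\<lambda>z. g' (g z))) i) else 0)"
  proof (cases "Q (residues m i)")
    case True
    have gi: "g (residue m z) \<in> {1..int n}" if "z \<in> set i" for z using g[OF True] that by blast
    have "residues n (map (periodic m n g) i) = image_mset g (residues m i)"
      unfolding residues_def by (simp add: image_mset.compositionality) 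
        (auto intro!: image_mset_cong simp: residue_periodic[of g, OF gi])
    moreover have "map (periodic n p g') (map (periodic m n g) i) = map (periodic m p (\<lambda>z. g' (g z))) i"
      using gi by (simp add: periodic_periodic[of n g, OF assms(1)])
    ultimately show ?thesis using True by (simp del: map_map map_eq_conv)
  qed simp
qed

text \<open>On the fundamental domain the formula for \<open>T\<^sub>k\<close> depends on the order of the entries \<open>k\<close> and \<open>k + 1\<close> only,
  which is preserved if \<open>g\<close> is strictly increasing on the residues that occur.\<close>

lemma tensor_space_map_relab:
  assumes M: "affine_tensor_module m r act" and N: "affine_tensor_module n r act'" and m: "0 < m"
    and mono: "\<And>i. \<lbrakk>length i = r; Q (residues m i)\<rbrakk> \<Longrightarrow> strict_mono_on (residue m ` set i) g"
    and range: "\<And>i. \<lbrakk>length i = r; Q (residues m i)\<rbrakk> \<Longrightarrow> g ` residue m ` set i \<subseteq> {1..int n}"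
  shows "tensor_space_map m n r act act' (relab m n Q g)"
proof -
  interpret M: affine_tensor_module m r act by fact
  interpret N: affine_tensor_module n r act' by fact
  have zero: "act' 0 h = 0" if "h \<in> carrier (hecke r)" for h
    using N.act_scale_left[of 0 h 0] that tensor_space_closed by simp
  show ?thesis
  proof unfold_locales
    fix x assume "x \<in> tensor_space r"
    then show "relab m n Q g x \<in> tensor_space r"
      unfolding relab_def tensor_space_def mem_Collect_eq by (intro keys_lin_ext) auto
  next
    fix i :: "int list" and j assume i: "length i = r" and j: "j \<in> {1..r}"
    then have t: "j - 1 < length i" by auto
    have "map (periodic m n g) (i[j - 1 := i ! (j - 1) + int m]) =
        (map (periodic m n g) i)[j - 1 := map (periodic m n g) i ! (j - 1) + int n]"
      using t m by (simp add: map_update periodic_shift)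
    then show "relab m n Q g (act (\<omega> i) (hgen r (Xinv j))) = act' (relab m n Q g (\<omega> i)) (hgen r (Xinv j))"
      unfolding M.act_Xinv[OF i j] relab_basis residues_shift[OF t]
      using i j N.act_Xinv[of "map (periodic m n g) i" j] by (simp add: zero)
  next
    fix i :: "int list" and k assume i: "length i = r" and fund: "set i \<subseteq> {1..int m}" and k: "k \<in> {1..<r}"
    have k': "k \<in> {1..<length i}" using i k by simp
    let ?j = "map (periodic m n g) i"
    note lin = lin_ext_add lin_ext_scale
    show "relab m n Q g (act (\<omega> i) (hgen r (T k))) = act' (relab m n Q g (\<omega> i)) (hgen r (T k))"
    proof (cases "Q (residues m i)")
      case True
      have res: "residue m ` set i = set i" using fund by (force simp: residue_fundamental)
      have per: "?j = map g i" using fund by (auto simp: periodic_fundamental subset_iff)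
      have set_j: "set ?j \<subseteq> {1..int n}" using range[OF i True] unfolding per res by auto
      have "strict_mono_on (set i) g" using mono[OF i True] res by simp
      moreover have "i ! (k - 1) \<in> set i" "i ! k \<in> set i" using k' by auto
      ultimately have order: "?j ! (k - 1) = ?j ! k \<longleftrightarrow> i ! (k - 1) = i ! k" "?j ! (k - 1) < ?j ! k \<longleftrightarrow> i ! (k - 1) < i ! k"
        using k' unfolding per by (auto simp: strict_mono_on_eq strict_mono_on_less)
      have j: "length ?j = r" using i by simp
      show ?thesis
        unfolding M.act_T[OF i fund k] relab_basis if_P[OF True] N.act_T[OF j set_j k] order
        using True by (simp add: relab_def lin residues_swap[OF k'] map_swap[OF k'])
    next
      case False
      then show ?thesis
        unfolding M.act_T[OF i fund k] relab_basis if_not_P[OF False]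
        using k by (simp add: relab_def lin residues_swap[OF k'] zero)
    qed
  qed (use m in \<open>simp_all add: relab_def lin_ext_add lin_ext_scale\<close>)
qed

section \<open>The idempotent\<close>

lemma finite_compositions: "finite (compositions n r)"
proof (rule finite_subset)
  show "compositions n r \<subseteq> {\<mu>. set \<mu> \<subseteq> {..r} \<and> length \<mu> = n}"
    using member_le_sum_list by (fastforce simp: compositions_def)
  show "finite {\<mu>. set \<mu> \<subseteq> {..r} \<and> length \<mu> = n}" by (rule finite_lists_length_eq) simp
qed

lemma residue_eq_iff:
  assumes "0 < m" "j \<in> {1..m}"
  shows "residue m z = int j \<longleftrightarrow> z mod int m = int j mod int m"
proof -
  have "residue m z = int j \<longleftrightarrow> (z - 1) mod int m = (int j - 1) mod int m"
    using assms by (auto simp: residue_def)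
  also have "\<dots> \<longleftrightarrow> z mod int m = int j mod int m"
    by (simp add: mod_eq_dvd_iff)
  finally show ?thesis .
qed

text \<open>Rewrites the weight of a list, as it occurs in the definition of the weight idempotents, as a multiplicity.
  The positions there are numbered from \<open>1\<close>.\<close>

lemma card_residue_class:
  assumes "0 < m" "j \<in> {1..m}" "length i = r"
  shows "card {t \<in> {1..r}. i ! (t - 1) mod int m = int j mod int m} = count (residues m i) (int j)"
proof -
  have "count (residues m i) (int j) = length (filter (\<lambda>z. residue m z = int j) i)"
    by (induction i) (auto simp: residues_def)
  also have "\<dots> = card {t. t < r \<and> residue m (i ! t) = int j}"
    unfolding length_filter_conv_card assms(3) ..
  also have "\<dots> = card {t \<in> {1..r}. i ! (t - 1) mod int m = int j mod int m}"
  proof (rule bij_betw_same_card[of Suc])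
    show "bij_betw Suc {t. t < r \<and> residue m (i ! t) = int j} {t \<in> {1..r}. i ! (t - 1) mod int m = int j mod int m}"
      unfolding residue_eq_iff[OF assms(1,2)]
      by (rule bij_betwI[where g = "\<lambda>t. t - 1"]) auto
  qed
  finally show ?thesis by simp
qed

lemma sum_count_residues:
  assumes "set_mset M \<subseteq> {1..int n}"
  shows "(\<Sum>j\<in>{1..n}. count M (int j)) = size M"
proof -
  have "(\<Sum>j\<in>{1..n}. count M (int j)) = (\<Sum>z\<in>{1..int n}. count M z)"
  proof (rule sum.reindex_bij_betw)
    show "bij_betw int {1..n} {1..int n}" by (rule bij_betwI[where g = nat]) auto
  qed
  also have "\<dots> = (\<Sum>z\<in>set_mset M. count M z)"
    using assms by (intro sum.mono_neutral_right) (auto simp: not_in_iff)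
  finally show ?thesis by (simp add: size_multiset_overloaded_eq)
qed

text \<open>The only candidate for a padded weight of \<open>i\<close> is the list of multiplicities of the residues
  \<open>1, \<dots>, n\<close>, and it has the right sum exactly if no other residues occur.\<close>

lemma sum_weight_indicators:
  assumes nN: "0 < n" "n \<le> N" and i: "length i = r"
  shows "(\<Sum>\<mu>\<in>compositions n r. if \<forall>j\<in>{1..N}. count (residues N i) (int j) = (\<mu> @ replicate (N - n) 0) ! (j - 1)
            then \<omega> i else 0)
    = (if set_mset (residues N i) \<subseteq> {1..int n} then \<omega> i else 0)"
proof -
  let ?M = "residues N i"
  let ?W = "\<lambda>\<mu>. \<forall>j\<in>{1..N}. count ?M (int j) = (\<mu> @ replicate (N - n) 0) ! (j - 1)"
  have bounds: "set_mset ?M \<subseteq> {1..int N}"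
    using nN residue_bounds[of N] by (auto simp: set_residues)
  have W_small: "set_mset ?M \<subseteq> {1..int n}" if mu: "\<mu> \<in> compositions n r" and W: "?W \<mu>" for \<mu>
  proof
    fix z assume z: "z \<in># ?M"
    then have zN: "z \<in> {1..int N}" using bounds by blast
    show "z \<in> {1..int n}"
    proof (rule ccontr)
      assume "z \<notin> {1..int n}"
      then have "nat z \<in> {1..N}" "n \<le> nat z - 1" "nat z - 1 < N" "int (nat z) = z" using zN by auto
      then have "count ?M z = 0"
        using bspec[OF W, of "nat z"] mu by (simp add: nth_append compositions_def)
      then have "z \<notin># ?M" by (simp only: not_in_iff)
      then show False using z by contradiction
    qed
  qed
  show ?thesis
  proof (cases "set_mset ?M \<subseteq> {1..int n}")
    case False
    have "(\<Sum>\<mu>\<in>compositions n r. if ?W \<mu> then \<omega> i else 0) = 0"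
    proof (rule sum.neutral, rule ballI)
      fix \<mu> assume "\<mu> \<in> compositions n r"
      then have "\<not> ?W \<mu>" using W_small False by blast
      then show "(if ?W \<mu> then \<omega> i else 0) = 0" by (rule if_not_P)
    qed
    then show ?thesis unfolding if_not_P[OF False] .
  next
    case True
    define \<nu> where "\<nu> = map (\<lambda>j. count ?M (int (Suc j))) [0..<n]"
    have "sum_list \<nu> = (\<Sum>j\<in>{1..n}. count ?M (int j))"
      unfolding \<nu>_def interv_sum_list_conv_sum_set_nat set_upt
    proof (rule sum.reindex_bij_betw)
      show "bij_betw Suc {0..<n} {1..n}" by (rule bij_betwI[where g = "\<lambda>t. t - 1"]) auto
    qed
    then have \<nu>: "\<nu> \<in> compositions n r"
      using sum_count_residues[OF True] i by (simp add: compositions_def \<nu>_def residues_def)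
    have W_iff: "?W \<mu> \<longleftrightarrow> \<mu> = \<nu>" if mu: "\<mu> \<in> compositions n r" for \<mu>
    proof
      assume W: "?W \<mu>"
      show "\<mu> = \<nu>"
      proof (rule nth_equalityI)
        show len: "length \<mu> = length \<nu>" using mu \<nu> by (simp add: compositions_def)
        fix k assume "k < length \<mu>"
        then show "\<mu> ! k = \<nu> ! k"
          using bspec[OF W, of "Suc k"] mu nN by (simp add: compositions_def \<nu>_def nth_append)
      qed
    next
      assume "\<mu> = \<nu>"
      moreover have "?W \<nu>"
      proof
        fix j assume j: "j \<in> {1..N}"
        show "count ?M (int j) = (\<nu> @ replicate (N - n) 0) ! (j - 1)"
        proof (cases "j \<le> n")
          case True
          then have "j - 1 < n" "Suc (j - 1) = j" using j by auto
          then show ?thesis by (simp add: nth_append \<nu>_def)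
        next
          case False
          then have "int j \<notin># ?M" using True by auto
          then have "count ?M (int j) = 0" by (simp add: not_in_iff)
          moreover have "j - 1 - n < N - n" "\<not> j - 1 < n" using False j by auto
          ultimately show ?thesis using False by (simp add: nth_append \<nu>_def)
        qed
      qed
      ultimately show "?W \<mu>" by simp
    qed
    have "(\<Sum>\<mu>\<in>compositions n r. if ?W \<mu> then \<omega> i else 0) = (\<Sum>\<mu>\<in>compositions n r. if \<mu> = \<nu> then \<omega> i else 0)"
      by (rule sum.cong[OF refl]) (simp only: W_iff)
    then show ?thesis using True \<nu> finite_compositions by simp
  qed
qed

section \<open>Supports and ranks\<close>

text \<open>The order isomorphism from \<open>A\<close> onto \<open>{1..card A}\<close>.\<close>

definition rank :: "int set \<Rightarrow> int \<Rightarrow> int" where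
  "rank A z = int (card {y \<in> A. y \<le> z})"

definition unrank :: "int set \<Rightarrow> int \<Rightarrow> int" where
  "unrank A = inv_into A (rank A)"

lemma strict_mono_rank:
  assumes "finite A" shows "strict_mono_on A (rank A)"
proof (rule strict_mono_onI)
  fix x y assume xy: "x \<in> A" "y \<in> A" "x < y"
  then have "y \<in> {z \<in> A. z \<le> y} - {z \<in> A. z \<le> x}" by simp
  moreover have "{z \<in> A. z \<le> x} \<subseteq> {z \<in> A. z \<le> y}" using xy by auto
  ultimately have "{z \<in> A. z \<le> x} \<subset> {z \<in> A. z \<le> y}" by blast
  then show "rank A x < rank A y" using assms by (simp add: rank_def psubset_card_mono)
qed

lemma rank_range:
  assumes "finite A" shows "rank A ` A \<subseteq> {1..int (card A)}"
proof
  fix z assume "z \<in> rank A ` A"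
  then obtain x where x: "x \<in> A" "z = rank A x" by auto
  have "card {x} \<le> card {y \<in> A. y \<le> x}" "card {y \<in> A. y \<le> x} \<le> card A"
    using assms x by (intro card_mono; auto)+
  then show "z \<in> {1..int (card A)}" by (simp add: x rank_def)
qed

lemma unrank_rank: "finite A \<Longrightarrow> z \<in> A \<Longrightarrow> unrank A (rank A z) = z"
  unfolding unrank_def by (rule inv_into_f_f[OF strict_mono_on_imp_inj_on[OF strict_mono_rank]])

lemma strict_mono_unrank:
  assumes "finite A" shows "strict_mono_on (rank A ` A) (unrank A)"
proof (rule strict_mono_onI)
  fix x y assume "x \<in> rank A ` A" "y \<in> rank A ` A" "x < y"
  then show "unrank A x < unrank A y"
    using strict_mono_on_less[OF strict_mono_rank[OF assms]] by (auto simp: unrank_rank[OF assms])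
qed

section \<open>The small Schur algebra as a full corner\<close>

locale corner_of_schur = n: affine_tensor_module n r act_n + N: affine_tensor_module N r act_N
  for n N r :: nat and act_n act_N :: "tens \<Rightarrow> hecke_elt \<Rightarrow> tens" +
  assumes n_pos: "0 < n" and n_le_N: "n \<le> N" and r_le_n: "r \<le> n"
begin

abbreviation \<Omega> :: "tens set" where "\<Omega> \<equiv> tensor_space r"

text \<open>\<open>inc\<close> identifies the small tensor space with \<open>e\<close> times the large one, and \<open>proj\<close> is its inverse, extended by
  zero. On lists with residue set \<open>A\<close>, \<open>down A\<close> compresses the residues to an initial segment of \<open>{1..n}\<close>, and
  \<open>up A\<close> undoes this.\<close>

definition inc :: "tens \<Rightarrow> tens" where "inc = relab n N (\<lambda>_. True) (\<lambda>z. z)"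
definition proj :: "tens \<Rightarrow> tens" where "proj = relab N n (\<lambda>M. set_mset M \<subseteq> {1..int n}) (\<lambda>z. z)"
definition down :: "int set \<Rightarrow> tens \<Rightarrow> tens" where "down A = relab N n (\<lambda>M. set_mset M = A) (rank A)"
definition up :: "int set \<Rightarrow> tens \<Rightarrow> tens" where "up A = relab n N (\<lambda>M. set_mset M = rank A ` A) (unrank A)"
definition supports :: "int set set" where "supports = {A. A \<subseteq> {1..int N} \<and> card A \<le> r}"

lemma N_pos: "0 < N" using n_pos n_le_N by simp

lemma finite_support: "A \<in> supports \<Longrightarrow> finite A"
  unfolding supports_def using finite_subset by blast

lemma finite_supports: "finite supports"
  unfolding supports_def by (rule finite_subset[of _ "Pow {1..int N}"]) auto

lemma residues_n: "residue n ` S \<subseteq> {1..int n}"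
  using residue_bounds[OF n_pos] by blast

lemma residues_N: "residue N ` S \<subseteq> {1..int N}"
  using residue_bounds[OF N_pos] by blast

lemma residues_n_N: "residue n ` S \<subseteq> {1..int N}"
  by (rule order_trans[OF residues_n]) (use n_le_N in auto)

lemma intertwines_inc: "intertwines r act_n act_N inc"
  unfolding inc_def
  by (rule tensor_space_map.intertwines[OF tensor_space_map_relab[OF n.affine_tensor_module_axioms N.affine_tensor_module_axioms n_pos]])
     (simp_all add: strict_mono_on_def residues_n_N)

lemma intertwines_proj: "intertwines r act_N act_n proj"
  unfolding proj_def
  by (rule tensor_space_map.intertwines[OF tensor_space_map_relab[OF N.affine_tensor_module_axioms n.affine_tensor_module_axioms N_pos]])
     (auto simp: strict_mono_on_def set_residues)

lemma intertwines_down: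
  assumes A: "A \<in> supports" shows "intertwines r act_N act_n (down A)"
proof -
  have "rank A ` A \<subseteq> {1..int n}"
    using rank_range[OF finite_support[OF A]] A r_le_n unfolding supports_def by force
  then show ?thesis
    unfolding down_def
    by (intro tensor_space_map.intertwines[OF tensor_space_map_relab[OF N.affine_tensor_module_axioms n.affine_tensor_module_axioms N_pos]])
       (use strict_mono_rank[OF finite_support[OF A]] in \<open>simp_all add: set_residues\<close>)
qed

lemma intertwines_up:
  assumes A: "A \<in> supports" shows "intertwines r act_n act_N (up A)"
proof -
  have "unrank A ` rank A ` A \<subseteq> {1..int N}"
    using unrank_rank[OF finite_support[OF A]] A unfolding supports_def by auto
  then show ?thesis
    unfolding up_def
    by (intro tensor_space_map.intertwines[OF tensor_space_map_relab[OF n.affine_tensor_module_axioms N.affine_tensor_module_axioms n_pos]])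
       (use strict_mono_unrank[OF finite_support[OF A]] in \<open>simp_all add: set_residues\<close>)
qed

lemma map_periodic_id:
  assumes "\<And>z. z \<in> residue m ` set i \<Longrightarrow> g z = z"
  shows "map (periodic m m g) i = i"
  by (rule map_idI) (simp add: assms periodic_id)

lemma proj_inc: "proj (inc x) = x"
proof -
  have "proj (inc x) = lin_ext (\<lambda>i. if True \<and> set_mset (image_mset (\<lambda>z. z) (residues n i)) \<subseteq> {1..int n}
      then \<omega> (map (periodic n n (\<lambda>z. z)) i) else 0) x"
    unfolding proj_def inc_def by (rule relab_relab[OF N_pos]) (simp add: residues_n_N)
  also have "\<dots> = lin_ext basis x"
    by (rule lin_ext_cong) (simp add: map_periodic_id set_residues residues_n)
  finally show ?thesis by simp
qed

lemma inc_proj: "inc (proj x) = lin_ext (\<lambda>i. if set_mset (residues N i) \<subseteq> {1..int n} then \<omega> i else 0) x"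
proof -
  have "inc (proj x) = lin_ext (\<lambda>i. if set_mset (residues N i) \<subseteq> {1..int n} \<and> True
      then \<omega> (map (periodic N N (\<lambda>z. z)) i) else 0) x"
    unfolding proj_def inc_def by (rule relab_relab[OF n_pos]) (auto simp: set_residues)
  then show ?thesis by (simp add: map_periodic_id cong: if_cong)
qed

lemma up_down:
  assumes A: "A \<in> supports"
  shows "up A (down A x) = lin_ext (\<lambda>i. if set_mset (residues N i) = A then \<omega> i else 0) x"
proof -
  have range: "rank A ` A \<subseteq> {1..int n}"
    using rank_range[OF finite_support[OF A]] A r_le_n unfolding supports_def by force
  have "up A (down A x) = lin_ext (\<lambda>i. if set_mset (residues N i) = A \<and> set_mset (image_mset (rank A) (residues N i)) = rank A ` A
      then \<omega> (map (periodic N N (\<lambda>z. unrank A (rank A z))) i) else 0) x"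
    unfolding up_def down_def by (rule relab_relab[OF n_pos]) (use range in \<open>auto simp: set_residues\<close>)
  also have "\<dots> = lin_ext (\<lambda>i. if set_mset (residues N i) = A then \<omega> i else 0) x"
  proof (rule lin_ext_cong)
    fix i
    have "map (periodic N N (\<lambda>z. unrank A (rank A z))) i = i" if "set_mset (residues N i) = A"
      by (rule map_periodic_id) (use that unrank_rank[OF finite_support[OF A]] in \<open>auto simp: set_residues\<close>)
    then show "(if set_mset (residues N i) = A \<and> set_mset (image_mset (rank A) (residues N i)) = rank A ` A
      then \<omega> (map (periodic N N (\<lambda>z. unrank A (rank A z))) i) else 0) = (if set_mset (residues N i) = A then \<omega> i else 0)"
      by simp
  qed
  finally show ?thesis .
qed

text \<open>The residue set of every list of length \<open>r\<close> has at most \<open>r\<close> elements, so it is a support, and exactly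
  one summand is nonzero on the corresponding basis vector.\<close>

lemma sum_up_down:
  assumes x: "x \<in> \<Omega>"
  shows "(\<Sum>A\<in>supports. up A (down A x)) = x"
proof -
  have "(\<Sum>A\<in>supports. up A (down A x)) = lin_ext (\<lambda>i. \<Sum>A\<in>supports. if set_mset (residues N i) = A then \<omega> i else 0) x"
    unfolding lin_ext_fun_sum by (intro sum.cong refl up_down)
  also have "\<dots> = lin_ext basis x"
  proof (rule lin_ext_cong)
    fix i assume "i \<in> Poly_Mapping.keys x"
    then have "length i = r" using x by (auto simp: tensor_space_def)
    then have "card (set_mset (residues N i)) \<le> r"
      unfolding set_residues using card_image_le[of "set i" "residue N"] card_length[of i] by simp
    then have "set_mset (residues N i) \<in> supports" unfolding supports_def using residues_N by (simp add: set_residues)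
    then show "(\<Sum>A\<in>supports. if set_mset (residues N i) = A then \<omega> i else 0) = \<omega> i"
      using finite_supports by simp
  qed
  finally show ?thesis by simp
qed

lemma relabel_tens_eq: "relabel_tens n N = inc"
proof -
  have "relabel n N = periodic n N (\<lambda>z. z)"
    by (rule ext) (simp add: relabel_def periodic_def residue_def)
  then show ?thesis unfolding relabel_tens_def inc_def relab_def by simp
qed

lemma weight_idem_eq:
  "weight_idem N r \<mu> = restrict (lin_ext (\<lambda>i. if \<forall>j\<in>{1..N}. count (residues N i) (int j) = \<mu> ! (j - 1) then \<omega> i else 0)) \<Omega>"
  unfolding weight_idem_def
proof (intro restrict_ext lin_ext_cong)
  fix x i assume "x \<in> \<Omega>" "i \<in> Poly_Mapping.keys x"
  then have "length i = r" by (auto simp: tensor_space_def)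
  then show "(if \<forall>j\<in>{1..N}. card {t \<in> {1..r}. i ! (t - 1) mod int N = int j mod int N} = \<mu> ! (j - 1) then \<omega> i else 0) =
     (if \<forall>j\<in>{1..N}. count (residues N i) (int j) = \<mu> ! (j - 1) then \<omega> i else 0)"
    using card_residue_class[OF N_pos] by simp
qed

text \<open>A weight idempotent is a relabelling that leaves all residues unchanged.\<close>

lemma weight_idem_in_schur: "weight_idem N r \<mu> \<in> carrier (schur r act_N)"
proof -
  have "lin_ext (\<lambda>i. if \<forall>j\<in>{1..N}. count (residues N i) (int j) = \<mu> ! (j - 1) then \<omega> i else 0)
      = relab N N (\<lambda>M. \<forall>j\<in>{1..N}. count M (int j) = \<mu> ! (j - 1)) (\<lambda>z. z)"
    unfolding relab_def map_periodic_id[of N _ "\<lambda>z. z", OF refl] by (rule refl)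
  moreover have "intertwines r act_N act_N (relab N N (\<lambda>M. \<forall>j\<in>{1..N}. count M (int j) = \<mu> ! (j - 1)) (\<lambda>z. z))"
    by (rule tensor_space_map.intertwines[OF tensor_space_map_relab[OF N.affine_tensor_module_axioms N.affine_tensor_module_axioms N_pos]])
       (simp_all add: strict_mono_on_def residues_N)
  ultimately show ?thesis unfolding weight_idem_eq by (simp only: N.restrict_in_schur)
qed

lemma corner_idem_eq: "corner_idem n N r act_N = (\<lambda>x \<in> \<Omega>. inc (proj x))"
proof (rule schur_eqI[where r = r])
  interpret S: algebra_over "schur r act_N" by (rule N.algebra_over_schur)
  have weights: "(\<lambda>\<mu>. weight_idem N r (\<mu> @ replicate (N - n) 0)) \<in> compositions n r \<rightarrow> carrier (schur r act_N)"
    using weight_idem_in_schur by blast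
  then have "corner_idem n N r act_N \<in> carrier (schur r act_N)"
    unfolding corner_idem_def by (rule S.finsum_closed)
  then show "corner_idem n N r act_N \<in> extensional \<Omega>" unfolding schur_carrier_iff by blast
  fix x assume x: "x \<in> \<Omega>"
  have "corner_idem n N r act_N x = (\<Sum>\<mu>\<in>compositions n r. weight_idem N r (\<mu> @ replicate (N - n) 0) x)"
    unfolding corner_idem_def by (rule N.finsum_schur_apply[OF finite_compositions weights x])
  also have "\<dots> = lin_ext (\<lambda>i. \<Sum>\<mu>\<in>compositions n r.
      if \<forall>j\<in>{1..N}. count (residues N i) (int j) = (\<mu> @ replicate (N - n) 0) ! (j - 1) then \<omega> i else 0) x"
    unfolding lin_ext_fun_sum weight_idem_eq using x by (intro sum.cong refl) (simp only: restrict_apply if_True)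
  also have "\<dots> = inc (proj x)"
    unfolding inc_proj
  proof (rule lin_ext_cong)
    fix i assume "i \<in> Poly_Mapping.keys x"
    then have "length i = r" using x by (auto simp: tensor_space_def)
    then show "(\<Sum>\<mu>\<in>compositions n r. if \<forall>j\<in>{1..N}. count (residues N i) (int j) = (\<mu> @ replicate (N - n) 0) ! (j - 1) then \<omega> i else 0)
        = (if set_mset (residues N i) \<subseteq> {1..int n} then \<omega> i else 0)"
      by (rule sum_weight_indicators[OF n_pos n_le_N])
  qed
  finally show "corner_idem n N r act_N x = (\<lambda>x \<in> \<Omega>. inc (proj x)) x" using x by simp
qed simp

lemmas inc_lin = intertwinesD[OF intertwines_inc]
lemmas proj_lin = intertwinesD[OF intertwines_proj]

text \<open>\<open>proj\<close> is the inverse of \<open>inc\<close> on its image, after projecting to this image with \<open>e\<close>.\<close>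

lemma corner_iso_eq: "corner_iso n N r act_N f = (\<lambda>x \<in> \<Omega>. inc (f (proj x)))"
  unfolding corner_iso_def relabel_tens_eq
proof (rule restrict_ext)
  fix x assume x: "x \<in> \<Omega>"
  have "inj_on inc \<Omega>" by (rule inj_on_inverseI[where g = proj]) (rule proj_inc)
  then have "inv_into \<Omega> inc (inc (proj x)) = proj x" by (rule inv_into_f_f) (rule proj_lin(1)[OF x])
  then show "inc (f (inv_into \<Omega> inc (corner_idem n N r act_N x))) = inc (f (proj x))"
    using x by (simp add: corner_idem_eq)
qed

text \<open>The maps \<open>f \<mapsto> inc \<circ> f \<circ> proj\<close> and \<open>f \<mapsto> proj \<circ> f \<circ> inc\<close> identify the small Schur algebra with the corner, because
  \<open>proj \<circ> inc\<close> is the identity and \<open>inc \<circ> proj\<close> is \<open>e\<close>. For fullness, the pairs \<open>down A\<close>, \<open>up A\<close>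
  pass through the small tensor space and are turned into endomorphisms of the large one with \<open>inc\<close> and \<open>proj\<close>.\<close>

lemma schur_is_full_corner:
  "full_corner (base_change \<phi> (schur r act_N)) (base_change \<phi> (schur r act_n))
    (pure_tensor \<phi> (schur r act_N) (corner_idem n N r act_N) 1)
    (base_change_map \<phi> (schur r act_N) (corner_iso n N r act_N)) supports
    (\<lambda>A. pure_tensor \<phi> (schur r act_N) (\<lambda>x \<in> \<Omega>. up A (proj x)) 1)
    (\<lambda>A. pure_tensor \<phi> (schur r act_N) (\<lambda>x \<in> \<Omega>. inc (down A x)) 1)"
proof (rule full_corner_base_change[where \<rho> = "\<lambda>f. \<lambda>x \<in> \<Omega>. proj (f (inc x))"])
  interpret SN: algebra_over "schur r act_N" by (rule N.algebra_over_schur)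
  interpret Sn: algebra_over "schur r act_n" by (rule n.algebra_over_schur)
  note S = schur_simps and lin = inc_lin proj_lin
  have val: "f x \<in> \<Omega>" if "f \<in> carrier (schur r act)" "x \<in> \<Omega>" for f x act
    using that unfolding schur_carrier_iff by (auto dest: intertwinesD(1))
  have ext: "f \<in> extensional \<Omega>" if "f \<in> carrier (schur r act)" for f act
    using that unfolding schur_carrier_iff by blast
  have \<iota>_closed: "corner_iso n N r act_N f \<in> carrier (schur r act_N)" if "f \<in> carrier (schur r act_n)" for f
  proof -
    have "intertwines r act_n act_n f" using that unfolding schur_carrier_iff by blast
    from intertwines_comp[OF intertwines_inc intertwines_comp[OF this intertwines_proj]]
    show ?thesis unfolding corner_iso_eq by (rule N.restrict_in_schur)
  qed
  have \<rho>_closed: "(\<lambda>x \<in> \<Omega>. proj (f (inc x))) \<in> carrier (schur r act_n)" if "f \<in> carrier (schur r act_N)" for f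
  proof -
    have "intertwines r act_N act_N f" using that unfolding schur_carrier_iff by blast
    from intertwines_comp[OF intertwines_proj intertwines_comp[OF this intertwines_inc]]
    show ?thesis by (rule n.restrict_in_schur)
  qed
  show "algebra_over_map (schur r act_n) (schur r act_N) (corner_iso n N r act_N)"
  proof (unfold_locales, rule \<iota>_closed)
    fix f g z assume f: "f \<in> carrier (schur r act_n)"
    show "corner_iso n N r act_N (z \<odot>\<^bsub>schur r act_n\<^esub> f) = z \<odot>\<^bsub>schur r act_N\<^esub> corner_iso n N r act_N f"
      unfolding corner_iso_eq S by (rule restrict_ext) (simp add: lin val[OF f])
    assume g: "g \<in> carrier (schur r act_n)"
    show "corner_iso n N r act_N (f \<oplus>\<^bsub>schur r act_n\<^esub> g) = corner_iso n N r act_N f \<oplus>\<^bsub>schur r act_N\<^esub> corner_iso n N r act_N g"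
      unfolding corner_iso_eq S by (rule restrict_ext) (simp add: lin val[OF f] val[OF g])
  qed
  show "algebra_over_map (schur r act_N) (schur r act_n) (\<lambda>f. \<lambda>x \<in> \<Omega>. proj (f (inc x)))"
  proof (unfold_locales, rule \<rho>_closed)
    fix f g z assume f: "f \<in> carrier (schur r act_N)"
    show "(\<lambda>x \<in> \<Omega>. proj ((z \<odot>\<^bsub>schur r act_N\<^esub> f) (inc x))) = z \<odot>\<^bsub>schur r act_n\<^esub> (\<lambda>x \<in> \<Omega>. proj (f (inc x)))"
      unfolding S by (rule restrict_ext) (simp add: lin val[OF f])
    assume g: "g \<in> carrier (schur r act_N)"
    show "(\<lambda>x \<in> \<Omega>. proj ((f \<oplus>\<^bsub>schur r act_N\<^esub> g) (inc x))) =
        (\<lambda>x \<in> \<Omega>. proj (f (inc x))) \<oplus>\<^bsub>schur r act_n\<^esub> (\<lambda>x \<in> \<Omega>. proj (g (inc x)))"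
      unfolding S by (rule restrict_ext) (simp add: lin val[OF f] val[OF g])
  qed
  show "finite supports" by (rule finite_supports)
  show "corner_iso n N r act_N (f \<otimes>\<^bsub>schur r act_n\<^esub> g) = corner_iso n N r act_N f \<otimes>\<^bsub>schur r act_N\<^esub> corner_iso n N r act_N g"
    if f: "f \<in> carrier (schur r act_n)" and g: "g \<in> carrier (schur r act_n)" for f g
    unfolding corner_iso_eq S by (rule restrict_ext) (simp add: lin val[OF f] val[OF g] proj_inc)
  show "corner_iso n N r act_N \<one>\<^bsub>schur r act_n\<^esub> = corner_idem n N r act_N"
    unfolding corner_iso_eq corner_idem_eq S by (rule restrict_ext) (simp add: lin)
  show "(\<lambda>x \<in> \<Omega>. proj (corner_iso n N r act_N f (inc x))) = f" if f: "f \<in> carrier (schur r act_n)" for f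
    unfolding corner_iso_eq
    by (rule schur_eqI[where r = r]) (use ext[OF f] in \<open>simp_all add: lin proj_inc\<close>)
  show "corner_iso n N r act_N (\<lambda>x \<in> \<Omega>. proj (f (inc x))) =
      corner_idem n N r act_N \<otimes>\<^bsub>schur r act_N\<^esub> f \<otimes>\<^bsub>schur r act_N\<^esub> corner_idem n N r act_N"
    if f: "f \<in> carrier (schur r act_N)" for f
    unfolding corner_iso_eq corner_idem_eq S by (rule restrict_ext) (simp add: lin val[OF f])
  fix A assume A: "A \<in> supports"
  note up = intertwines_up[OF A] and down = intertwines_down[OF A]
  show "(\<lambda>x \<in> \<Omega>. up A (proj x)) \<in> carrier (schur r act_N)"
    by (rule N.restrict_in_schur[OF intertwines_comp[OF up intertwines_proj]])
  show "(\<lambda>x \<in> \<Omega>. inc (down A x)) \<in> carrier (schur r act_N)"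
    by (rule N.restrict_in_schur[OF intertwines_comp[OF intertwines_inc down]])
  show "(\<lambda>x \<in> \<Omega>. up A (proj x)) \<otimes>\<^bsub>schur r act_N\<^esub> corner_idem n N r act_N = (\<lambda>x \<in> \<Omega>. up A (proj x))"
    unfolding corner_idem_eq S by (rule restrict_ext) (simp add: lin proj_inc)
  show "corner_idem n N r act_N \<otimes>\<^bsub>schur r act_N\<^esub> (\<lambda>x \<in> \<Omega>. inc (down A x)) = (\<lambda>x \<in> \<Omega>. inc (down A x))"
    unfolding corner_idem_eq S by (rule restrict_ext) (simp add: lin proj_inc intertwinesD(1)[OF down])
next
  interpret SN: algebra_over "schur r act_N" by (rule N.algebra_over_schur)
  let ?ab = "\<lambda>A. (\<lambda>x \<in> \<Omega>. up A (proj x)) \<otimes>\<^bsub>schur r act_N\<^esub> (\<lambda>x \<in> \<Omega>. inc (down A x))"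
  have terms: "?ab \<in> supports \<rightarrow> carrier (schur r act_N)"
  proof
    fix A assume A: "A \<in> supports"
    show "?ab A \<in> carrier (schur r act_N)"
      by (intro SN.m_closed N.restrict_in_schur intertwines_comp[OF intertwines_up[OF A] intertwines_proj]
          intertwines_comp[OF intertwines_inc intertwines_down[OF A]])
  qed
  show "\<one>\<^bsub>schur r act_N\<^esub> = finsum (schur r act_N) ?ab supports"
  proof (rule schur_eqI[where r = r])
    show "finsum (schur r act_N) ?ab supports \<in> extensional \<Omega>"
      using SN.finsum_closed[OF terms] unfolding schur_carrier_iff by blast
    fix x assume x: "x \<in> \<Omega>"
    have "finsum (schur r act_N) ?ab supports x = (\<Sum>A\<in>supports. ?ab A x)"
      by (rule N.finsum_schur_apply[OF finite_supports terms x])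
    also have "\<dots> = (\<Sum>A\<in>supports. up A (down A x))"
    proof (rule sum.cong[OF refl])
      fix A assume A: "A \<in> supports"
      show "?ab A x = up A (down A x)"
        using x intertwinesD(1)[OF intertwines_down[OF A] x]
        by (simp add: schur_simps proj_inc inc_lin(1))
    qed
    also have "\<dots> = x" by (rule sum_up_down[OF x])
    finally show "\<one>\<^bsub>schur r act_N\<^esub> x = finsum (schur r act_N) ?ab supports x" using x by (simp add: schur_simps)
  qed (simp add: schur_simps)
qed

end

theorem proposition4p13:
  fixes n N r l' :: nat and \<epsilon> :: complex
    and act_n act_N :: "tens \<Rightarrow> hecke_elt \<Rightarrow> tens"
  assumes "0 < n" and "0 < N" and "0 < r"
    and "primitive_root_of_unity l' \<epsilon>"
    and "affine_tensor_module n r act_n"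
    and "affine_tensor_module N r act_N"
    and "N \<ge> n" and "n \<ge> r"
  shows "equivalence_of_categories
           (fdmod (schur_at \<epsilon> r act_N) :: ((schur_eps, 'm) module, 'm \<Rightarrow> 'm) cat)
           (fdmod (schur_at \<epsilon> r act_n) :: ((schur_eps, 'm) module, 'm \<Rightarrow> 'm) cat)
           (G_obj \<epsilon> n N r act_N)
           (G_map \<epsilon> n N r act_N)"
proof -
  interpret corner_of_schur n N r act_n act_N
    using assms by (simp add: corner_of_schur_def corner_of_schur_axioms_def)
  interpret full_corner "schur_at \<epsilon> r act_N" "schur_at \<epsilon> r act_n" "corner_idem_at \<epsilon> n N r act_N"
    "corner_iso_at \<epsilon> n N r act_N" supports
    "\<lambda>A. pure_tensor (laurent_eval \<epsilon>) (schur r act_N) (\<lambda>x \<in> \<Omega>. up A (proj x)) 1"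
    "\<lambda>A. pure_tensor (laurent_eval \<epsilon>) (schur r act_N) (\<lambda>x \<in> \<Omega>. inc (down A x)) 1"
    unfolding schur_at_def corner_idem_at_def corner_iso_at_def by (rule schur_is_full_corner)
  have obj: "(G_obj \<epsilon> n N r act_N :: (schur_eps, 'm) module \<Rightarrow> _) =
      corner_obj (corner_idem_at \<epsilon> n N r act_N) (corner_iso_at \<epsilon> n N r act_N)"
    by (rule ext) (simp add: G_obj_def corner_obj_def)
  have map: "(G_map \<epsilon> n N r act_N :: (schur_eps, 'm) module \<Rightarrow> _) = corner_map"
    by (intro ext) (simp add: G_map_def obj)
  show ?thesis unfolding map unfolding obj by (rule corner_equivalence)
qed

end
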